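(* Fix $\alpha>1$. For integers $K,N\ge1$ with $M=\alpha KN$ an integer, let $\bar\Delta_{\mathrm{DPC\text{-}ZF}}(\alpha,KN)=\frac{3}{KN}\bar\beta_{\mathrm{DPC\text{-}ZF}}(M,KN)$ (in dB), where $\bar\beta_{\mathrm{DPC\text{-}ZF}}(M,KN)$ is the expected asymptotic sum-rate loss of zero-forcing relative to dirty paper coding. Then, as $KN\to\infty$ (along values for which $\alpha KN$ is an integer), $$\bar\Delta_{\mathrm{DPC\text{-}ZF}}(\alpha,KN)\to -3\left(\log_2 e+\alpha\log_2\left(1-\frac1\alpha\right)\right)\quad\text{(dB)}.$$
   Context: MIMO broadcast channel: $M$ transmit antennas, $K$ users with $N$ antennas each, $M\ge KN$, stacked channel $\mathbf H\in\mathbb C^{KN\times M}$ with i.i.d. zero-mean unit-variance circularly-symmetric complex Gaussian entries, unit noise, total power $P$. $\mathcal C_{\mathrm{DPC}}(\mathbf H,P)=\max\{\log_2|\mathbf I+\sum_k\mathbf H_k^H\mathbf Q_k\mathbf H_k| : \mathbf Q_k\succeq0\ (N\times N),\ \sum_k\mathrm{tr}\mathbf Q_k\le P\}$. For each row $\mathbf h_{k,n}$ of $\mathbf H$, $|g_{k,n}|$ is the norm of the projection of $\mathbf h_{k,n}$ onto the orthogonal complement of the span of the other rows, and $\mathcal C_{\mathrm{ZF}}(\mathbf H,P)=\max_{P_{k,n}\ge0,\sum P_{k,n}\le P}\sum_{k,n}\log_2(1+P_{k,n}|g_{k,n}|^2)$. Then $\bar\beta_{\mathrm{DPC\text{-}ZF}}(M,KN)=\mathbb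 E_{\mathbf H}[\lim_{P\to\infty}(\mathcal C_{\mathrm{DPC}}(\mathbf H,P)-\mathcal C_{\mathrm{ZF}}(\mathbf H,P))]$ (it depends only on $M$ and $KN$). *)

theory Defs
  imports "HOL-Probability.Probability" "Jordan_Normal_Form.Schur_Decomposition"
begin

text \<open>Circularly-symmetric complex Gaussian with zero mean and unit variance
  (E |z|^2 = 1): density exp(-|z|^2)/pi w.r.t. Lebesgue measure on the complex plane.\<close>
definition cgauss :: "complex measure" where
  "cgauss = density lborel (\<lambda>z. ennreal (exp (- (cmod z)\<^sup>2) / pi))"

definition channel_law :: "nat \<Rightarrow> nat \<Rightarrow> (nat \<times> nat \<Rightarrow> complex) measure" where
  "channel_law R M = PiM ({..<R} \<times> {..<M}) (\<lambda>_. cgauss)"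

definition chan_mat :: "nat \<Rightarrow> nat \<Rightarrow> (nat \<times> nat \<Rightarrow> complex) \<Rightarrow> complex mat" where
  "chan_mat R M h = mat R M h"

definition user_block :: "complex mat \<Rightarrow> nat \<Rightarrow> nat \<Rightarrow> complex mat" where
  "user_block H N k = mat N (dim_col H) (\<lambda>(i, j). H $$ (k * N + i, j))"

definition mtrace :: "complex mat \<Rightarrow> complex" where
  "mtrace Q = (\<Sum>i<dim_row Q. Q $$ (i, i))"

definition psd :: "nat \<Rightarrow> complex mat \<Rightarrow> bool" where
  "psd n Q \<longleftrightarrow> Q \<in> carrier_mat n n \<and> mat_adjoint Q = Q \<and>
     (\<forall>v \<in> carrier_vec n. 0 \<le> Re (conjugate v \<bullet> (Q *\<^sub>v v)))"

definition C_DPC :: "nat \<Rightarrow> nat \<Rightarrow> nat \<Rightarrow> complex mat \<Rightarrow> real \<Rightarrow> real" where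
  "C_DPC K N M H P = Sup {log 2 (Re (det (1\<^sub>m M +
        mat M M (\<lambda>(i, j). \<Sum>k<K. (mat_adjoint (user_block H N k) * Q k * user_block H N k) $$ (i, j)))))
     | Q. (\<forall>k<K. psd N (Q k)) \<and> (\<Sum>k<K. Re (mtrace (Q k))) \<le> P}"

definition perp_proj :: "nat \<Rightarrow> nat \<Rightarrow> complex mat \<Rightarrow> nat \<Rightarrow> complex vec" where
  "perp_proj R M H r = (THE g. g \<in> carrier_vec M \<and>
      (\<forall>r'<R. r' \<noteq> r \<longrightarrow> conjugate (row H r') \<bullet> g = 0) \<and>
      (\<exists>c. row H r - g = vec M (\<lambda>j. \<Sum>r'\<in>{..<R} - {r}. c r' * H $$ (r', j))))"

definition vnorm :: "complex vec \<Rightarrow> real" where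
  "vnorm v = sqrt (\<Sum>j<dim_vec v. (cmod (v $ j))\<^sup>2)"

definition zf_gain :: "nat \<Rightarrow> nat \<Rightarrow> complex mat \<Rightarrow> nat \<Rightarrow> real" where
  "zf_gain R M H r = vnorm (perp_proj R M H r)"

definition C_ZF :: "nat \<Rightarrow> nat \<Rightarrow> complex mat \<Rightarrow> real \<Rightarrow> real" where
  "C_ZF R M H P = Sup {(\<Sum>r<R. log 2 (1 + p r * (zf_gain R M H r)\<^sup>2))
     | p. (\<forall>r<R. 0 \<le> p r) \<and> (\<Sum>r<R. p r) \<le> P}"

definition beta_DPC_ZF :: "nat \<Rightarrow> nat \<Rightarrow> nat \<Rightarrow> real" where
  "beta_DPC_ZF K N M = (\<integral>h. Lim at_top (\<lambda>P. C_DPC K N M (chan_mat (K * N) M h) P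
                                      - C_ZF (K * N) M (chan_mat (K * N) M h) P)
                       \<partial>channel_law (K * N) M)"

definition Delta_DPC_ZF :: "nat \<Rightarrow> nat \<Rightarrow> nat \<Rightarrow> real" where
  "Delta_DPC_ZF K N M = 3 / real (K * N) * beta_DPC_ZF K N M"

end

theory Submission
  imports Defs "HOL-Real_Asymp.Real_Asymp"
begin

text \<open>
  Let G be the Gram matrix of the R = KN channel rows and G(r) the one with row r removed.
  Equal power allocation and the arithmetic-geometric mean inequality (on the eigenvalues of
  G^(-1) + Q for dirty paper coding) pin down both capacities up to o(1) as P tends to infinity,
  and the zero-forcing gains satisfy |g(r)|^2 = det G / det G(r).  Hence the limiting loss is
  log det G - (sum over r of log det G - log det G(r)).

  Rotating the columns so that the last row becomes a multiple of the last unit vector shows that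
  det G has the law of t * det G', with t Gamma(M)-distributed and G' an independent Gram matrix of
  size R - 1 built from M - 1 columns.  So E ln det G is a sum of values \<psi>(M), ..., \<psi>(M - R + 1) of
  the digamma function, and \<psi>(n + 1) = \<psi>(n) + 1/n reduces the loss to harmonic numbers.

  The limit in P has to be measurable on the null set of degenerate channels as well, since the
  Bochner integral of a non-measurable function is 0.  There C(tP) \<le> C(P) + n log t allows P to be
  restricted to the integers, and for fixed P the capacities are semicontinuous in the channel.
\<close>

subsection \<open>Positive semidefinite matrices\<close>

text \<open>The dirty paper upper bound uses only that the joint covariance Q is positive
  semidefinite with trace at most P, while the nearly optimal multiple of the identity is itself
  block diagonal; so the split into users leaves no trace in the limit. Factoring det (1 + G Q) =
  det G * det (G^(-1) + Q) turns the noise into a shift of the power by the constant trace of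
  G^(-1), which the logarithm forgets as P grows. For zero forcing the sum of 1 / |g(r)|^2 is the
  corresponding shift.

  The rotation that aligns the last row depends on that row. Fubini's theorem fixes the row first,
  and for the other rows the rotation is then a constant unitary map. It is built from rotations of
  two columns, each a product of shears, so translation invariance of Lebesgue measure suffices.

  Deleting a row removes only the last term \<psi>(M - R + 1) from the sum of digamma values. The
  loss thus compares R different values with R copies of that one; \<psi>(1) cancels and is never
  evaluated. What remains is (M (H(M) - H(M - R)) - R) / ln 2 with harmonic numbers H, and M / R =
  \<alpha> yields the limit.\<close>

lemma index_mat_adjoint [simp]:
  fixes A :: "complex mat"
  shows "i < dim_col A \<Longrightarrow> j < dim_row A \<Longrightarrow> mat_adjoint A $$ (i, j) = cnj (A $$ (j, i))"
    and "dim_row (mat_adjoint A) = dim_col A" and "dim_col (mat_adjoint A) = dim_row A"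
  unfolding mat_adjoint_def by (auto simp: mat_of_rows_def)

lemma mat_adjoint_carrier [simp]:
  "(A :: complex mat) \<in> carrier_mat n m \<Longrightarrow> mat_adjoint A \<in> carrier_mat m n"
  by (auto intro!: carrier_matI)

lemma mat_adjoint_adjoint [simp]: "mat_adjoint (mat_adjoint A) = (A :: complex mat)"
  by (intro eq_matI) auto

lemma mat_adjoint_mult:
  fixes A B :: "complex mat"
  assumes "A \<in> carrier_mat n m" "B \<in> carrier_mat m p"
  shows "mat_adjoint (A * B) = mat_adjoint B * mat_adjoint A"
  using assms by (intro eq_matI) (auto simp: scalar_prod_def mult.commute intro!: sum.cong)

lemma quadratic_form_eq_sum:
  fixes Q :: "complex mat"
  assumes "Q \<in> carrier_mat n n" "v \<in> carrier_vec n"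
  shows "conjugate v \<bullet> (Q *\<^sub>v v) = (\<Sum>i<n. \<Sum>j<n. cnj (v $ i) * Q $$ (i, j) * v $ j)"
  using assms by (auto simp: scalar_prod_def atLeast0LessThan sum_distrib_left mult.assoc intro!: sum.cong)

text \<open>Closure properties of \<open>psd\<close> amount to rearranging double sums, so the
  definition is restated with entries, and with plain functions as test vectors.\<close>

lemma psd_iff:
  "psd n Q \<longleftrightarrow> Q \<in> carrier_mat n n \<and> (\<forall>i<n. \<forall>j<n. cnj (Q $$ (i, j)) = Q $$ (j, i)) \<and>
     (\<forall>f. 0 \<le> Re (\<Sum>i<n. \<Sum>j<n. cnj (f i) * Q $$ (i, j) * f j))"
proof (cases "Q \<in> carrier_mat n n")
  case Q: True
  have adj: "mat_adjoint Q = Q \<longleftrightarrow> (\<forall>i<n. \<forall>j<n. cnj (Q $$ (i, j)) = Q $$ (j, i))"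
  proof
    assume h: "mat_adjoint Q = Q"
    have "cnj (Q $$ (i, j)) = mat_adjoint Q $$ (j, i)" if "i < n" "j < n" for i j
      using Q that by auto
    then show "\<forall>i<n. \<forall>j<n. cnj (Q $$ (i, j)) = Q $$ (j, i)" unfolding h by auto
  next
    assume h: "\<forall>i<n. \<forall>j<n. cnj (Q $$ (i, j)) = Q $$ (j, i)"
    show "mat_adjoint Q = Q" using Q h by (intro eq_matI) auto
  qed
  have "(\<forall>v \<in> carrier_vec n. 0 \<le> Re (conjugate v \<bullet> (Q *\<^sub>v v))) \<longleftrightarrow>
     (\<forall>f. 0 \<le> Re (\<Sum>i<n. \<Sum>j<n. cnj (f i) * Q $$ (i, j) * f j))"
  proof safe
    fix f :: "nat \<Rightarrow> complex"
    assume "\<forall>v \<in> carrier_vec n. 0 \<le> Re (conjugate v \<bullet> (Q *\<^sub>v v))"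
    then have "0 \<le> Re (conjugate (vec n f) \<bullet> (Q *\<^sub>v vec n f))" by auto
    then show "0 \<le> Re (\<Sum>i<n. \<Sum>j<n. cnj (f i) * Q $$ (i, j) * f j)"
      by (subst (asm) quadratic_form_eq_sum[OF Q]) auto
  next
    fix v :: "complex vec"
    assume "\<forall>f. 0 \<le> Re (\<Sum>i<n. \<Sum>j<n. cnj (f i) * Q $$ (i, j) * f j)" "v \<in> carrier_vec n"
    then show "0 \<le> Re (conjugate v \<bullet> (Q *\<^sub>v v))"
      using quadratic_form_eq_sum[OF Q, of v] by auto
  qed
  then show ?thesis using Q adj by (auto simp: psd_def)
qed (auto simp: psd_def)

lemma psdI:
  assumes "Q \<in> carrier_mat n n" "\<And>i j. i < n \<Longrightarrow> j < n \<Longrightarrow> cnj (Q $$ (i, j)) = Q $$ (j, i)"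
    "\<And>f. 0 \<le> Re (\<Sum>i<n. \<Sum>j<n. cnj (f i) * Q $$ (i, j) * f j)"
  shows "psd n Q"
  using assms by (simp add: psd_iff)

lemma
  assumes "psd n Q"
  shows psd_carrier: "Q \<in> carrier_mat n n"
    and psd_hermitian: "i < n \<Longrightarrow> j < n \<Longrightarrow> cnj (Q $$ (i, j)) = Q $$ (j, i)"
    and psd_form_nonneg: "0 \<le> Re (\<Sum>i<n. \<Sum>j<n. cnj (f i) * Q $$ (i, j) * f j)"
  using assms by (auto simp: psd_iff)

lemma psd_add: "psd n A \<Longrightarrow> psd n B \<Longrightarrow> psd n (A + B)"
proof (rule psdI)
  fix f :: "nat \<Rightarrow> complex" assume A: "psd n A" and B: "psd n B"
  have "(\<Sum>i<n. \<Sum>j<n. cnj (f i) * (A + B) $$ (i, j) * f j) =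
    (\<Sum>i<n. \<Sum>j<n. cnj (f i) * A $$ (i, j) * f j) + (\<Sum>i<n. \<Sum>j<n. cnj (f i) * B $$ (i, j) * f j)"
    unfolding sum.distrib[symmetric]
    using psd_carrier[OF A] psd_carrier[OF B] by (intro sum.cong refl) (auto simp: algebra_simps)
  then show "0 \<le> Re (\<Sum>i<n. \<Sum>j<n. cnj (f i) * (A + B) $$ (i, j) * f j)"
    using psd_form_nonneg[OF A, of f] psd_form_nonneg[OF B, of f] by simp
qed (use psd_carrier[of n A] psd_carrier[of n B] psd_hermitian[of n A] psd_hermitian[of n B] in auto)

lemma psd_smult: "psd n A \<Longrightarrow> 0 \<le> c \<Longrightarrow> psd n (complex_of_real c \<cdot>\<^sub>m A)"
proof (rule psdI)
  fix f :: "nat \<Rightarrow> complex" assume A: "psd n A" "0 \<le> c"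
  have "(\<Sum>i<n. \<Sum>j<n. cnj (f i) * (complex_of_real c \<cdot>\<^sub>m A) $$ (i, j) * f j) =
    complex_of_real c * (\<Sum>i<n. \<Sum>j<n. cnj (f i) * A $$ (i, j) * f j)"
    using psd_carrier[OF A(1)] by (auto simp: sum_distrib_left algebra_simps intro!: sum.cong)
  then show "0 \<le> Re (\<Sum>i<n. \<Sum>j<n. cnj (f i) * (complex_of_real c \<cdot>\<^sub>m A) $$ (i, j) * f j)"
    using psd_form_nonneg[OF A(1), of f] A(2) by simp
next
  fix i j assume A: "psd n A" "0 \<le> c" "i < n" "j < n"
  then show "cnj ((complex_of_real c \<cdot>\<^sub>m A) $$ (i, j)) = (complex_of_real c \<cdot>\<^sub>m A) $$ (j, i)"
    using psd_carrier[OF A(1)] psd_hermitian[OF A(1) A(3,4)] by auto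
qed (auto simp: psd_carrier)

text \<open>At an eigenvector v the quadratic form equals e * |v|^2. It is real because A is
  Hermitian and nonnegative because A is \<open>psd\<close>, and |v|^2 is positive.\<close>

lemma psd_eigenvalue:
  assumes A: "psd n A" and e: "eigenvalue A e"
  shows "e = complex_of_real (Re e)" "0 \<le> Re e"
proof -
  have Ac: "A \<in> carrier_mat n n" using A by (rule psd_carrier)
  obtain v where v: "v \<in> carrier_vec n" "v \<noteq> 0\<^sub>v n" "A *\<^sub>v v = e \<cdot>\<^sub>v v"
    using e Ac unfolding eigenvalue_def eigenvector_def by auto
  define s where "s = (\<Sum>i<n. (cmod (v $ i))\<^sup>2)"
  have "\<exists>i<n. v $ i \<noteq> 0" using v(1,2) by (metis carrier_vecD eq_vecI index_zero_vec)
  then obtain i where i: "i < n" "v $ i \<noteq> 0" by auto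
  have s: "s > 0" unfolding s_def
    by (rule sum_pos2[of _ i]) (use i in auto)
  define q where "q = (\<Sum>i<n. \<Sum>j<n. cnj (v $ i) * A $$ (i, j) * v $ j)"
  have "q = conjugate v \<bullet> (A *\<^sub>v v)" unfolding q_def using quadratic_form_eq_sum[OF Ac v(1)] by simp
  also have "\<dots> = e * (conjugate v \<bullet> v)" using v(1,3) by simp
  also have "conjugate v \<bullet> v = complex_of_real s"
    using v(1) by (auto simp: scalar_prod_def s_def atLeast0LessThan mult.commute complex_norm_square[symmetric] simp del: of_real_power intro!: sum.cong)
  finally have qe: "q = e * of_real s" .
  have "cnj q = (\<Sum>i<n. \<Sum>j<n. v $ i * cnj (A $$ (i, j)) * cnj (v $ j))"
    by (simp add: q_def)
  also have "\<dots> = (\<Sum>i<n. \<Sum>j<n. v $ i * A $$ (j, i) * cnj (v $ j))"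
    using psd_hermitian[OF A] by simp
  also have "\<dots> = q" unfolding q_def by (subst sum.swap) (simp add: ac_simps)
  finally have "Im q = 0" by (simp add: complex_eq_iff)
  moreover have "0 \<le> Re q" unfolding q_def by (rule psd_form_nonneg[OF A])
  ultimately show "e = complex_of_real (Re e)" "0 \<le> Re e"
    using s qe by (auto simp: complex_eq_iff zero_le_mult_iff)
qed

lemma mtrace_mult_commute:
  assumes "A \<in> carrier_mat n m" "B \<in> carrier_mat m n"
  shows "mtrace (A * B) = mtrace (B * A)"
proof -
  have "mtrace (A * B) = (\<Sum>i<n. \<Sum>j<m. A $$ (i, j) * B $$ (j, i))"
    using assms by (auto simp: mtrace_def scalar_prod_def atLeast0LessThan intro!: sum.cong)
  also have "\<dots> = (\<Sum>j<m. \<Sum>i<n. B $$ (j, i) * A $$ (i, j))"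
    by (subst sum.swap) (simp add: mult.commute)
  also have "\<dots> = mtrace (B * A)"
    using assms by (auto simp: mtrace_def scalar_prod_def atLeast0LessThan intro!: sum.cong)
  finally show ?thesis .
qed

text \<open>Schur triangularization lists the eigenvalues with multiplicity, and determinant and
  trace are invariant under similarity. The shift by t is included so that bounds for det A and for
  det (1 + t A) come from the same list \<open>l\<close>.\<close>

lemma psd_spectrum:
  assumes A: "psd n A"
  obtains l :: "nat \<Rightarrow> real" where
    "\<And>i. i < n \<Longrightarrow> 0 \<le> l i"
    "\<And>t. det (complex_of_real t \<cdot>\<^sub>m 1\<^sub>m n + A) = complex_of_real (\<Prod>i<n. t + l i)"
    "mtrace A = complex_of_real (\<Sum>i<n. l i)"
proof -
  have Ac: "A \<in> carrier_mat n n" using A by (rule psd_carrier)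
  obtain es where es: "char_poly A = (\<Prod>a\<leftarrow>es. [:- a, 1:])" "length es = n"
    using char_poly_factorized[OF Ac] by auto
  obtain B P Q where "schur_decomposition A es = (B, P, Q)" by (metis prod_cases3)
  then have sim: "similar_mat_wit A B P Q" and ut: "upper_triangular B" and diag: "diag_mat B = es"
    using schur_decomposition[OF Ac es(1)] by auto
  have c: "B \<in> carrier_mat n n" "P \<in> carrier_mat n n" "Q \<in> carrier_mat n n"
    and PQ: "P * Q = 1\<^sub>m n" and QP: "Q * P = 1\<^sub>m n" and APBQ: "A = P * B * Q"
    using sim Ac unfolding similar_mat_wit_def Let_def by auto
  define l where "l i = Re (B $$ (i, i))" for i
  have Bii: "B $$ (i, i) \<in> set es" if "i < n" for i
    using that c(1) by (auto simp: diag[symmetric] diag_mat_def)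
  have ev: "eigenvalue A e" if "e \<in> set es" for e
    using that by (auto simp: eigenvalue_root_char_poly[OF Ac] es(1) poly_prod_list prod_list_zero_iff)
  have l: "B $$ (i, i) = complex_of_real (l i)" "0 \<le> l i" if "i < n" for i
    using psd_eigenvalue[OF A ev[OF Bii[OF that]]] by (simp_all add: l_def)
  show ?thesis
  proof (rule that[of l])
    show "0 \<le> l i" if "i < n" for i using l that by auto
    fix t :: real
    let ?T = "complex_of_real t \<cdot>\<^sub>m 1\<^sub>m n :: complex mat"
    have "P * (?T + B) * Q = P * ?T * Q + P * B * Q"
      using c by (subst mult_add_distrib_mat[of P n n _ n], auto, subst add_mult_distrib_mat[of _ n n _ _ n], auto)
    also have "P * ?T * Q = complex_of_real t \<cdot>\<^sub>m (P * Q)"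
      using c mult_smult_distrib[OF c(2) one_carrier_mat, of "complex_of_real t"]
        mult_smult_assoc_mat[OF c(2,3), of "complex_of_real t"] by simp
    also have "\<dots> = ?T" by (simp add: PQ)
    finally have "similar_mat (?T + A) (?T + B)"
      unfolding similar_mat_def similar_mat_wit_def Let_def using c PQ QP Ac APBQ
      by (intro exI[of _ P] exI[of _ Q]) auto
    then have "det (?T + A) = det (?T + B)" by (rule det_similar)
    also have "\<dots> = prod_list (diag_mat (?T + B))"
      by (rule det_upper_triangular[of _ n]) (use ut c in \<open>auto simp: upper_triangular_def\<close>)
    also have "\<dots> = (\<Prod>i<n. (?T + B) $$ (i, i))"
      using c by (simp add: prod_list_diag_prod atLeast0LessThan)
    also have "\<dots> = complex_of_real (\<Prod>i<n. t + l i)"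
      using c l by (auto intro!: prod.cong)
    finally show "det (?T + A) = complex_of_real (\<Prod>i<n. t + l i)" .
    have "mtrace A = mtrace (Q * (P * B))" unfolding APBQ
      by (rule mtrace_mult_commute[of _ n n]) (use c in auto)
    also have "Q * (P * B) = B"
      using c QP by (simp add: assoc_mult_mat[of Q n n P n B n, symmetric])
    also have "mtrace B = complex_of_real (\<Sum>i<n. l i)"
      using c l by (auto simp: mtrace_def)
    finally show "mtrace A = complex_of_real (\<Sum>i<n. l i)" .
  qed
qed

lemma index_congruence:
  fixes B :: "complex mat"
  assumes Q: "Q \<in> carrier_mat n n" and B: "B \<in> carrier_mat n m" and ij: "i < m" "j < m"
  shows "(mat_adjoint B * Q * B) $$ (i, j) = (\<Sum>a<n. \<Sum>b<n. cnj (B $$ (a, i)) * Q $$ (a, b) * B $$ (b, j))"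
proof -
  have "(mat_adjoint B * Q * B) $$ (i, j) = (\<Sum>b<n. (\<Sum>a<n. cnj (B $$ (a, i)) * Q $$ (a, b)) * B $$ (b, j))"
    using ij B Q by (auto simp: scalar_prod_def atLeast0LessThan intro!: sum.cong)
  then show ?thesis by (subst sum.swap) (simp add: sum_distrib_right)
qed

text \<open>The quadratic form of the congruent matrix at f is the form of Q at B f, which the proof
  calls \<open>g\<close>.\<close>

lemma psd_congruence:
  fixes B :: "complex mat"
  assumes Q: "psd n Q" and B: "B \<in> carrier_mat n m"
  shows "psd m (mat_adjoint B * Q * B)"
proof (rule psdI)
  have Qc: "Q \<in> carrier_mat n n" using Q by (rule psd_carrier)
  note entry = index_congruence[OF Qc B]
  show "mat_adjoint B * Q * B \<in> carrier_mat m m" using B Qc by auto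
  show "cnj ((mat_adjoint B * Q * B) $$ (j, i)) = (mat_adjoint B * Q * B) $$ (i, j)"
    if ij: "j < m" "i < m" for i j
  proof -
    have "cnj ((mat_adjoint B * Q * B) $$ (j, i)) = (\<Sum>a<n. \<Sum>b<n. B $$ (a, j) * cnj (Q $$ (a, b)) * cnj (B $$ (b, i)))"
      using ij by (simp add: entry)
    also have "\<dots> = (\<Sum>a<n. \<Sum>b<n. B $$ (a, j) * Q $$ (b, a) * cnj (B $$ (b, i)))"
      using psd_hermitian[OF Q] by simp
    also have "\<dots> = (mat_adjoint B * Q * B) $$ (i, j)"
      unfolding entry[OF ij(2,1)] by (subst sum.swap) (simp add: ac_simps)
    finally show ?thesis by simp
  qed
  fix f
  define g where "g a = (\<Sum>i<m. B $$ (a, i) * f i)" for a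
  have "(\<Sum>i<m. \<Sum>j<m. cnj (f i) * (mat_adjoint B * Q * B) $$ (i, j) * f j) =
    (\<Sum>i<m. \<Sum>j<m. \<Sum>a<n. \<Sum>b<n. cnj (f i) * cnj (B $$ (a, i)) * Q $$ (a, b) * (B $$ (b, j) * f j))"
    by (simp add: entry sum_distrib_left sum_distrib_right ac_simps)
  also have "\<dots> = (\<Sum>i<m. \<Sum>a<n. \<Sum>j<m. \<Sum>b<n. cnj (f i) * cnj (B $$ (a, i)) * Q $$ (a, b) * (B $$ (b, j) * f j))"
    by (intro sum.cong refl sum.swap)
  also have "\<dots> = (\<Sum>a<n. \<Sum>i<m. \<Sum>b<n. \<Sum>j<m. cnj (f i) * cnj (B $$ (a, i)) * Q $$ (a, b) * (B $$ (b, j) * f j))"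
    by (subst sum.swap) (intro sum.cong refl sum.swap)
  also have "\<dots> = (\<Sum>a<n. \<Sum>b<n. \<Sum>i<m. \<Sum>j<m. cnj (f i) * cnj (B $$ (a, i)) * Q $$ (a, b) * (B $$ (b, j) * f j))"
    by (intro sum.cong refl sum.swap)
  also have "\<dots> = (\<Sum>a<n. \<Sum>b<n. cnj (g a) * Q $$ (a, b) * g b)"
    by (simp add: g_def sum_distrib_left sum_distrib_right ac_simps)
  finally show "0 \<le> Re (\<Sum>i<m. \<Sum>j<m. cnj (f i) * (mat_adjoint B * Q * B) $$ (i, j) * f j)"
    using psd_form_nonneg[OF Q, of g] by simp
qed

lemma psd_one: "psd n (1\<^sub>m n)"
proof (rule psdI)
  fix f :: "nat \<Rightarrow> complex"
  have "(\<Sum>i<n. \<Sum>j<n. cnj (f i) * 1\<^sub>m n $$ (i, j) * f j) = (\<Sum>i<n. \<Sum>j<n. if j = i then cnj (f i) * f i else 0)"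
    by (intro sum.cong refl) auto
  also have "\<dots> = of_real (\<Sum>i<n. (cmod (f i))\<^sup>2)"
    by (simp add: complex_norm_square mult.commute del: of_real_power)
  finally show "0 \<le> Re (\<Sum>i<n. \<Sum>j<n. cnj (f i) * 1\<^sub>m n $$ (i, j) * f j)"
    by (simp add: sum_nonneg)
qed auto

text \<open>Covariances of bounded trace have bounded entries, which keeps the suprema below finite.
  The bound also shows that traces are nonnegative.\<close>

lemma cmod_psd_le:
  assumes Q: "psd n Q" and ij: "i < n" "j < n"
  shows "cmod (Q $$ (i, j)) \<le> Re (mtrace Q)"
proof -
  have Qc: "Q \<in> carrier_mat n n" using Q by (rule psd_carrier)
  have diag: "0 \<le> Re (Q $$ (k, k))" if "k < n" for k
  proof -
    have "(\<Sum>a<n. \<Sum>b<n. cnj (if a = k then 1 else 0) * Q $$ (a, b) * (if b = k then 1 else 0)) = Q $$ (k, k)"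
      using that by (subst sum.remove[of _ k]) (auto simp: sum.delta' if_distrib if_distribR cong: if_cong)
    then show ?thesis using psd_form_nonneg[OF Q, of "\<lambda>a. if a = k then 1 else 0"] by metis
  qed
  have tr: "Re (Q $$ (k, k)) \<le> Re (mtrace Q)" if "k < n" for k
    using member_le_sum[of k "{..<n}" "\<lambda>k. Re (Q $$ (k, k))"] that diag Qc by (auto simp: mtrace_def)
  show ?thesis
  proof (cases "i = j")
    case True
    have "Im (Q $$ (j, j)) = 0" using psd_hermitian[OF Q ij(2) ij(2)] by (simp add: complex_eq_iff)
    then have "cmod (Q $$ (j, j)) = Re (Q $$ (j, j))"
      using diag[OF ij(2)] by (simp add: cmod_eq_Re)
    then show ?thesis using True tr[OF ij(2)] by simp
  next
    case False
    define z where "z = Q $$ (i, j)"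
    \<comment> \<open>The phase \<open>c\<close> makes c * z = -|z|, so the form at e_i + c e_j is
      Q_ii + Q_jj - 2 |z|. The value 1 at z = 0 keeps |c| = 1.\<close>
    define c where "c = (if z = 0 then 1 else - cnj z / cmod z)"
    have c: "cmod c = 1" by (auto simp: c_def norm_divide)
    have cz: "c * z = - complex_of_real (cmod z)"
      by (auto simp: c_def mult.commute complex_norm_square[symmetric] power2_eq_square)
    define f where "f = (\<lambda>a. if a = i then 1 else if a = j then c else 0 :: complex)"
    have s: "(\<Sum>a<n. F a) = F i + F j" if "\<And>a. a \<noteq> i \<Longrightarrow> a \<noteq> j \<Longrightarrow> F a = 0" for F :: "nat \<Rightarrow> complex"
    proof -
      have "(\<Sum>a<n. F a) = (\<Sum>a\<in>{i, j}. F a)"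
        by (rule sum.mono_neutral_right) (use ij that in auto)
      then show ?thesis using False by simp
    qed
    have "(\<Sum>a<n. \<Sum>b<n. cnj (f a) * Q $$ (a, b) * f b) =
       Q $$ (i, i) + c * z + cnj c * (Q $$ (j, i) + c * Q $$ (j, j))"
      using False by (simp add: s f_def z_def algebra_simps)
    also have "\<dots> = Q $$ (i, i) + c * z + cnj (c * z) + of_real ((cmod c)\<^sup>2) * Q $$ (j, j)"
      using psd_hermitian[OF Q ij] by (simp add: z_def algebra_simps complex_norm_square del: of_real_power)
    also have "\<dots> = Q $$ (i, i) + Q $$ (j, j) - 2 * of_real (cmod z)" by (simp add: c cz)
    finally have "0 \<le> Re (Q $$ (i, i)) + Re (Q $$ (j, j)) - 2 * cmod z"
      using psd_form_nonneg[OF Q, of f] by simp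
    then show ?thesis using tr[OF ij(1)] tr[OF ij(2)] by (simp add: z_def)
  qed
qed

text \<open>Sylvester's identity: the two products of the block matrices \<open>?X\<close> and
  \<open>?Y\<close> are both block triangular, one with 1 + A B on the diagonal, the other with 1 +
  B A, and they have equal determinants.\<close>

lemma det_one_plus_mult_commute:
  fixes A B :: "complex mat"
  assumes A: "A \<in> carrier_mat n m" and B: "B \<in> carrier_mat m n"
  shows "det (1\<^sub>m n + A * B) = det (1\<^sub>m m + B * A)"
proof -
  let ?X = "four_block_mat (1\<^sub>m n) (- A) B (1\<^sub>m m)"
  let ?Y = "four_block_mat (1\<^sub>m n) (0\<^sub>m n m) (- B) (1\<^sub>m m)"
  have X: "?X \<in> carrier_mat (n + m) (n + m)" and Y: "?Y \<in> carrier_mat (n + m) (n + m)"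
    using A B by auto
  have 1: "?X * ?Y = four_block_mat (1\<^sub>m n + A * B) (- A) (0\<^sub>m m n) (1\<^sub>m m)"
    by (subst mult_four_block_mat[of _ n n _ m _ m]) (use A B in auto)
  have 2: "?Y * ?X = four_block_mat (1\<^sub>m n) (- A) (0\<^sub>m m n) (1\<^sub>m m + B * A)"
    by (subst mult_four_block_mat[of _ n n _ m _ m]) (use A B in \<open>auto intro!: cong_four_block_mat comm_add_mat\<close>)
  have "det (1\<^sub>m n + A * B) = det (?X * ?Y)"
    unfolding 1 by (subst det_four_block_mat_lower_left_zero[of _ n _ m]) (use A B in auto)
  also have "\<dots> = det (?Y * ?X)" using det_mult[OF X Y] det_mult[OF Y X] by simp
  also have "\<dots> = det (1\<^sub>m m + B * A)"
    unfolding 2 by (subst det_four_block_mat_lower_left_zero[of _ n _ m]) (use A B in auto)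
  finally show ?thesis .
qed

subsection \<open>The dirty paper coding capacity\<close>

text \<open>Everything is read off from the eigenvalues. The first bound keeps arguments of
  logarithms positive, the second makes the rate bounded, the third yields C(tP) \<le> C(P) + n log
  t, the fourth the lower bound at equal powers, and the last one is the arithmetic-geometric mean
  inequality.\<close>

lemma psd_det_one_plus:
  assumes X: "psd n X"
  shows "1 \<le> Re (det (1\<^sub>m n + X))"
    and "Re (det (1\<^sub>m n + X)) \<le> exp (Re (mtrace X))"
    and "1 \<le> t \<Longrightarrow> Re (det (1\<^sub>m n + complex_of_real t \<cdot>\<^sub>m X)) \<le> t ^ n * Re (det (1\<^sub>m n + X))"
    and "0 < t \<Longrightarrow> t ^ n * Re (det X) \<le> Re (det (1\<^sub>m n + complex_of_real t \<cdot>\<^sub>m X))"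
    and "det X = complex_of_real (Re (det X))"
    and "0 \<le> Re (det X)"
    and "0 < n \<Longrightarrow> Re (det X) \<le> (Re (mtrace X) / n) ^ n"
proof -
  obtain l :: "nat \<Rightarrow> real" where l: "\<And>i. i < n \<Longrightarrow> 0 \<le> l i"
    and det: "\<And>t. det (complex_of_real t \<cdot>\<^sub>m 1\<^sub>m n + X) = complex_of_real (\<Prod>i<n. t + l i)"
    and tr: "mtrace X = complex_of_real (\<Sum>i<n. l i)"
    using psd_spectrum[OF X] by metis
  have Xc: "X \<in> carrier_mat n n" using X by (rule psd_carrier)
  have one: "complex_of_real 1 \<cdot>\<^sub>m 1\<^sub>m n = (1\<^sub>m n :: complex mat)" by (intro eq_matI) auto
  have zero: "complex_of_real 0 \<cdot>\<^sub>m 1\<^sub>m n + X = X" using Xc by (intro eq_matI) auto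
  have det1: "det (1\<^sub>m n + X) = complex_of_real (\<Prod>i<n. 1 + l i)" using det[of 1] unfolding one .
  have det0: "det X = complex_of_real (\<Prod>i<n. l i)" using det[of 0] unfolding zero by simp
  show "1 \<le> Re (det (1\<^sub>m n + X))"
    unfolding det1 Re_complex_of_real by (rule prod_ge_1) (use l in auto)
  have "(\<Prod>i<n. 1 + l i) \<le> (\<Prod>i<n. exp (l i))"
    by (rule prod_mono) (use l in \<open>auto simp: exp_ge_add_one_self add_nonneg_nonneg\<close>)
  then show "Re (det (1\<^sub>m n + X)) \<le> exp (Re (mtrace X))"
    unfolding det1 tr Re_complex_of_real by (simp add: exp_sum)
  \<comment> \<open>Pulling out t leaves the factors 1 / t + l i, which are at least l i, and at
    most 1 + l i once t is at least 1.\<close>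
  have scale: "det (1\<^sub>m n + complex_of_real t \<cdot>\<^sub>m X) = complex_of_real (t ^ n * (\<Prod>i<n. 1 / t + l i))"
    if "0 < t" for t
  proof -
    have "1\<^sub>m n + complex_of_real t \<cdot>\<^sub>m X = complex_of_real t \<cdot>\<^sub>m (complex_of_real (1 / t) \<cdot>\<^sub>m 1\<^sub>m n + X)"
      using Xc that by (intro eq_matI) (auto simp: algebra_simps)
    then show ?thesis using Xc by (simp only: det_smult det) simp
  qed
  show "Re (det (1\<^sub>m n + complex_of_real t \<cdot>\<^sub>m X)) \<le> t ^ n * Re (det (1\<^sub>m n + X))" if "1 \<le> t"
  proof -
    have "(\<Prod>i<n. 1 / t + l i) \<le> (\<Prod>i<n. 1 + l i)"
      by (rule prod_mono) (use that l in auto)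
    then have "t ^ n * (\<Prod>i<n. 1 / t + l i) \<le> t ^ n * (\<Prod>i<n. 1 + l i)"
      using that by (intro mult_left_mono) auto
    moreover have "0 < t" using that by simp
    ultimately show ?thesis by (simp only: scale det1 Re_complex_of_real)
  qed
  show "t ^ n * Re (det X) \<le> Re (det (1\<^sub>m n + complex_of_real t \<cdot>\<^sub>m X))" if "0 < t"
  proof -
    have "(\<Prod>i<n. l i) \<le> (\<Prod>i<n. 1 / t + l i)"
      by (rule prod_mono) (use that l in auto)
    then have "t ^ n * (\<Prod>i<n. l i) \<le> t ^ n * (\<Prod>i<n. 1 / t + l i)"
      using that by (intro mult_left_mono) auto
    then show ?thesis using that by (simp only: scale det0 Re_complex_of_real)
  qed
  show "det X = complex_of_real (Re (det X))" unfolding det0 by simp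
  show "0 \<le> Re (det X)" unfolding det0 Re_complex_of_real by (rule prod_nonneg) (use l in auto)
  show "Re (det X) \<le> (Re (mtrace X) / n) ^ n" if n: "0 < n"
  proof -
    have "(\<Prod>i<n. l i) powr (1 / n) \<le> (\<Sum>i<n. l i / n)"
      using arith_geom_mean[of "{..<n}" l] n l by auto
    then have "((\<Prod>i<n. l i) powr (1 / n)) ^ n \<le> (\<Sum>i<n. l i / n) ^ n"
      by (rule power_mono) simp
    moreover have "((\<Prod>i<n. l i) powr (1 / n)) ^ n = (\<Prod>i<n. l i)"
    proof -
      have "0 \<le> (\<Prod>i<n. l i)" by (rule prod_nonneg) (use l in auto)
      then show ?thesis using n
        by (cases "(\<Prod>i<n. l i) = 0")
          (auto simp: zero_power powr_powr powr_power simp del: prod_zero_iff)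
    qed
    ultimately show ?thesis unfolding det0 tr Re_complex_of_real by (simp add: sum_divide_distrib)
  qed
qed

section \<open>Gram matrices and joint covariances of all users\<close>

definition gram :: "nat \<Rightarrow> nat \<Rightarrow> (nat \<times> nat \<Rightarrow> complex) \<Rightarrow> complex mat" where
  "gram R M h = mat R R (\<lambda>(r, s). \<Sum>j<M. h (r, j) * cnj (h (s, j)))"

lemma gram_carrier [simp]: "gram R M h \<in> carrier_mat R R"
  by (simp add: gram_def)

lemma index_gram: "r < R \<Longrightarrow> s < R \<Longrightarrow> gram R M h $$ (r, s) = (\<Sum>j<M. h (r, j) * cnj (h (s, j)))"
  by (simp add: gram_def)

lemma chan_mat_carrier [simp]: "chan_mat R M h \<in> carrier_mat R M"
  by (simp add: chan_mat_def)

lemma gram_eq: "gram R M h = chan_mat R M h * mat_adjoint (chan_mat R M h)"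
  by (intro eq_matI) (auto simp: gram_def chan_mat_def scalar_prod_def atLeast0LessThan)

lemma psd_gram: "psd R (gram R M h)"
proof -
  have "gram R M h = mat_adjoint (mat_adjoint (chan_mat R M h)) * 1\<^sub>m M * mat_adjoint (chan_mat R M h)"
    unfolding gram_eq using right_mult_one_mat[OF chan_mat_carrier] by simp
  then show ?thesis using psd_congruence[OF psd_one, of "mat_adjoint (chan_mat R M h)" M R] by simp
qed

text \<open>The joint covariance of all receive antennas: i div N is the user and i mod N the
  antenna of that user, as in \<open>user_block\<close>.\<close>

definition block_diag :: "nat \<Rightarrow> nat \<Rightarrow> (nat \<Rightarrow> complex mat) \<Rightarrow> complex mat" where
  "block_diag K N Q = mat (K * N) (K * N)
     (\<lambda>(i, j). if i div N = j div N then Q (i div N) $$ (i mod N, j mod N) else 0)"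

lemma block_diag_carrier [simp]: "block_diag K N Q \<in> carrier_mat (K * N) (K * N)"
  by (simp add: block_diag_def)

lemma sum_blocks:
  fixes f :: "nat \<Rightarrow> 'a :: comm_monoid_add"
  shows "(\<Sum>i<K * N. f i) = (\<Sum>k<K. \<Sum>a<N. f (k * N + a))"
proof -
  have "(\<Sum>i = k * N..<k * N + N. f i) = (\<Sum>a<N. f (k * N + a))" for k
    using sum.shift_bounds_nat_ivl[of f 0 "k * N" N] by (simp add: atLeast0LessThan add.commute)
  then show ?thesis by (simp add: sum.nat_group[symmetric])
qed

lemma block_index_less: "k < K \<Longrightarrow> a < N \<Longrightarrow> k * N + a < K * (N::nat)"
proof -
  assume "k < K" "a < N"
  then have "k * N + a < Suc k * N" by simp
  also have "\<dots> \<le> K * N" using \<open>k < K\<close> by (intro mult_le_mono) auto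
  finally show ?thesis .
qed

lemma index_block_diag:
  assumes "k < K" "l < K" "a < N" "b < N"
  shows "block_diag K N Q $$ (k * N + a, l * N + b) = (if k = l then Q k $$ (a, b) else 0)"
  using assms by (simp add: block_diag_def block_index_less)

text \<open>Blocks belonging to two different users vanish, and F maps 0 to 0, so only one sum over
  users survives.\<close>

lemma sum_block_diag:
  fixes F :: "nat \<Rightarrow> nat \<Rightarrow> complex \<Rightarrow> complex"
  assumes "\<And>p q. F p q 0 = 0"
  shows "(\<Sum>p<K * N. \<Sum>q<K * N. F p q (block_diag K N Q $$ (p, q))) =
    (\<Sum>k<K. \<Sum>a<N. \<Sum>b<N. F (k * N + a) (k * N + b) (Q k $$ (a, b)))"
proof -
  have "(\<Sum>p<K * N. \<Sum>q<K * N. F p q (block_diag K N Q $$ (p, q))) =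
    (\<Sum>k<K. \<Sum>a<N. \<Sum>l<K. \<Sum>b<N. F (k * N + a) (l * N + b) (if k = l then Q k $$ (a, b) else 0))"
    unfolding sum_blocks by (intro sum.cong refl) (simp add: index_block_diag)
  also have "\<dots> = (\<Sum>k<K. \<Sum>a<N. \<Sum>l<K. if l = k then \<Sum>b<N. F (k * N + a) (l * N + b) (Q k $$ (a, b)) else 0)"
    by (intro sum.cong refl) (auto simp: assms)
  finally show ?thesis by simp
qed

lemma psd_block_diag:
  assumes Q: "\<And>k. k < K \<Longrightarrow> psd N (Q k)"
  shows "psd (K * N) (block_diag K N Q)"
proof (rule psdI)
  fix i j assume ij: "i < K * N" "j < K * N"
  then have "0 < N" "i div N < K" "j div N < K" by (auto simp: less_mult_imp_div_less intro: Nat.gr0I)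
  then show "cnj (block_diag K N Q $$ (i, j)) = block_diag K N Q $$ (j, i)"
    using ij psd_hermitian[OF Q] by (auto simp: block_diag_def)
next
  fix f :: "nat \<Rightarrow> complex"
  have "(\<Sum>i<K * N. \<Sum>j<K * N. cnj (f i) * block_diag K N Q $$ (i, j) * f j) =
    (\<Sum>k<K. \<Sum>a<N. \<Sum>b<N. cnj (f (k * N + a)) * Q k $$ (a, b) * f (k * N + b))"
    by (rule sum_block_diag) simp
  also have "0 \<le> Re \<dots>"
    unfolding Re_sum[of _ "{..<K}"]
    using psd_form_nonneg[OF Q, of _ "\<lambda>a. f (k * N + a)" for k] by (auto intro!: sum_nonneg simp del: Re_sum)
  finally show "0 \<le> Re (\<Sum>i<K * N. \<Sum>j<K * N. cnj (f i) * block_diag K N Q $$ (i, j) * f j)" .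
qed auto

lemma mtrace_block_diag:
  assumes Q: "\<And>k. k < K \<Longrightarrow> Q k \<in> carrier_mat N N"
  shows "mtrace (block_diag K N Q) = (\<Sum>k<K. mtrace (Q k))"
proof -
  have "mtrace (block_diag K N Q) = (\<Sum>i<K * N. block_diag K N Q $$ (i, i))"
    by (simp add: mtrace_def block_diag_def)
  also have "\<dots> = (\<Sum>k<K. \<Sum>a<N. Q k $$ (a, a))"
    unfolding sum_blocks by (intro sum.cong refl) (simp add: index_block_diag)
  also have "\<dots> = (\<Sum>k<K. mtrace (Q k))"
    using Q by (intro sum.cong refl) (auto simp: mtrace_def)
  finally show ?thesis .
qed

section \<open>The dirty paper sum rate as a supremum over covariances\<close>

definition dpc_feasible :: "nat \<Rightarrow> nat \<Rightarrow> real \<Rightarrow> (nat \<Rightarrow> complex mat) set" where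
  "dpc_feasible K N P = {Q. (\<forall>k<K. psd N (Q k)) \<and> (\<Sum>k<K. Re (mtrace (Q k))) \<le> P}"

text \<open>By the block structure this single congruence is the sum over k of H_k^H Q_k H_k in
  \<open>C_DPC\<close>, and so results on one positive semidefinite matrix apply to it.\<close>

definition dpc_mat :: "nat \<Rightarrow> nat \<Rightarrow> nat \<Rightarrow> (nat \<times> nat \<Rightarrow> complex) \<Rightarrow> (nat \<Rightarrow> complex mat) \<Rightarrow> complex mat" where
  "dpc_mat K N M h Q =
     mat_adjoint (chan_mat (K * N) M h) * block_diag K N Q * chan_mat (K * N) M h"

definition dpc_rate :: "nat \<Rightarrow> nat \<Rightarrow> nat \<Rightarrow> (nat \<times> nat \<Rightarrow> complex) \<Rightarrow> (nat \<Rightarrow> complex mat) \<Rightarrow> real" where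
  "dpc_rate K N M h Q = log 2 (Re (det (1\<^sub>m M + dpc_mat K N M h Q)))"

lemma dpc_feasible_psd: "Q \<in> dpc_feasible K N P \<Longrightarrow> psd (K * N) (block_diag K N Q)"
  by (rule psd_block_diag) (simp add: dpc_feasible_def)

lemma dpc_feasible_trace:
  assumes "Q \<in> dpc_feasible K N P" shows "Re (mtrace (block_diag K N Q)) \<le> P"
proof -
  have "mtrace (block_diag K N Q) = (\<Sum>k<K. mtrace (Q k))"
    by (rule mtrace_block_diag) (use assms psd_carrier in \<open>auto simp: dpc_feasible_def\<close>)
  then show ?thesis using assms by (simp add: dpc_feasible_def)
qed

lemma psd_dpc_mat: "Q \<in> dpc_feasible K N P \<Longrightarrow> psd M (dpc_mat K N M h Q)"
  unfolding dpc_mat_def by (rule psd_congruence[OF dpc_feasible_psd]) auto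

lemma C_DPC_eq_SUP: "C_DPC K N M (chan_mat (K * N) M h) P = (SUP Q\<in>dpc_feasible K N P. dpc_rate K N M h Q)"
proof -
  let ?H = "chan_mat (K * N) M h"
  have eq: "mat M M (\<lambda>(i, j). \<Sum>k<K. (mat_adjoint (user_block ?H N k) * Q k * user_block ?H N k) $$ (i, j)) =
      dpc_mat K N M h Q" if Q: "\<forall>k<K. psd N (Q k)" for Q
  proof (rule eq_matI)
    fix i j assume "i < dim_row (dpc_mat K N M h Q)" "j < dim_col (dpc_mat K N M h Q)"
    then have ij: "i < M" "j < M" by (auto simp: dpc_mat_def chan_mat_def)
    have U: "user_block ?H N k \<in> carrier_mat N M" for k by (auto simp: user_block_def chan_mat_def)
    have Uk: "user_block ?H N k $$ (a, j) = ?H $$ (k * N + a, j)" if "a < N" "j < M" for k a j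
      using that by (simp add: user_block_def chan_mat_def)
    have "(\<Sum>k<K. (mat_adjoint (user_block ?H N k) * Q k * user_block ?H N k) $$ (i, j)) =
      (\<Sum>k<K. \<Sum>a<N. \<Sum>b<N. cnj (?H $$ (k * N + a, i)) * Q k $$ (a, b) * ?H $$ (k * N + b, j))"
    proof (rule sum.cong[OF refl])
      fix k assume "k \<in> {..<K}"
      then have Qk: "Q k \<in> carrier_mat N N" using Q psd_carrier by auto
      show "(mat_adjoint (user_block ?H N k) * Q k * user_block ?H N k) $$ (i, j) =
        (\<Sum>a<N. \<Sum>b<N. cnj (?H $$ (k * N + a, i)) * Q k $$ (a, b) * ?H $$ (k * N + b, j))"
        unfolding index_congruence[OF Qk U ij] by (intro sum.cong refl) (simp add: Uk ij)
    qed
    also have "\<dots> = (\<Sum>p<K * N. \<Sum>q<K * N. cnj (?H $$ (p, i)) * block_diag K N Q $$ (p, q) * ?H $$ (q, j))"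
      by (rule sum_block_diag[symmetric]) simp
    also have "\<dots> = dpc_mat K N M h Q $$ (i, j)"
      unfolding dpc_mat_def by (rule index_congruence[symmetric]) (use ij in auto)
    finally show "mat M M (\<lambda>(i, j). \<Sum>k<K. (mat_adjoint (user_block ?H N k) * Q k * user_block ?H N k) $$ (i, j)) $$ (i, j) =
      dpc_mat K N M h Q $$ (i, j)" using ij by simp
  qed (auto simp: dpc_mat_def chan_mat_def)
  have "{log 2 (Re (det (1\<^sub>m M +
        mat M M (\<lambda>(i, j). \<Sum>k<K. (mat_adjoint (user_block ?H N k) * Q k * user_block ?H N k) $$ (i, j)))))
     | Q. (\<forall>k<K. psd N (Q k)) \<and> (\<Sum>k<K. Re (mtrace (Q k))) \<le> P} = dpc_rate K N M h ` dpc_feasible K N P"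
    unfolding setcompr_eq_image dpc_feasible_def dpc_rate_def by (rule image_cong) (auto simp: eq)
  then show ?thesis by (simp only: C_DPC_def)
qed

text \<open>A supremum of reals is informative only for a bounded set. Here det (1 + X) is at most
  exp (trace X), and the trace of X is bounded crudely through the entries of Q, each of modulus at
  most P.\<close>

lemma bdd_above_dpc_rate: "bdd_above (dpc_rate K N M h ` dpc_feasible K N P)"
proof -
  define B where "B = (\<Sum>i<M. \<Sum>a<K * N. \<Sum>b<K * N. cmod (h (a, i)) * P * cmod (h (b, i)))"
  have "dpc_rate K N M h Q \<le> log 2 (exp B)" if Q: "Q \<in> dpc_feasible K N P" for Q
  proof -
    let ?X = "dpc_mat K N M h Q"
    note X = psd_dpc_mat[OF Q, of M h]
    have le: "cmod (block_diag K N Q $$ (a, b)) \<le> P" if "a < K * N" "b < K * N" for a b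
      using cmod_psd_le[OF dpc_feasible_psd[OF Q] that] dpc_feasible_trace[OF Q] by simp
    have "mtrace ?X = (\<Sum>i<M. \<Sum>a<K * N. \<Sum>b<K * N. cnj (h (a, i)) * block_diag K N Q $$ (a, b) * h (b, i))"
      unfolding mtrace_def using psd_carrier[OF X]
    proof (intro sum.cong)
      fix i assume "i \<in> {..<M}"
      then have i: "i < M" by simp
      show "?X $$ (i, i) = (\<Sum>a<K * N. \<Sum>b<K * N. cnj (h (a, i)) * block_diag K N Q $$ (a, b) * h (b, i))"
        unfolding dpc_mat_def index_congruence[OF block_diag_carrier chan_mat_carrier i i]
        by (intro sum.cong refl) (simp add: chan_mat_def i)
    qed auto
    then have "Re (mtrace ?X) \<le> (\<Sum>i<M. \<Sum>a<K * N. \<Sum>b<K * N. Re (cnj (h (a, i)) * block_diag K N Q $$ (a, b) * h (b, i)))"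
      by (simp only: Re_sum order_refl)
    also have "\<dots> \<le> (\<Sum>i<M. \<Sum>a<K * N. \<Sum>b<K * N. cmod (cnj (h (a, i)) * block_diag K N Q $$ (a, b) * h (b, i)))"
      by (intro sum_mono complex_Re_le_cmod)
    also have "\<dots> \<le> B" unfolding B_def
      by (intro sum_mono) (auto simp: norm_mult intro!: mult_right_mono mult_left_mono le)
    finally have "Re (mtrace ?X) \<le> B" .
    then have "Re (det (1\<^sub>m M + ?X)) \<le> exp B" using psd_det_one_plus(2)[OF X] by (meson exp_le_cancel_iff order_trans)
    then show ?thesis unfolding dpc_rate_def using psd_det_one_plus(1)[OF X]
      by (subst log_le_cancel_iff) auto
  qed
  then show ?thesis by (intro bdd_aboveI) auto
qed

lemma dpc_feasible_nonempty: "0 \<le> P \<Longrightarrow> (\<lambda>_. 0\<^sub>m N N) \<in> dpc_feasible K N P"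
proof -
  have "psd N (0\<^sub>m N N)" by (rule psdI) auto
  moreover have "mtrace (0\<^sub>m N N) = 0" by (simp add: mtrace_def)
  ultimately show "0 \<le> P \<Longrightarrow> ?thesis" by (simp add: dpc_feasible_def)
qed

lemma C_DPC_mono:
  assumes "0 \<le> P" "P \<le> P'"
  shows "C_DPC K N M (chan_mat (K * N) M h) P \<le> C_DPC K N M (chan_mat (K * N) M h) P'"
  unfolding C_DPC_eq_SUP
proof (rule cSUP_subset_mono[OF _ bdd_above_dpc_rate])
  show "dpc_feasible K N P \<noteq> {}" using dpc_feasible_nonempty[OF assms(1)] by auto
qed (use assms in \<open>auto simp: dpc_feasible_def\<close>)

text \<open>Dividing a covariance by t makes it feasible for P, and 1 + t l \<le> t (1 + l) for each
  of the M eigenvalues costs at most a factor t^M. This holds for degenerate channels too, where it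
  serves to compare real powers with integer ones.\<close>

lemma C_DPC_scale:
  assumes P: "0 \<le> P" and t: "1 \<le> t"
  shows "C_DPC K N M (chan_mat (K * N) M h) (t * P) \<le> C_DPC K N M (chan_mat (K * N) M h) P + M * log 2 t"
  unfolding C_DPC_eq_SUP
proof (rule cSUP_least)
  show "dpc_feasible K N (t * P) \<noteq> {}" using dpc_feasible_nonempty[of "t * P"] P t by auto
  fix Q assume Q: "Q \<in> dpc_feasible K N (t * P)"
  define Q' where "Q' k = complex_of_real (1 / t) \<cdot>\<^sub>m Q k" for k
  have Qc: "Q k \<in> carrier_mat N N" if "k < K" for k
    using Q that psd_carrier by (auto simp: dpc_feasible_def)
  have "Re (mtrace (Q' k)) = Re (mtrace (Q k)) / t" if "k < K" for k
    using Qc[OF that] by (auto simp: Q'_def mtrace_def sum_divide_distrib)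
  then have "(\<Sum>k<K. Re (mtrace (Q' k))) = (\<Sum>k<K. Re (mtrace (Q k))) / t"
    by (simp add: sum_divide_distrib)
  moreover have "(\<Sum>k<K. Re (mtrace (Q k))) / t \<le> P"
    using Q t by (simp add: dpc_feasible_def field_simps)
  moreover have "psd N (Q' k)" if "k < K" for k
    using Q that t psd_smult[of N "Q k" "1 / t"] by (simp add: Q'_def dpc_feasible_def)
  ultimately have Q': "Q' \<in> dpc_feasible K N P"
    by (simp add: dpc_feasible_def)
  have "block_diag K N Q = complex_of_real t \<cdot>\<^sub>m block_diag K N Q'"
  proof (rule eq_matI)
    fix i j assume "i < dim_row (complex_of_real t \<cdot>\<^sub>m block_diag K N Q')" "j < dim_col (complex_of_real t \<cdot>\<^sub>m block_diag K N Q')"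
    then have ij: "i < K * N" "j < K * N" by (auto simp: block_diag_def)
    then have "0 < N" "i div N < K" by (auto simp: less_mult_imp_div_less intro: Nat.gr0I)
    then show "block_diag K N Q $$ (i, j) = (complex_of_real t \<cdot>\<^sub>m block_diag K N Q') $$ (i, j)"
      using ij t carrier_matD[OF Qc[of "i div N"]] by (auto simp: block_diag_def Q'_def)
  qed (auto simp: block_diag_def)
  then have X: "dpc_mat K N M h Q = complex_of_real t \<cdot>\<^sub>m dpc_mat K N M h Q'"
    using mult_smult_distrib[OF mat_adjoint_carrier[OF chan_mat_carrier[of "K * N" M h]]
        block_diag_carrier[of K N Q']]
      mult_smult_assoc_mat[OF mult_carrier_mat[OF mat_adjoint_carrier[OF chan_mat_carrier[of "K * N" M h]]
        block_diag_carrier[of K N Q']] chan_mat_carrier[of "K * N" M h]]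
    by (simp add: dpc_mat_def)
  note psd = psd_dpc_mat[OF Q', of M h]
  have "dpc_rate K N M h Q \<le> log 2 (t ^ M * Re (det (1\<^sub>m M + dpc_mat K N M h Q')))"
    unfolding dpc_rate_def using psd_det_one_plus(3)[OF psd t]
      psd_det_one_plus(1)[OF psd_dpc_mat[OF Q, of M h]] by (subst log_le_cancel_iff) (auto simp: X)
  also have "\<dots> = M * log 2 t + dpc_rate K N M h Q'"
    using t psd_det_one_plus(1)[OF psd] by (simp add: dpc_rate_def log_mult log_nat_power)
  also have "dpc_rate K N M h Q' \<le> (SUP Q\<in>dpc_feasible K N P. dpc_rate K N M h Q)"
    by (rule cSUP_upper[OF Q' bdd_above_dpc_rate])
  finally show "dpc_rate K N M h Q \<le> (SUP Q\<in>dpc_feasible K N P. dpc_rate K N M h Q) + M * log 2 t" by simp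
qed

text \<open>Sylvester's identity moves the determinant to the receive side: the M x M matrix H^H H
  is singular for M > R, whereas the R x R Gram matrix is generically invertible.\<close>

lemma det_dpc_mat:
  assumes "B \<in> carrier_mat R R"
  shows "det (1\<^sub>m M + mat_adjoint (chan_mat R M h) * B * chan_mat R M h) = det (1\<^sub>m R + gram R M h * B)"
proof -
  let ?H = "chan_mat R M h"
  have "det (1\<^sub>m M + mat_adjoint ?H * B * ?H) = det (1\<^sub>m R + ?H * (mat_adjoint ?H * B))"
    by (rule det_one_plus_mult_commute[OF mult_carrier_mat[OF mat_adjoint_carrier[OF chan_mat_carrier] assms] chan_mat_carrier])
  also have "?H * (mat_adjoint ?H * B) = gram R M h * B"
    unfolding gram_eq by (rule assoc_mult_mat[symmetric, OF chan_mat_carrier mat_adjoint_carrier[OF chan_mat_carrier] assms])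
  finally show ?thesis .
qed

lemma mat_adjoint_one: "mat_adjoint (1\<^sub>m n :: complex mat) = 1\<^sub>m n"
  by (intro eq_matI) auto

lemma log_power_mult:
  fixes c g :: real
  shows "0 < c \<Longrightarrow> 0 < g \<Longrightarrow> log 2 (c ^ n * g) = n * log 2 c + log 2 g"
  by (simp add: log_mult log_nat_power)

lemma psd_inverse:
  assumes G: "psd n G" and d: "det G \<noteq> 0"
  obtains J where "psd n J" "G * J = 1\<^sub>m n"
proof -
  have Gc: "G \<in> carrier_mat n n" using G by (rule psd_carrier)
  define J where "J = (1 / det G) \<cdot>\<^sub>m adj_mat G"
  have Jc: "J \<in> carrier_mat n n" using adj_mat(1)[OF Gc] by (simp add: J_def)
  have GJ: "G * J = 1\<^sub>m n"
    unfolding J_def using mult_smult_distrib[OF Gc adj_mat(1)[OF Gc], of "1 / det G"] adj_mat(2)[OF Gc] d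
    by (auto intro!: eq_matI)
  have adjG: "mat_adjoint G = G" using G by (simp add: psd_def)
  \<comment> \<open>The inverse is a congruence of G by itself, J = J^H G J, and inherits positivity
    that way.\<close>
  have "mat_adjoint J * G * J = mat_adjoint (G * J) * J"
    by (simp add: mat_adjoint_mult[OF Gc Jc] adjG)
  also have "\<dots> = J" unfolding GJ mat_adjoint_one using Jc by simp
  finally have "psd n J" using psd_congruence[OF G Jc] by simp
  then show ?thesis using that GJ by blast
qed

text \<open>Equal powers give the lower bound. For the upper one, det (1 + G B) = det G * det
  (G^(-1) + B), and the second factor is controlled by the trace of G^(-1) + B, which is at most P +
  s.\<close>

lemma C_DPC_bounds:
  assumes KN: "0 < K * N" and d: "det (gram (K * N) M h) \<noteq> 0"
  obtains s where "0 \<le> s" "\<forall>P>0.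
     real (K * N) * log 2 (P / real (K * N)) + log 2 (cmod (det (gram (K * N) M h))) \<le> C_DPC K N M (chan_mat (K * N) M h) P \<and>
     C_DPC K N M (chan_mat (K * N) M h) P \<le> real (K * N) * log 2 ((P + s) / real (K * N)) + log 2 (cmod (det (gram (K * N) M h)))"
proof -
  let ?R = "K * N" and ?G = "gram (K * N) M h"
  define g where "g = Re (det ?G)"
  have g: "det ?G = complex_of_real g" "0 \<le> g" using psd_det_one_plus(5,6)[OF psd_gram] by (auto simp: g_def)
  then have g0: "0 < g" using d by (auto simp: less_le)
  have cg: "cmod (det ?G) = g" using g by simp
  obtain J where J: "psd ?R J" "?G * J = 1\<^sub>m ?R" using psd_inverse[OF psd_gram d] .
  have Jc: "J \<in> carrier_mat ?R ?R" using J(1) by (rule psd_carrier)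
  \<comment> \<open>The trace of G^(-1), a constant independent of P.\<close>
  define s where "s = Re (mtrace J)"
  have s0: "0 \<le> s" using cmod_psd_le[OF J(1) KN KN] norm_ge_zero[of "J $$ (0, 0)"] unfolding s_def by linarith
  have lo: "?R * log 2 (P / ?R) + log 2 g \<le> C_DPC K N M (chan_mat ?R M h) P"
    if P: "0 < P" for P
  proof -
    let ?c = "P / ?R"
    have c: "0 < ?c" using P KN by simp
    \<comment> \<open>Power P / R on each of the R = KN receive antennas, so the whole budget P is
      spent.\<close>
    define Q where "Q k = complex_of_real ?c \<cdot>\<^sub>m (1\<^sub>m N :: complex mat)" for k :: nat
    have "(\<Sum>k<K. Re (mtrace (Q k))) = P" using KN by (simp add: Q_def mtrace_def)
    then have Q: "Q \<in> dpc_feasible K N P"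
      using psd_smult[OF psd_one, of ?c N] c by (auto simp: dpc_feasible_def Q_def)
    have bd: "block_diag K N Q = complex_of_real ?c \<cdot>\<^sub>m 1\<^sub>m ?R"
    proof (rule eq_matI)
      fix i j assume "i < dim_row (complex_of_real ?c \<cdot>\<^sub>m 1\<^sub>m ?R :: complex mat)" "j < dim_col (complex_of_real ?c \<cdot>\<^sub>m 1\<^sub>m ?R :: complex mat)"
      then show "block_diag K N Q $$ (i, j) = (complex_of_real ?c \<cdot>\<^sub>m 1\<^sub>m ?R) $$ (i, j)"
        using KN by (auto simp: block_diag_def Q_def) (metis div_mult_mod_eq)
    qed (auto simp: block_diag_def)
    have "?c ^ ?R * g \<le> Re (det (1\<^sub>m ?R + complex_of_real ?c \<cdot>\<^sub>m ?G))"
      using psd_det_one_plus(4)[OF psd_gram c] by (simp add: g_def)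
    also have "complex_of_real ?c \<cdot>\<^sub>m ?G = ?G * block_diag K N Q"
      unfolding bd using mult_smult_distrib[OF gram_carrier[of ?R M h] one_carrier_mat]
      by (simp add: right_mult_one_mat[OF gram_carrier])
    also have "Re (det (1\<^sub>m ?R + ?G * block_diag K N Q)) = Re (det (1\<^sub>m M + dpc_mat K N M h Q))"
      unfolding dpc_mat_def by (subst det_dpc_mat) auto
    finally have "log 2 (?c ^ ?R * g) \<le> dpc_rate K N M h Q"
      unfolding dpc_rate_def using c g0 psd_det_one_plus(1)[OF psd_dpc_mat[OF Q, of M h]]
      by (subst log_le_cancel_iff) (auto simp del: power_divide)
    also have "\<dots> \<le> C_DPC K N M (chan_mat ?R M h) P"
      unfolding C_DPC_eq_SUP by (rule cSUP_upper[OF Q bdd_above_dpc_rate])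
    also have "log 2 (?c ^ ?R * g) = ?R * log 2 ?c + log 2 g"
      using c g0 by (rule log_power_mult)
    finally show ?thesis .
  qed
  have up: "C_DPC K N M (chan_mat ?R M h) P \<le> ?R * log 2 ((P + s) / ?R) + log 2 g"
    if P: "0 < P" for P
    unfolding C_DPC_eq_SUP
  proof (rule cSUP_least)
    show "dpc_feasible K N P \<noteq> {}" using dpc_feasible_nonempty[of P] P by auto
    fix Q assume Q: "Q \<in> dpc_feasible K N P"
    let ?B = "block_diag K N Q"
    have psd: "psd ?R (J + ?B)" by (intro psd_add J(1) dpc_feasible_psd[OF Q])
    have "Re (mtrace (J + ?B)) = s + Re (mtrace ?B)"
      using Jc by (simp add: mtrace_def s_def sum.distrib block_diag_def)
    then have tr: "Re (mtrace (J + ?B)) \<le> P + s" using dpc_feasible_trace[OF Q] by simp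
    have tr0: "0 \<le> Re (mtrace (J + ?B))"
      using cmod_psd_le[OF psd KN KN] norm_ge_zero order_trans by blast
    have "?G * (J + ?B) = 1\<^sub>m ?R + ?G * ?B"
      unfolding J(2)[symmetric] by (rule mult_add_distrib_mat[OF gram_carrier Jc block_diag_carrier])
    then have "det (1\<^sub>m M + dpc_mat K N M h Q) = det ?G * det (J + ?B)"
      unfolding dpc_mat_def using det_dpc_mat[OF block_diag_carrier, of M K N h Q]
        det_mult[OF gram_carrier psd_carrier[OF psd], of M h] by simp
    then have "Re (det (1\<^sub>m M + dpc_mat K N M h Q)) = g * Re (det (J + ?B))" by (simp add: g)
    also have "\<dots> \<le> g * ((P + s) / ?R) ^ ?R"
    proof (intro mult_left_mono g(2))
      have "Re (det (J + ?B)) \<le> (Re (mtrace (J + ?B)) / ?R) ^ ?R"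
        by (rule psd_det_one_plus(7)[OF psd KN])
      also have "\<dots> \<le> ((P + s) / ?R) ^ ?R"
        using tr tr0 by (intro power_mono divide_right_mono) auto
      finally show "Re (det (J + ?B)) \<le> ((P + s) / ?R) ^ ?R" .
    qed
    finally have "dpc_rate K N M h Q \<le> log 2 (g * ((P + s) / ?R) ^ ?R)"
      unfolding dpc_rate_def using psd_det_one_plus(1)[OF psd_dpc_mat[OF Q, of M h]] by simp
    also have "\<dots> = ?R * log 2 ((P + s) / ?R) + log 2 g"
    proof -
      have "0 < (P + s) / ?R" using P \<open>0 \<le> s\<close> KN by (intro divide_pos_pos) auto
      then show ?thesis using g0 log_power_mult[of "(P + s) / ?R" g ?R] by (simp only: mult.commute)
    qed
    finally show "dpc_rate K N M h Q \<le> ?R * log 2 ((P + s) / ?R) + log 2 g" .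
  qed
  show ?thesis
    by (rule that[OF s0]) (unfold cg, intro allI impI conjI lo up)
qed

subsection \<open>The zero-forcing capacity and the limiting loss\<close>

text \<open>The Hermitian inner product on the first M coordinates, conjugate linear in its first
  argument as in \<open>perp_proj\<close>. Functions replace vectors so that linear combinations
  carry no dimension conditions.\<close>

definition cip :: "nat \<Rightarrow> (nat \<Rightarrow> complex) \<Rightarrow> (nat \<Rightarrow> complex) \<Rightarrow> complex" where
  "cip M u v = (\<Sum>j<M. cnj (u j) * v j)"

definition sqnorm :: "nat \<Rightarrow> (nat \<Rightarrow> complex) \<Rightarrow> real" where
  "sqnorm M u = (\<Sum>j<M. (cmod (u j))\<^sup>2)"

lemma cip_self: "cip M u u = complex_of_real (sqnorm M u)"
  by (simp add: cip_def sqnorm_def complex_norm_square mult.commute del: of_real_power)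

lemma sqnorm_nonneg: "0 \<le> sqnorm M u"
  by (simp add: sqnorm_def sum_nonneg)

lemma sqnorm_eq_0: "sqnorm M u = 0 \<longleftrightarrow> (\<forall>j<M. u j = 0)"
  by (auto simp: sqnorm_def sum_nonneg_eq_0_iff)

lemma cip_cong: "(\<And>j. j < M \<Longrightarrow> u j = u' j) \<Longrightarrow> (\<And>j. j < M \<Longrightarrow> v j = v' j) \<Longrightarrow> cip M u v = cip M u' v'"
  by (simp add: cip_def)

lemma cip_add_right: "cip M u (\<lambda>j. v j + w j) = cip M u v + cip M u w"
  and cip_add_left: "cip M (\<lambda>j. v j + w j) u = cip M v u + cip M w u"
  and cip_diff_right: "cip M u (\<lambda>j. v j - w j) = cip M u v - cip M u w"
  and cip_diff_left: "cip M (\<lambda>j. v j - w j) u = cip M v u - cip M w u"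
  and cip_mult_right: "cip M u (\<lambda>j. k * v j) = k * cip M u v"
  by (simp_all add: cip_def algebra_simps sum.distrib sum_subtractf sum_distrib_left)

lemma cip_sum_right: "cip M u (\<lambda>j. \<Sum>s\<in>S. c s * v s j) = (\<Sum>s\<in>S. c s * cip M u (v s))"
  unfolding cip_def sum_distrib_left by (subst sum.swap) (simp add: ac_simps)

lemma cip_sum_left: "cip M (\<lambda>j. \<Sum>s\<in>S. c s * v s j) u = (\<Sum>s\<in>S. cnj (c s) * cip M (v s) u)"
  unfolding cip_def sum_distrib_left cnj_sum sum_distrib_right by (subst sum.swap) (simp add: ac_simps)

lemma cip_commute: "cip M u v = cnj (cip M v u)"
  by (simp add: cip_def mult.commute)

lemma sqnorm_add:
  assumes "cip M u v = 0" shows "sqnorm M (\<lambda>j. u j + v j) = sqnorm M u + sqnorm M v"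
proof -
  have "cip M v u = 0" using assms cip_commute[of M v u] by simp
  then have "cip M (\<lambda>j. u j + v j) (\<lambda>j. u j + v j) = cip M u u + cip M v v"
    using assms by (simp add: cip_add_left cip_add_right)
  then have "complex_of_real (sqnorm M (\<lambda>j. u j + v j)) = of_real (sqnorm M u + sqnorm M v)"
    by (simp only: cip_self of_real_add)
  then show ?thesis by (simp only: of_real_eq_iff)
qed

text \<open>Gram-Schmidt, adding one vector at a time. Linearly dependent families are covered,
  which makes the projection in \<open>zf_gain\<close> meaningful for every channel.\<close>

lemma orthogonal_residual_exists:
  assumes "finite S"
  shows "\<exists>c. \<forall>s\<in>S. cip M (v s) (\<lambda>j. x j - (\<Sum>t\<in>S. c t * v t j)) = 0"
  using assms
proof (induction S arbitrary: x rule: finite_induct)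
  case empty
  then show ?case by simp
next
  case (insert a S)
  from insert.IH[of x] obtain c where c: "\<And>s. s \<in> S \<Longrightarrow> cip M (v s) (\<lambda>j. x j - (\<Sum>t\<in>S. c t * v t j)) = 0" by auto
  from insert.IH[of "v a"] obtain d where d: "\<And>s. s \<in> S \<Longrightarrow> cip M (v s) (\<lambda>j. v a j - (\<Sum>t\<in>S. d t * v t j)) = 0" by auto
  define y where "y = (\<lambda>j. x j - (\<Sum>t\<in>S. c t * v t j))"
  define u where "u = (\<lambda>j. v a j - (\<Sum>t\<in>S. d t * v t j))"
  \<comment> \<open>The coefficient of \<open>y\<close> along \<open>u\<close>, the part of
    \<open>v a\<close> orthogonal to the earlier vectors. If \<open>u\<close> vanishes on the M
    coordinates, both inner products are 0 and any k would serve.\<close>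
  define k where "k = cip M u y / cip M u u"
  have uy: "cip M u (\<lambda>j. y j - k * u j) = 0"
  proof (cases "sqnorm M u = 0")
    case True
    then show ?thesis by (simp add: cip_def sqnorm_eq_0)
  next
    case False
    then have "k * cip M u u = cip M u y" by (simp add: k_def cip_self)
    then show ?thesis by (simp only: cip_diff_right cip_mult_right) simp
  qed
  have S: "cip M (v s) (\<lambda>j. y j - k * u j) = 0" if "s \<in> S" for s
    using c[OF that] d[OF that] by (simp add: cip_diff_right cip_mult_right y_def u_def)
  have "v a = (\<lambda>j. u j + (\<Sum>t\<in>S. d t * v t j))" by (simp add: u_def)
  then have a: "cip M (v a) (\<lambda>j. y j - k * u j) = 0"
    using uy S by (simp add: cip_add_left cip_sum_left)
  \<comment> \<open>Coefficients of y - k u after expanding \<open>y\<close> and \<open>u\<close> in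
    the family v.\<close>
  define e where "e t = (if t = a then k else c t - k * d t)" for t
  have "(\<lambda>j. x j - (\<Sum>t\<in>insert a S. e t * v t j)) = (\<lambda>j. y j - k * u j)"
  proof
    fix j
    have "(\<Sum>t\<in>S. e t * v t j) = (\<Sum>t\<in>S. c t * v t j) - k * (\<Sum>t\<in>S. d t * v t j)"
      unfolding sum_distrib_left sum_subtractf[symmetric]
      using insert.hyps by (intro sum.cong refl) (auto simp: e_def algebra_simps)
    then show "x j - (\<Sum>t\<in>insert a S. e t * v t j) = y j - k * u j"
      using insert.hyps by (simp add: e_def y_def u_def algebra_simps)
  qed
  then show ?case using a S by (intro exI[of _ e]) simp
qed

definition residual :: "nat \<Rightarrow> (nat \<times> nat \<Rightarrow> complex) \<Rightarrow> nat \<Rightarrow> (nat \<Rightarrow> complex) \<Rightarrow> nat \<Rightarrow> complex" where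
  "residual R h r c j = h (r, j) - (\<Sum>s\<in>{..<R} - {r}. c s * h (s, j))"

text \<open>This resolves the description in \<open>perp_proj\<close>. Two candidates differ by a
  vector in the span of the other rows that is orthogonal to these rows, hence orthogonal to itself
  and zero.\<close>

lemma zf_gain_eq:
  assumes r: "r < R"
    and orth: "\<And>s. s < R \<Longrightarrow> s \<noteq> r \<Longrightarrow> cip M (\<lambda>j. h (s, j)) (residual R h r c) = 0"
  shows "(zf_gain R M (chan_mat R M h) r)\<^sup>2 = sqnorm M (residual R h r c)"
proof -
  let ?H = "chan_mat R M h" and ?S = "{..<R} - {r}"
  define g where "g = vec M (residual R h r c)"
  have ip: "conjugate (row ?H s) \<bullet> w = cip M (\<lambda>j. h (s, j)) (\<lambda>j. w $ j)"
    if "s < R" "w \<in> carrier_vec M" for s w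
    using that by (auto simp: scalar_prod_def chan_mat_def cip_def atLeast0LessThan intro!: sum.cong)
  have "perp_proj R M ?H r = g"
    unfolding perp_proj_def
  proof (rule the_equality, intro conjI allI impI)
    show "g \<in> carrier_vec M" by (simp add: g_def)
    show "conjugate (row ?H s) \<bullet> g = 0" if "s < R" "s \<noteq> r" for s
      using ip[OF that(1), of g] orth[OF that] by (simp add: g_def cip_def)
    show "\<exists>c. row ?H r - g = vec M (\<lambda>j. \<Sum>s\<in>?S. c s * ?H $$ (s, j))"
      using r by (intro exI[of _ c] eq_vecI) (auto simp: g_def residual_def chan_mat_def)
    fix g' assume g': "g' \<in> carrier_vec M \<and> (\<forall>s<R. s \<noteq> r \<longrightarrow> conjugate (row ?H s) \<bullet> g' = 0) \<and>
      (\<exists>c. row ?H r - g' = vec M (\<lambda>j. \<Sum>s\<in>?S. c s * ?H $$ (s, j)))"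
    then obtain d where d: "row ?H r - g' = vec M (\<lambda>j. \<Sum>s\<in>?S. d s * ?H $$ (s, j))" by auto
    have g'j: "g' $ j = residual R h r d j" if "j < M" for j
    proof -
      have "(row ?H r - g') $ j = (\<Sum>s\<in>?S. d s * h (s, j))"
        unfolding d using that by (auto simp: chan_mat_def)
      moreover have "(row ?H r - g') $ j = h (r, j) - g' $ j"
        using that r g' by (subst index_minus_vec) (auto simp: chan_mat_def)
      ultimately show ?thesis by (simp add: residual_def algebra_simps)
    qed
    \<comment> \<open>The difference of the candidates, written as a combination of the other rows
      so that its inner product with itself can be expanded.\<close>
    define y where "y = (\<lambda>j. \<Sum>s\<in>?S. (c s - d s) * h (s, j))"
    have y: "y j = g' $ j - g $ j" if "j < M" for j
      using that g'j[OF that] by (simp add: g_def y_def residual_def left_diff_distrib sum_subtractf)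
    have "cip M (\<lambda>j. h (s, j)) y = 0" if "s \<in> ?S" for s
    proof -
      have "cip M (\<lambda>j. h (s, j)) y = cip M (\<lambda>j. h (s, j)) (\<lambda>j. g' $ j - residual R h r c j)"
        by (rule cip_cong) (simp_all add: y, simp add: g_def)
      also have "\<dots> = cip M (\<lambda>j. h (s, j)) (\<lambda>j. g' $ j)"
        using orth that by (simp add: cip_diff_right)
      also have "\<dots> = 0" using ip[of s g'] g' that by auto
      finally show ?thesis .
    qed
    then have "cip M y y = 0" unfolding y_def cip_sum_left by (simp add: y_def[symmetric])
    then have "\<forall>j<M. y j = 0" by (simp add: cip_self sqnorm_eq_0)
    then show "g' = g" using g' y by (intro eq_vecI) (auto simp: g_def)
  qed
  moreover have "(vnorm g)\<^sup>2 = sqnorm M (residual R h r c)"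
    unfolding vnorm_def by (subst real_sqrt_pow2) (auto simp: g_def sqnorm_def sum_nonneg)
  ultimately show ?thesis by (simp add: zf_gain_def)
qed

text \<open>The projection residual is the shortest one, by Pythagoras. As an infimum of functions
  continuous in h, the squared gain is measurable without any condition on the rank.\<close>

lemma zf_gain_sq_eq_INF:
  assumes r: "r < R"
  shows "(zf_gain R M (chan_mat R M h) r)\<^sup>2 = (INF c. sqnorm M (residual R h r c))"
proof -
  let ?S = "{..<R} - {r}"
  obtain c where c: "\<And>s. s \<in> ?S \<Longrightarrow> cip M (\<lambda>j. h (s, j)) (residual R h r c) = 0"
    using orthogonal_residual_exists[of ?S M "\<lambda>s j. h (s, j)" "\<lambda>j. h (r, j)"]
    unfolding residual_def[abs_def] by auto
  have "sqnorm M (residual R h r c) \<le> sqnorm M (residual R h r d)" for d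
  proof -
    define y where "y = (\<lambda>j. \<Sum>s\<in>?S. (c s - d s) * h (s, j))"
    have "residual R h r d = (\<lambda>j. y j + residual R h r c j)"
      by (auto simp: residual_def y_def left_diff_distrib sum_subtractf)
    moreover have "cip M y (residual R h r c) = 0" unfolding y_def cip_sum_left using c by simp
    ultimately show ?thesis using sqnorm_add[of M y "residual R h r c"] sqnorm_nonneg[of M y] by simp
  qed
  then have "(INF c. sqnorm M (residual R h r c)) = sqnorm M (residual R h r c)"
    by (intro cInf_eq_minimum) auto
  then show ?thesis using zf_gain_eq[OF r, of M h c] c by auto
qed

text \<open>Row r of adj(G) G = det G * 1 states that the combination of rows weighted by row r of
  the adjugate is orthogonal to every row except h_r. Divided by the cofactor D it contains h_r with
  weight 1, hence it is the residual, and its inner product with h_r is det G / D.\<close>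

lemma zf_gain_sq_eq_det:
  assumes r: "r < R" and D: "det (mat_delete (gram R M h) r r) \<noteq> 0"
  shows "(zf_gain R M (chan_mat R M h) r)\<^sup>2 = cmod (det (gram R M h)) / cmod (det (mat_delete (gram R M h) r r))"
proof -
  let ?G = "gram R M h" and ?S = "{..<R} - {r}"
  define D where "D = det (mat_delete ?G r r)"
  define A where "A = adj_mat ?G"
  have A: "A \<in> carrier_mat R R" "A * ?G = det ?G \<cdot>\<^sub>m 1\<^sub>m R" using adj_mat[OF gram_carrier] by (auto simp: A_def)
  have Arr: "A $$ (r, r) = D" using r by (simp add: A_def adj_mat_def cofactor_def D_def gram_def)
  define c where "c s = - A $$ (r, s) / D" for s
  have res: "residual R h r c = (\<lambda>j. \<Sum>s<R. A $$ (r, s) / D * h (s, j))"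
  proof
    fix j
    have "(\<Sum>s<R. A $$ (r, s) / D * h (s, j)) = h (r, j) + (\<Sum>s\<in>?S. A $$ (r, s) / D * h (s, j))"
      using r D Arr by (subst sum.remove[of _ r]) (auto simp: D_def)
    then show "residual R h r c j = (\<Sum>s<R. A $$ (r, s) / D * h (s, j))"
      by (simp add: residual_def c_def sum_negf)
  qed
  have ip: "cip M (\<lambda>j. h (s, j)) (residual R h r c) = (if s = r then det ?G / D else 0)" if s: "s < R" for s
  proof -
    have "cip M (\<lambda>j. h (s, j)) (residual R h r c) = (\<Sum>t<R. A $$ (r, t) / D * ?G $$ (t, s))"
      unfolding res cip_sum_right using s by (intro sum.cong refl) (simp add: index_gram cip_def mult.commute)
    also have "\<dots> = (A * ?G) $$ (r, s) / D"
      using A(1) r s gram_carrier[of R M h] by (auto simp: scalar_prod_def atLeast0LessThan sum_divide_distrib simp del: gram_carrier)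
    also have "\<dots> = (if s = r then det ?G / D else 0)" unfolding A(2) using r s by auto
    finally show ?thesis .
  qed
  have "complex_of_real (sqnorm M (residual R h r c)) = cip M (residual R h r c) (residual R h r c)"
    by (simp add: cip_self)
  also have "\<dots> = cip M (\<lambda>j. h (r, j)) (residual R h r c) -
      (\<Sum>s\<in>?S. cnj (c s) * cip M (\<lambda>j. h (s, j)) (residual R h r c))"
    by (subst (1) residual_def[abs_def]) (simp add: cip_diff_left cip_sum_left)
  also have "\<dots> = det ?G / D" using ip r by simp
  finally have "cmod (det ?G / D) = sqnorm M (residual R h r c)"
    using sqnorm_nonneg by (metis norm_of_real abs_of_nonneg)
  moreover have "(zf_gain R M (chan_mat R M h) r)\<^sup>2 = sqnorm M (residual R h r c)"
    by (rule zf_gain_eq[OF r]) (simp add: ip)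
  ultimately show ?thesis by (simp add: norm_divide D_def)
qed

section \<open>Power allocation for zero forcing\<close>

definition zf_feasible :: "nat \<Rightarrow> real \<Rightarrow> (nat \<Rightarrow> real) set" where
  "zf_feasible R P = {p. (\<forall>r<R. 0 \<le> p r) \<and> (\<Sum>r<R. p r) \<le> P}"

definition zf_rate :: "nat \<Rightarrow> (nat \<Rightarrow> real) \<Rightarrow> (nat \<Rightarrow> real) \<Rightarrow> real" where
  "zf_rate R g p = (\<Sum>r<R. log 2 (1 + p r * (g r)\<^sup>2))"

lemma C_ZF_eq_SUP: "C_ZF R M H P = (SUP p\<in>zf_feasible R P. zf_rate R (zf_gain R M H) p)"
  unfolding C_ZF_def zf_feasible_def zf_rate_def by (simp add: setcompr_eq_image)

lemma zf_feasible_le: "p \<in> zf_feasible R P \<Longrightarrow> r < R \<Longrightarrow> p r \<le> P"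
  using member_le_sum[of r "{..<R}" p] by (auto simp: zf_feasible_def)

lemma bdd_above_zf_rate: "bdd_above (zf_rate R g ` zf_feasible R P)"
proof -
  have "zf_rate R g p \<le> (\<Sum>r<R. log 2 (1 + P * (g r)\<^sup>2))" if p: "p \<in> zf_feasible R P" for p
    unfolding zf_rate_def
  proof (rule sum_mono)
    fix r assume "r \<in> {..<R}"
    then have "0 \<le> p r" "p r \<le> P" using p zf_feasible_le[OF p] by (auto simp: zf_feasible_def)
    then show "log 2 (1 + p r * (g r)\<^sup>2) \<le> log 2 (1 + P * (g r)\<^sup>2)"
      by (subst log_le_cancel_iff) (auto intro!: add_pos_nonneg mult_right_mono)
  qed
  then show ?thesis by (intro bdd_aboveI) auto
qed

lemma zf_feasible_nonempty: "0 \<le> P \<Longrightarrow> (\<lambda>_. 0) \<in> zf_feasible R P"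
  by (simp add: zf_feasible_def)

lemma C_ZF_mono:
  assumes "0 \<le> P" "P \<le> P'"
  shows "C_ZF R M H P \<le> C_ZF R M H P'"
  unfolding C_ZF_eq_SUP
proof (rule cSUP_subset_mono[OF _ bdd_above_zf_rate])
  show "zf_feasible R P \<noteq> {}" using zf_feasible_nonempty[OF assms(1)] by auto
qed (use assms in \<open>auto simp: zf_feasible_def\<close>)

text \<open>The powers p / t are feasible for P, and each of the R summands loses at most log t
  because 1 + t x \<le> t (1 + x).\<close>

lemma C_ZF_scale:
  assumes P: "0 \<le> P" and t: "1 \<le> t"
  shows "C_ZF R M H (t * P) \<le> C_ZF R M H P + R * log 2 t"
  unfolding C_ZF_eq_SUP
proof (rule cSUP_least)
  let ?g = "zf_gain R M H"
  show "zf_feasible R (t * P) \<noteq> {}" using zf_feasible_nonempty[of "t * P"] P t by auto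
  fix p assume p: "p \<in> zf_feasible R (t * P)"
  define q where "q r = p r / t" for r
  have q: "q \<in> zf_feasible R P"
    using p t by (auto simp: zf_feasible_def q_def sum_divide_distrib[symmetric] field_simps)
  have "zf_rate R ?g p \<le> (\<Sum>r<R. log 2 t + log 2 (1 + q r * (?g r)\<^sup>2))"
    unfolding zf_rate_def
  proof (rule sum_mono)
    fix r assume "r \<in> {..<R}"
    then have q0: "0 \<le> q r" and pq: "p r = t * q r" using q t by (auto simp: zf_feasible_def q_def)
    have pos: "0 < 1 + q r * (?g r)\<^sup>2" using q0 by (auto intro!: add_pos_nonneg)
    have "log 2 (1 + p r * (?g r)\<^sup>2) \<le> log 2 (t * (1 + q r * (?g r)\<^sup>2))"
      using t q0 pos by (subst log_le_cancel_iff) (auto simp: pq distrib_left intro!: add_pos_nonneg)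
    also have "\<dots> = log 2 t + log 2 (1 + q r * (?g r)\<^sup>2)" using t pos by (simp add: log_mult)
    finally show "log 2 (1 + p r * (?g r)\<^sup>2) \<le> log 2 t + log 2 (1 + q r * (?g r)\<^sup>2)" .
  qed
  also have "\<dots> = R * log 2 t + zf_rate R ?g q" by (simp add: sum.distrib zf_rate_def)
  also have "zf_rate R ?g q \<le> (SUP p\<in>zf_feasible R P. zf_rate R ?g p)"
    by (rule cSUP_upper[OF q bdd_above_zf_rate])
  finally show "zf_rate R ?g p \<le> (SUP p\<in>zf_feasible R P. zf_rate R ?g p) + R * log 2 t" by simp
qed

text \<open>Writing 1 + p g^2 = (1 / g^2 + p) g^2 separates the gains from the powers. The
  arithmetic-geometric mean inequality applies to the factors 1 / g^2 + p, whose sum is at most P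
  plus the sum \<open>s\<close> of the 1 / g^2.\<close>

lemma C_ZF_bounds:
  assumes R: "0 < R" and g: "\<And>r. r < R \<Longrightarrow> 0 < (zf_gain R M H r)\<^sup>2"
  obtains s where "0 \<le> s" "\<forall>P>0.
     real R * log 2 (P / real R) + (\<Sum>r<R. log 2 ((zf_gain R M H r)\<^sup>2)) \<le> C_ZF R M H P \<and>
     C_ZF R M H P \<le> real R * log 2 ((P + s) / real R) + (\<Sum>r<R. log 2 ((zf_gain R M H r)\<^sup>2))"
proof -
  let ?g = "zf_gain R M H"
  define s where "s = (\<Sum>r<R. 1 / (?g r)\<^sup>2)"
  have s0: "0 \<le> s" unfolding s_def by (intro sum_nonneg) auto
  have lo: "real R * log 2 (P / real R) + (\<Sum>r<R. log 2 ((?g r)\<^sup>2)) \<le> C_ZF R M H P" if P: "0 < P" for P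
  proof -
    have "(\<lambda>_. P / R) \<in> zf_feasible R P" using P R by (auto simp: zf_feasible_def)
    then have "zf_rate R ?g (\<lambda>_. P / R) \<le> C_ZF R M H P"
      unfolding C_ZF_eq_SUP by (rule cSUP_upper[OF _ bdd_above_zf_rate])
    moreover have "(\<Sum>r<R. log 2 (P / R) + log 2 ((?g r)\<^sup>2)) \<le> zf_rate R ?g (\<lambda>_. P / R)"
      unfolding zf_rate_def
    proof (rule sum_mono)
      fix r assume r: "r \<in> {..<R}"
      have "log 2 (P / R) + log 2 ((?g r)\<^sup>2) = log 2 (P / R * (?g r)\<^sup>2)"
        using P R g[of r] r by (subst log_mult) auto
      also have "\<dots> \<le> log 2 (1 + P / R * (?g r)\<^sup>2)"
        using P R g[of r] r by (subst log_le_cancel_iff) (auto intro!: add_pos_nonneg)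
      finally show "log 2 (P / R) + log 2 ((?g r)\<^sup>2) \<le> log 2 (1 + P / R * (?g r)\<^sup>2)" .
    qed
    ultimately show ?thesis by (simp add: sum.distrib)
  qed
  have up: "C_ZF R M H P \<le> real R * log 2 ((P + s) / real R) + (\<Sum>r<R. log 2 ((?g r)\<^sup>2))" if P: "0 < P" for P
    unfolding C_ZF_eq_SUP
  proof (rule cSUP_least)
    show "zf_feasible R P \<noteq> {}" using zf_feasible_nonempty[of P] P by auto
    fix p assume p: "p \<in> zf_feasible R P"
    define x where "x r = 1 / (?g r)\<^sup>2 + p r" for r
    have x: "0 < x r" if "r < R" for r using g[OF that] p that by (auto simp: x_def zf_feasible_def intro!: add_pos_nonneg)
    have sumx: "(\<Sum>r<R. x r) \<le> P + s" using p by (simp add: x_def sum.distrib s_def zf_feasible_def)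
    have px: "0 < (\<Prod>r<R. x r)" by (rule prod_pos) (use x in auto)
    have Ps: "0 < (P + s) / R" using P s0 R by (intro divide_pos_pos) auto
    have "(\<Prod>r<R. x r) powr (1 / R) \<le> (\<Sum>r<R. x r / R)"
      using arith_geom_mean[of "{..<R}" x] R x by (auto simp: less_imp_le)
    also have "\<dots> \<le> (P + s) / R" using sumx by (simp add: sum_divide_distrib[symmetric] divide_right_mono)
    finally have "log 2 ((\<Prod>r<R. x r) powr (1 / R)) \<le> log 2 ((P + s) / R)"
      using px Ps by (subst log_le_cancel_iff) (auto simp del: prod_zero_iff)
    then have "log 2 (\<Prod>r<R. x r) \<le> R * log 2 ((P + s) / R)"
      using R px by (simp add: log_powr field_simps del: prod_zero_iff)
    moreover have "log 2 (\<Prod>r<R. x r) = (\<Sum>r<R. log 2 (x r))"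
      unfolding log_def using x by (subst ln_prod) (force simp: sum_divide_distrib)+
    moreover have "zf_rate R ?g p = (\<Sum>r<R. log 2 (x r) + log 2 ((?g r)\<^sup>2))"
      unfolding zf_rate_def
    proof (rule sum.cong[OF refl])
      fix r assume "r \<in> {..<R}"
      then have r: "r < R" by simp
      have "1 + p r * (?g r)\<^sup>2 = x r * (?g r)\<^sup>2" using g[OF r] by (simp add: x_def field_simps)
      then show "log 2 (1 + p r * (?g r)\<^sup>2) = log 2 (x r) + log 2 ((?g r)\<^sup>2)"
        using g[OF r] x[OF r] by (simp add: log_mult)
    qed
    ultimately show "zf_rate R ?g p \<le> real R * log 2 ((P + s) / real R) + (\<Sum>r<R. log 2 ((?g r)\<^sup>2))"
      by (simp add: sum.distrib)
  qed
  show ?thesis by (rule that[OF s0]) (intro allI impI conjI lo up)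
qed

text \<open>Both capacities share the leading term R log (P / R), which cancels in the difference.
  The gap between upper and lower bound is R log (1 + v / P) with a constant v, and so tends to
  0.\<close>

lemma rate_loss_tendsto:
  assumes KN: "0 < K * N" and d: "det (gram (K * N) M h) \<noteq> 0"
    and D: "\<And>r. r < K * N \<Longrightarrow> det (mat_delete (gram (K * N) M h) r r) \<noteq> 0"
  shows "((\<lambda>P. C_DPC K N M (chan_mat (K * N) M h) P - C_ZF (K * N) M (chan_mat (K * N) M h) P) \<longlongrightarrow>
     log 2 (cmod (det (gram (K * N) M h))) -
     (\<Sum>r<K * N. log 2 (cmod (det (gram (K * N) M h))) - log 2 (cmod (det (mat_delete (gram (K * N) M h) r r))))) at_top"
proof -
  let ?R = "K * N" and ?H = "chan_mat (K * N) M h" and ?G = "gram (K * N) M h"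
  let ?d = "log 2 (cmod (det ?G))" and ?z = "\<Sum>r<?R. log 2 ((zf_gain ?R M ?H r)\<^sup>2)"
  have gain: "(zf_gain ?R M ?H r)\<^sup>2 = cmod (det ?G) / cmod (det (mat_delete ?G r r))" if "r < ?R" for r
    by (rule zf_gain_sq_eq_det[OF that D[OF that]])
  have pos: "0 < (zf_gain ?R M ?H r)\<^sup>2" if "r < ?R" for r
    using d D[OF that] by (simp add: gain that)
  have z: "?z = (\<Sum>r<?R. ?d - log 2 (cmod (det (mat_delete ?G r r))))"
    using d D by (intro sum.cong refl) (simp add: gain log_divide)
  obtain s where s: "0 \<le> s" "\<forall>P>0. real ?R * log 2 (P / real ?R) + ?d \<le> C_DPC K N M ?H P \<and>
     C_DPC K N M ?H P \<le> real ?R * log 2 ((P + s) / real ?R) + ?d"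
    by (rule C_DPC_bounds[OF KN d])
  obtain u where u: "0 \<le> u" "\<forall>P>0. real ?R * log 2 (P / real ?R) + ?z \<le> C_ZF ?R M ?H P \<and>
     C_ZF ?R M ?H P \<le> real ?R * log 2 ((P + u) / real ?R) + ?z"
    by (rule C_ZF_bounds[OF KN pos])
  have gap: "real ?R * log 2 ((P + v) / real ?R) - real ?R * log 2 (P / real ?R) = real ?R * log 2 (1 + v / P)"
    if "0 < P" "0 \<le> v" for P v
  proof -
    have "(P + v) / real ?R = P / real ?R * (1 + v / P)" using that KN by (simp add: field_simps)
    moreover have "0 < P / real ?R" "0 < 1 + v / P" using that KN by (auto intro!: add_pos_nonneg)
    ultimately have "log 2 ((P + v) / real ?R) = log 2 (P / real ?R) + log 2 (1 + v / P)"
      using log_power_mult[of "P / real ?R" "1 + v / P" 1] by (simp only: power_one_right of_nat_1 mult_1)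
    then show ?thesis by (simp add: algebra_simps)
  qed
  have lim: "((\<lambda>P. real ?R * log 2 (1 + v / P)) \<longlongrightarrow> 0) at_top" for v :: real
  proof -
    have "((\<lambda>P. v / P) \<longlongrightarrow> 0) at_top" by (rule tendsto_divide_0[OF tendsto_const filterlim_at_top_imp_at_infinity[OF filterlim_ident]])
    then have "((\<lambda>P. real ?R * log 2 (1 + v / P)) \<longlongrightarrow> real ?R * log 2 (1 + 0)) at_top"
      by (intro tendsto_intros) auto
    then show ?thesis by simp
  qed
  show ?thesis unfolding z[symmetric]
  proof (rule tendsto_sandwich)
    show "\<forall>\<^sub>F P in at_top. ?d - ?z - real ?R * log 2 (1 + u / P) \<le> C_DPC K N M ?H P - C_ZF ?R M ?H P"
      using eventually_gt_at_top[of 0]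
    proof eventually_elim
      case (elim P)
      show ?case using s(2)[rule_format, OF elim] u(2)[rule_format, OF elim] gap[OF elim u(1)] by linarith
    qed
    show "\<forall>\<^sub>F P in at_top. C_DPC K N M ?H P - C_ZF ?R M ?H P \<le> ?d - ?z + real ?R * log 2 (1 + s / P)"
      using eventually_gt_at_top[of 0]
    proof eventually_elim
      case (elim P)
      show ?case using s(2)[rule_format, OF elim] u(2)[rule_format, OF elim] gap[OF elim s(1)] by linarith
    qed
    show "((\<lambda>P. ?d - ?z - real ?R * log 2 (1 + u / P)) \<longlongrightarrow> ?d - ?z) at_top"
      using tendsto_diff[OF tendsto_const lim[of u], of "?d - ?z"] by simp
    show "((\<lambda>P. ?d - ?z + real ?R * log 2 (1 + s / P)) \<longlongrightarrow> ?d - ?z) at_top"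
      using tendsto_add[OF tendsto_const lim[of s], of "?d - ?z"] by simp
  qed
qed

subsection \<open>Measurability of the limiting loss\<close>

lemma continuous_on_det:
  fixes A :: "'a :: topological_space \<Rightarrow> complex mat"
  assumes c: "\<And>x. A x \<in> carrier_mat n n"
    and e: "\<And>i j. i < n \<Longrightarrow> j < n \<Longrightarrow> continuous_on S (\<lambda>x. A x $$ (i, j))"
  shows "continuous_on S (\<lambda>x. det (A x))"
proof -
  have "continuous_on S (\<lambda>x. \<Sum>p\<in>{p. p permutes {0..<n}}. signof p * (\<Prod>i = 0..<n. A x $$ (i, p i)))"
    by (intro continuous_on_sum continuous_on_mult continuous_on_const continuous_on_prod e)
      (use permutes_in_image in fastforce)+
  then show ?thesis by (simp only: det_def'[OF c])
qed

text \<open>The index set may be uncountable: the supremum is lower semicontinuous, since the set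
  where it exceeds y is a union of open sets.\<close>

lemma borel_measurable_SUP_continuous:
  fixes f :: "'i \<Rightarrow> 'a :: topological_space \<Rightarrow> real"
  assumes "I \<noteq> {}" "\<And>x. bdd_above ((\<lambda>i. f i x) ` I)" "\<And>i. i \<in> I \<Longrightarrow> continuous_on UNIV (f i)"
  shows "(\<lambda>x. SUP i\<in>I. f i x) \<in> borel_measurable borel"
proof (rule borel_measurableI_greater)
  fix y
  have "{x. y < (SUP i\<in>I. f i x)} = (\<Union>i\<in>I. {x. y < f i x})"
    using assms(1,2) by (auto simp: less_cSUP_iff)
  moreover have "open (\<Union>i\<in>I. {x. y < f i x})"
    using assms(3) by (intro open_UN ballI open_Collect_less continuous_on_const) auto
  ultimately show "{x \<in> space borel. y < (SUP i\<in>I. f i x)} \<in> sets borel" by simp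
qed

lemma borel_measurable_INF_continuous:
  fixes f :: "'i \<Rightarrow> 'a :: topological_space \<Rightarrow> real"
  assumes "I \<noteq> {}" "\<And>x. bdd_below ((\<lambda>i. f i x) ` I)" "\<And>i. i \<in> I \<Longrightarrow> continuous_on UNIV (f i)"
  shows "(\<lambda>x. INF i\<in>I. f i x) \<in> borel_measurable borel"
proof (rule borel_measurableI_less)
  fix y
  have "{x. (INF i\<in>I. f i x) < y} = (\<Union>i\<in>I. {x. f i x < y})"
    using assms(1,2) by (auto simp: cINF_less_iff)
  moreover have "open (\<Union>i\<in>I. {x. f i x < y})"
    using assms(3) by (intro open_UN ballI open_Collect_less continuous_on_const) auto
  ultimately show "{x \<in> space borel. (INF i\<in>I. f i x) < y} \<in> sets borel" by simp
qed

lemma continuous_on_dpc_rate: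
  assumes Q: "Q \<in> dpc_feasible K N P"
  shows "continuous_on UNIV (\<lambda>h. dpc_rate K N M h Q)"
proof -
  have c: "dpc_mat K N M h Q \<in> carrier_mat M M" for h using psd_carrier[OF psd_dpc_mat[OF Q]] .
  have "continuous_on UNIV (\<lambda>h. det (1\<^sub>m M + dpc_mat K N M h Q))"
  proof (rule continuous_on_det)
    show "1\<^sub>m M + dpc_mat K N M h Q \<in> carrier_mat M M" for h using c by simp
    fix i j assume ij: "i < M" "j < M"
    have "(1\<^sub>m M + dpc_mat K N M h Q) $$ (i, j) = 1\<^sub>m M $$ (i, j) +
      (\<Sum>a<K * N. \<Sum>b<K * N. cnj (h (a, i)) * block_diag K N Q $$ (a, b) * h (b, j))" for h
    proof -
      have "dpc_mat K N M h Q $$ (i, j) =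
        (\<Sum>a<K * N. \<Sum>b<K * N. cnj (h (a, i)) * block_diag K N Q $$ (a, b) * h (b, j))"
        unfolding dpc_mat_def index_congruence[OF block_diag_carrier chan_mat_carrier ij]
        by (intro sum.cong refl) (simp add: chan_mat_def ij)
      then show ?thesis using c[of h] ij by simp
    qed
    then show "continuous_on UNIV (\<lambda>h. (1\<^sub>m M + dpc_mat K N M h Q) $$ (i, j))"
      by (simp only:) (intro continuous_intros continuous_on_product_coordinates)
  qed
  moreover have "Re (det (1\<^sub>m M + dpc_mat K N M h Q)) > 0" for h
    using psd_det_one_plus(1)[OF psd_dpc_mat[OF Q, of M h]] by simp
  ultimately show ?thesis unfolding dpc_rate_def log_def
    by (intro continuous_on_divide continuous_on_ln continuous_on_const continuous_on_Re) (auto simp: less_imp_neq[symmetric])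
qed

lemma borel_measurable_C_DPC:
  assumes "0 \<le> P"
  shows "(\<lambda>h. C_DPC K N M (chan_mat (K * N) M h) P) \<in> borel_measurable borel"
  unfolding C_DPC_eq_SUP
proof (rule borel_measurable_SUP_continuous[OF _ bdd_above_dpc_rate continuous_on_dpc_rate])
  show "dpc_feasible K N P \<noteq> {}" using dpc_feasible_nonempty[OF assms] by auto
qed

lemma borel_measurable_zf_gain:
  assumes r: "r < R"
  shows "(\<lambda>h. zf_gain R M (chan_mat R M h) r) \<in> borel_measurable borel"
proof -
  have "(\<lambda>h. INF c. sqnorm M (residual R h r c)) \<in> borel_measurable borel"
  proof (rule borel_measurable_INF_continuous)
    show "bdd_below (range (\<lambda>c. sqnorm M (residual R h r c)))" for h
      using sqnorm_nonneg by (intro bdd_belowI[of _ 0]) auto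
    show "continuous_on UNIV (\<lambda>h. sqnorm M (residual R h r c))" for c
      unfolding sqnorm_def residual_def by (intro continuous_intros continuous_on_product_coordinates)
  qed auto
  then have "(\<lambda>h. sqrt ((zf_gain R M (chan_mat R M h) r)\<^sup>2)) \<in> borel_measurable borel"
    unfolding zf_gain_sq_eq_INF[OF r] by measurable
  moreover have "0 \<le> zf_gain R M H r" for H by (simp add: zf_gain_def vnorm_def sum_nonneg)
  ultimately show ?thesis by simp
qed

text \<open>The rate is continuous in the gains, but the gains are merely known to be measurable in
  the channel. The supremum is therefore taken as a function of the gain vector and composed with
  the gains afterwards.\<close>

lemma borel_measurable_C_ZF:
  assumes "0 \<le> P"
  shows "(\<lambda>h. C_ZF R M (chan_mat R M h) P) \<in> borel_measurable borel"
proof -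
  have 1: "(\<lambda>g. SUP p\<in>zf_feasible R P. zf_rate R g p) \<in> borel_measurable borel"
  proof (rule borel_measurable_SUP_continuous)
    show "zf_feasible R P \<noteq> {}" using zf_feasible_nonempty[OF assms] by auto
    show "bdd_above (zf_rate R g ` zf_feasible R P)" for g by (rule bdd_above_zf_rate)
    fix p assume p: "p \<in> zf_feasible R P"
    show "continuous_on UNIV (\<lambda>g. zf_rate R g p)" unfolding zf_rate_def log_def
    proof (intro continuous_on_sum continuous_on_divide continuous_on_ln continuous_on_const ballI)
      fix r assume r: "r \<in> {..<R}"
      show "continuous_on UNIV (\<lambda>g. 1 + p r * (g r)\<^sup>2)" by (intro continuous_intros continuous_on_product_coordinates)
      fix g :: "nat \<Rightarrow> real"
      have "0 < 1 + p r * (g r)\<^sup>2" using p r by (auto simp: zf_feasible_def intro!: add_pos_nonneg)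
      then show "1 + p r * (g r)\<^sup>2 \<noteq> 0" by simp
    qed auto
  qed
  \<comment> \<open>Gains are extended by 0 beyond R so that all coordinates of \<open>T\<close> are
    measurable, as measurability into the full function space demands.\<close>
  define T where "T h r = (if r < R then zf_gain R M (chan_mat R M h) r else 0)" for h r
  have "T \<in> borel_measurable borel"
  proof (rule measurable_coordinatewise_then_product)
    show "(\<lambda>h. T h r) \<in> borel_measurable borel" for r
      using borel_measurable_zf_gain[of r R M] by (cases "r < R") (simp_all add: T_def)
  qed
  from measurable_compose[OF this 1]
  have "(\<lambda>h. SUP p\<in>zf_feasible R P. zf_rate R (T h) p) \<in> borel_measurable borel" .
  moreover have "zf_rate R (T h) p = zf_rate R (zf_gain R M (chan_mat R M h)) p" for h p
    by (simp add: zf_rate_def T_def)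
  ultimately show ?thesis unfolding C_ZF_eq_SUP by simp
qed

section \<open>From Borel maps to the channel law, and from real to integer powers\<close>

lemma sets_cgauss [simp, measurable_cong]: "sets cgauss = sets borel"
  by (simp add: cgauss_def)

lemma space_cgauss [simp]: "space cgauss = UNIV"
  by (simp add: cgauss_def)

text \<open>The capacities only see the entries in the index rectangle, so a map that is Borel on
  the full function space is measurable for the product \<sigma>-algebra.\<close>
lemma measurable_channel_law:
  assumes f: "f \<in> borel_measurable borel"
    and dep: "\<And>h h'. (\<And>x. x \<in> {..<R} \<times> {..<M} \<Longrightarrow> h x = h' x) \<Longrightarrow> f h = f h'"
  shows "f \<in> borel_measurable (channel_law R M)"
proof -
  let ?I = "{..<R} \<times> {..<M}"
  \<comment> \<open>Extension by 0 is measurable coordinate by coordinate, and f cannot distinguish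
    h from \<open>e h\<close>.\<close>
  define e where "e h x = (if x \<in> ?I then h x else 0)" for h :: "nat \<times> nat \<Rightarrow> complex" and x
  have "e \<in> borel_measurable (channel_law R M)"
  proof (rule measurable_coordinatewise_then_product)
    fix x
    show "(\<lambda>h. e h x) \<in> borel_measurable (channel_law R M)"
    proof (cases "x \<in> ?I")
      case True
      then have "(\<lambda>h. h x) \<in> measurable (channel_law R M) cgauss"
        unfolding channel_law_def by (rule measurable_component_singleton)
      then show ?thesis using True by (simp add: e_def cong: measurable_cong_sets)
    qed (simp only: e_def if_False measurable_const space_borel UNIV_I)
  qed
  from measurable_compose[OF this f] have "(\<lambda>h. f (e h)) \<in> borel_measurable (channel_law R M)" .
  moreover have "f (e h) = f h" for h by (rule dep) (simp add: e_def)
  ultimately show ?thesis by simp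
qed

lemma chan_mat_cong: "(\<And>x. x \<in> {..<R} \<times> {..<M} \<Longrightarrow> h x = h' x) \<Longrightarrow> chan_mat R M h = chan_mat R M h'"
  by (auto simp: chan_mat_def intro!: cong_mat)

text \<open>The variation of D on [n, n + 1] is at most c log (1 + 1 / n), which tends to 0. The
  equivalence is needed in both directions in order to equate the limits as descriptions.\<close>

lemma tendsto_at_top_iff_sequentially:
  fixes D :: "real \<Rightarrow> real"
  assumes b: "\<And>P n. 1 \<le> n \<Longrightarrow> real n \<le> P \<Longrightarrow> P \<le> real n + 1 \<Longrightarrow> \<bar>D P - D (real n)\<bar> \<le> c * log 2 (1 + 1 / real n)"
  shows "(D \<longlongrightarrow> l) at_top \<longleftrightarrow> (\<lambda>n. D (real n)) \<longlonglongrightarrow> l"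
proof
  assume "(D \<longlongrightarrow> l) at_top"
  then show "(\<lambda>n. D (real n)) \<longlonglongrightarrow> l" by (rule filterlim_compose[OF _ filterlim_real_sequentially])
next
  assume l: "(\<lambda>n. D (real n)) \<longlonglongrightarrow> l"
  have fl: "filterlim (\<lambda>P::real. nat \<lfloor>P\<rfloor>) sequentially at_top"
    by (rule filterlim_compose[OF filterlim_nat_sequentially filterlim_floor_sequentially])
  have "(\<lambda>n. c * log 2 (1 + 1 / real n)) \<longlonglongrightarrow> c * log 2 (1 + 0)"
    by (intro tendsto_intros lim_1_over_n) auto
  then have z0: "(\<lambda>n. c * log 2 (1 + 1 / real n)) \<longlonglongrightarrow> 0" by simp
  have z: "((\<lambda>P::real. c * log 2 (1 + 1 / real (nat \<lfloor>P\<rfloor>))) \<longlongrightarrow> 0) at_top"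
    by (rule filterlim_compose[OF z0 fl])
  have "((\<lambda>P. D P - D (real (nat \<lfloor>P\<rfloor>))) \<longlongrightarrow> 0) at_top"
  proof (rule Lim_null_comparison[OF _ z])
    show "\<forall>\<^sub>F P in at_top. norm (D P - D (real (nat \<lfloor>P\<rfloor>))) \<le> c * log 2 (1 + 1 / real (nat \<lfloor>P\<rfloor>))"
      using eventually_ge_at_top[of 1]
    proof eventually_elim
      case (elim P)
      then have "1 \<le> nat \<lfloor>P\<rfloor>" "real (nat \<lfloor>P\<rfloor>) \<le> P" "P \<le> real (nat \<lfloor>P\<rfloor>) + 1" by linarith+
      then show ?case unfolding real_norm_def by (rule b)
    qed
  qed
  from tendsto_add[OF this filterlim_compose[OF l fl]] show "(D \<longlongrightarrow> l) at_top" by simp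
qed

text \<open>Monotonicity bounds C P from below; the scaling law with ratio P / n, at most 1 + 1 / n,
  bounds it from above.\<close>

lemma capacity_increment:
  fixes C :: "real \<Rightarrow> real"
  assumes mono: "\<And>P P'. 0 \<le> P \<Longrightarrow> P \<le> P' \<Longrightarrow> C P \<le> C P'"
    and scale: "\<And>P t. 0 \<le> P \<Longrightarrow> 1 \<le> t \<Longrightarrow> C (t * P) \<le> C P + real m * log 2 t"
    and P: "1 \<le> n" "real n \<le> P" "P \<le> real n + 1"
  shows "\<bar>C P - C (real n)\<bar> \<le> real m * log 2 (1 + 1 / real n)"
proof -
  have "C P = C ((P / real n) * real n)" using P by simp
  also have "\<dots> \<le> C (real n) + real m * log 2 (P / real n)"
    using P by (intro scale) (auto simp: field_simps)
  also have "log 2 (P / real n) \<le> log 2 (1 + 1 / real n)"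
    using P by (subst log_le_cancel_iff) (auto simp: field_simps add_pos_nonneg)
  finally have "C P \<le> C (real n) + real m * log 2 (1 + 1 / real n)" by (simp add: mult_left_mono)
  moreover have "C (real n) \<le> C P" using P by (intro mono) auto
  ultimately show ?thesis by simp
qed

lemma borel_measurable_rate_loss:
  "(\<lambda>h. Lim at_top (\<lambda>P. C_DPC K N M (chan_mat (K * N) M h) P - C_ZF (K * N) M (chan_mat (K * N) M h) P))
     \<in> borel_measurable (channel_law (K * N) M)"
proof -
  let ?D = "\<lambda>h P. C_DPC K N M (chan_mat (K * N) M h) P - C_ZF (K * N) M (chan_mat (K * N) M h) P"
  \<comment> \<open>Both sides describe the unique limit value. Since the same l satisfy both
    descriptions, they agree for every h, even where no limit exists.\<close>
  have "Lim at_top (?D h) = lim (\<lambda>n. ?D h (real n))" for h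
  proof -
    have "\<bar>?D h P - ?D h (real n)\<bar> \<le> (real M + real (K * N)) * log 2 (1 + 1 / real n)"
      if n: "1 \<le> n" "real n \<le> P" "P \<le> real n + 1" for P n
      using capacity_increment[of "C_DPC K N M (chan_mat (K * N) M h)" M, OF C_DPC_mono C_DPC_scale n]
        capacity_increment[of "C_ZF (K * N) M (chan_mat (K * N) M h)" "K * N", OF C_ZF_mono C_ZF_scale n]
      unfolding distrib_right by linarith
    from tendsto_at_top_iff_sequentially[of "?D h", OF this]
    show ?thesis unfolding t2_space_class.Lim_def by simp
  qed
  moreover have "(\<lambda>h. lim (\<lambda>n. ?D h (real n))) \<in> borel_measurable (channel_law (K * N) M)"
  proof (rule borel_measurable_lim_metric)
    fix n
    show "(\<lambda>h. ?D h (real n)) \<in> borel_measurable (channel_law (K * N) M)"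
    proof (rule measurable_channel_law)
      show "(\<lambda>h. ?D h (real n)) \<in> borel_measurable borel"
        by (intro borel_measurable_diff borel_measurable_C_DPC borel_measurable_C_ZF) auto
      show "?D h (real n) = ?D h' (real n)" if "\<And>x. x \<in> {..<K * N} \<times> {..<M} \<Longrightarrow> h x = h' x" for h h'
        using chan_mat_cong[OF that] by simp
    qed
  qed
  ultimately show ?thesis by simp
qed

subsection \<open>Gaussian vectors and rotation invariance\<close>

text \<open>A disc of radius sqrt a has area pi * a. Agreement on the half-lines, which generate the
  Borel sets, takes the place of polar coordinates.\<close>

lemma distr_lborel_cmod_sq:
  "distr lborel borel (\<lambda>z::complex. (cmod z)\<^sup>2) = density lborel (\<lambda>t. ennreal pi * indicator {0..} t)"
proof (rule measure_eqI_generator_eq[where E = "range (\<lambda>a::real. {..a})" and \<Omega> = UNIV and A = "\<lambda>n. {..real n}"])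
  show "Int_stable (range (\<lambda>a::real. {..a}))"
    by (auto simp: Int_stable_def)
  have le: "emeasure (distr lborel borel (\<lambda>z::complex. (cmod z)\<^sup>2)) {..a} = ennreal pi * ennreal a" for a
  proof (cases "0 \<le> a")
    case True
    have "emeasure (distr lborel borel (\<lambda>z::complex. (cmod z)\<^sup>2)) {..a} = emeasure lborel {z::complex. (cmod z)\<^sup>2 \<le> a}"
      by (subst emeasure_distr) (auto simp: vimage_def)
    also have "{z::complex. (cmod z)\<^sup>2 \<le> a} = cball 0 (sqrt a)"
      using True by (auto simp: real_le_rsqrt) (metis norm_ge_zero real_sqrt_pow2 power_mono)
    also have "emeasure lborel \<dots> = ennreal pi * ennreal a"
      using True by (simp add: emeasure_cball unit_ball_vol_2 ennreal_mult')
    finally show ?thesis .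
  next
    case False
    then have "\<not> (cmod z)\<^sup>2 \<le> a" for z using zero_le_power2[of "cmod z"] by linarith
    then have "emeasure (distr lborel borel (\<lambda>z::complex. (cmod z)\<^sup>2)) {..a} = 0"
      by (subst emeasure_distr) (auto simp: vimage_def)
    then show ?thesis using False by (simp add: ennreal_neg)
  qed
  show "emeasure (distr lborel borel (\<lambda>z::complex. (cmod z)\<^sup>2)) X =
    emeasure (density lborel (\<lambda>t. ennreal pi * indicator {0..} t)) X" if Xr: "X \<in> range (\<lambda>a::real. {..a})" for X
  proof -
    obtain a where X: "X = {..a}" using Xr by auto
    have "emeasure (density lborel (\<lambda>t. ennreal pi * indicator {0..} t)) {..a} = (\<integral>\<^sup>+t. ennreal pi * indicator {0..a} t \<partial>lborel)"
      by (subst emeasure_density) (auto intro!: nn_integral_cong split: split_indicator)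
    also have "\<dots> = ennreal pi * ennreal a"
      by (subst nn_integral_cmult_indicator) (auto simp: emeasure_lborel_Icc_eq ennreal_neg)
    finally show ?thesis using X le by simp
  qed
  show "emeasure (distr lborel borel (\<lambda>z::complex. (cmod z)\<^sup>2)) {..real n} \<noteq> \<infinity>" for n
    unfolding le by (simp add: ennreal_mult_eq_top_iff)
  show "sets (distr lborel borel (\<lambda>z::complex. (cmod z)\<^sup>2)) = sigma_sets UNIV (range (\<lambda>a::real. {..a}))"
    "sets (density lborel (\<lambda>t. ennreal pi * indicator {0..} t)) = sigma_sets UNIV (range (\<lambda>a::real. {..a}))"
    by (simp_all add: borel_eq_atMost)
  show "(\<Union>n. {..real n}) = UNIV" using real_arch_simple by auto
qed auto

text \<open>The Gaussian density depends on |z|^2 only, so its image is exp (- t) / pi against pi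
  times Lebesgue measure: a standard exponential law. The total mass of \<open>cgauss\<close> is
  read off from it next.\<close>

lemma distr_cgauss_cmod_sq:
  "distr cgauss borel (\<lambda>z. (cmod z)\<^sup>2) = density lborel (exponential_density 1)"
proof -
  have "distr cgauss borel (\<lambda>z. (cmod z)\<^sup>2) = density (distr lborel borel (\<lambda>z::complex. (cmod z)\<^sup>2)) (\<lambda>t. ennreal (exp (- t) / pi))"
    unfolding cgauss_def by (subst density_distr) auto
  also have "\<dots> = density lborel (\<lambda>t. ennreal pi * indicator {0..} t * ennreal (exp (- t) / pi))"
    unfolding distr_lborel_cmod_sq by (subst density_density_eq) auto
  also have "\<dots> = density lborel (exponential_density 1)"
  proof (rule density_cong)
    have "ennreal pi * ennreal (exp (- t) / pi) = ennreal (exp (- t))" for t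
      by (subst ennreal_mult[symmetric]) auto
    then show "AE t in lborel. ennreal pi * indicator {0..} t * ennreal (exp (- t) / pi) = ennreal (exponential_density 1 t)"
      by (auto simp: exponential_density_def split: split_indicator)
  qed auto
  finally show ?thesis .
qed

lemma prob_space_cgauss: "prob_space cgauss"
proof -
  interpret E: prob_space "distr cgauss borel (\<lambda>z. (cmod z)\<^sup>2)"
    unfolding distr_cgauss_cmod_sq by (rule prob_space_exponential_density) simp
  have "emeasure cgauss UNIV = emeasure (distr cgauss borel (\<lambda>z. (cmod z)\<^sup>2)) UNIV"
    by (subst emeasure_distr) auto
  also have "\<dots> = 1" using E.emeasure_space_1 by simp
  finally show ?thesis by (intro prob_spaceI) simp
qed

interpretation cgauss: prob_space cgauss by (rule prob_space_cgauss)
interpretation cgauss_product: product_sigma_finite "\<lambda>_. cgauss" by standard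

lemma prob_space_channel_law: "prob_space (channel_law R M)"
  unfolding channel_law_def by (intro prob_space_PiM prob_space_cgauss)

text \<open>A sum of independent standard exponential variables is Gamma distributed. The function
  \<open>erlang_density k\<close> has shape k + 1, hence the index
  \<open>card I - 1\<close>.\<close>

lemma distr_PiM_cgauss_sum_sq:
  assumes I: "finite I" "I \<noteq> {}"
  shows "distr (PiM I (\<lambda>_. cgauss)) borel (\<lambda>w. \<Sum>i\<in>I. (cmod (w i))\<^sup>2) = density lborel (erlang_density (card I - 1) 1)"
proof -
  let ?E = "density lborel (exponential_density 1)"
  interpret P: prob_space "PiM I (\<lambda>_. cgauss)" by (intro prob_space_PiM prob_space_cgauss)
  have E: "prob_space ?E" by (rule prob_space_exponential_density) simp
  have comp: "distr (PiM I (\<lambda>_. cgauss)) borel (\<lambda>w. (cmod (w i))\<^sup>2) = ?E" if "i \<in> I" for i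
  proof -
    have "distr (PiM I (\<lambda>_. cgauss)) borel (\<lambda>w. (cmod (w i))\<^sup>2) =
      distr (distr (PiM I (\<lambda>_. cgauss)) cgauss (\<lambda>w. w i)) borel (\<lambda>z. (cmod z)\<^sup>2)"
      using that by (subst distr_distr) (auto simp: comp_def)
    also have "distr (PiM I (\<lambda>_. cgauss)) cgauss (\<lambda>w. w i) = cgauss"
      using that by (intro distr_PiM_component prob_space_cgauss)
    finally show ?thesis by (simp add: distr_cgauss_cmod_sq)
  qed
  have "P.indep_vars (\<lambda>_. borel) (\<lambda>i w. (cmod (w i))\<^sup>2) I"
  proof (subst P.indep_vars_iff_distr_eq_PiM'[OF I(2)])
    show "(\<lambda>w. (cmod (w i))\<^sup>2) \<in> borel_measurable (PiM I (\<lambda>_. cgauss))" if "i \<in> I" for i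
      using that by measurable
    have "distr (PiM I (\<lambda>_. cgauss)) (\<Pi>\<^sub>M i\<in>I. borel) (\<lambda>w. \<lambda>i\<in>I. (cmod (w i))\<^sup>2) =
       distr (PiM I (\<lambda>_. cgauss)) (\<Pi>\<^sub>M i\<in>I. ?E) (compose I (\<lambda>z. (cmod z)\<^sup>2))"
      by (intro distr_cong sets_PiM_cong) (auto simp: compose_def)
    also have "\<dots> = PiM I (\<lambda>_. distr cgauss ?E (\<lambda>z. (cmod z)\<^sup>2))"
      by (rule distr_PiM_finite_prob_space') (auto simp: I E prob_space_cgauss)
    also have "distr cgauss ?E (\<lambda>z. (cmod z)\<^sup>2) = ?E"
      unfolding distr_cgauss_cmod_sq[symmetric] by (rule distr_cong) auto
    also have "PiM I (\<lambda>_. ?E) = PiM I (\<lambda>i. distr (PiM I (\<lambda>_. cgauss)) borel (\<lambda>w. (cmod (w i))\<^sup>2))"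
      by (rule PiM_cong) (auto simp: comp)
    finally show "distr (PiM I (\<lambda>_. cgauss)) (\<Pi>\<^sub>M i\<in>I. borel) (\<lambda>w. \<lambda>i\<in>I. (cmod (w i))\<^sup>2) =
      PiM I (\<lambda>i. distr (PiM I (\<lambda>_. cgauss)) borel (\<lambda>w. (cmod (w i))\<^sup>2))" .
  qed
  moreover have "distributed (PiM I (\<lambda>_. cgauss)) lborel (\<lambda>w. (cmod (w i))\<^sup>2) (exponential_density 1)" if "i \<in> I" for i
    unfolding distributed_def using that comp[OF that]
    by (auto cong: distr_cong simp: exponential_density_nonneg)
  ultimately have "distributed (PiM I (\<lambda>_. cgauss)) lborel (\<lambda>w. \<Sum>i\<in>I. (cmod (w i))\<^sup>2) (erlang_density (card I - 1) 1)"
    by (intro P.exponential_distributed_sum I) auto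
  then show ?thesis unfolding distributed_def by (auto cong: distr_cong)
qed

text \<open>A unitary matrix of determinant one whose off-diagonal entry b does not vanish is a
  product of three shears, and shears preserve Lebesgue measure by translation invariance.\<close>
lemma nn_integral_lborel_rotate:
  fixes F :: "complex \<times> complex \<Rightarrow> ennreal"
  assumes F: "F \<in> borel_measurable borel" and ab: "a * cnj a + b * cnj b = 1" and b: "b \<noteq> 0"
  shows "(\<integral>\<^sup>+x. \<integral>\<^sup>+y. F (a * x + b * y, - cnj b * x + cnj a * y) \<partial>lborel \<partial>lborel) = (\<integral>\<^sup>+x. \<integral>\<^sup>+y. F (x, y) \<partial>lborel \<partial>lborel)"
proof -
  have trans: "(\<integral>\<^sup>+y. g (y + c) \<partial>lborel) = (\<integral>\<^sup>+y. g y \<partial>lborel)" if [measurable]: "g \<in> borel_measurable borel" for g :: "complex \<Rightarrow> ennreal" and c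
  proof -
    have "(\<integral>\<^sup>+y. g y \<partial>lborel) = (\<integral>\<^sup>+y. g y \<partial>distr lborel borel ((+) c))" by (simp add: lborel_distr_plus)
    also have "\<dots> = (\<integral>\<^sup>+y. g (y + c) \<partial>lborel)" by (subst nn_integral_distr) (auto simp: add.commute)
    finally show ?thesis by simp
  qed
  have swap: "(\<integral>\<^sup>+x. \<integral>\<^sup>+y. G (x, y) \<partial>lborel \<partial>lborel) = (\<integral>\<^sup>+y. \<integral>\<^sup>+x. G (x, y) \<partial>lborel \<partial>lborel)"
    if "G \<in> borel_measurable borel" for G :: "complex \<times> complex \<Rightarrow> ennreal"
    using lborel_pair.Fubini[of G] that by (simp add: lborel_prod)
  have sec: "(\<lambda>y. G (x, y)) \<in> borel_measurable borel" "(\<lambda>x. G (x, y)) \<in> borel_measurable borel"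
    if [measurable]: "G \<in> borel_measurable borel" for G :: "complex \<times> complex \<Rightarrow> ennreal" and x y
    by measurable
  have shear1: "(\<integral>\<^sup>+x. \<integral>\<^sup>+y. G (x, y + p * x) \<partial>lborel \<partial>lborel) = (\<integral>\<^sup>+x. \<integral>\<^sup>+y. G (x, y) \<partial>lborel \<partial>lborel)"
    if "G \<in> borel_measurable borel" for G :: "complex \<times> complex \<Rightarrow> ennreal" and p
    using trans[OF sec(1)[OF that]] by simp
  have shear2: "(\<integral>\<^sup>+x. \<integral>\<^sup>+y. G (x + p * y, y) \<partial>lborel \<partial>lborel) = (\<integral>\<^sup>+x. \<integral>\<^sup>+y. G (x, y) \<partial>lborel \<partial>lborel)"
    if [measurable]: "G \<in> borel_measurable borel" for G :: "complex \<times> complex \<Rightarrow> ennreal" and p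
  proof -
    have "(\<lambda>(x, y). G (x + p * y, y)) \<in> borel_measurable borel"
      unfolding borel_prod[symmetric] by measurable
    from swap[OF this] have "(\<integral>\<^sup>+x. \<integral>\<^sup>+y. G (x + p * y, y) \<partial>lborel \<partial>lborel) = (\<integral>\<^sup>+y. \<integral>\<^sup>+x. G (x + p * y, y) \<partial>lborel \<partial>lborel)"
      by simp
    also have "\<dots> = (\<integral>\<^sup>+y. \<integral>\<^sup>+x. G (x, y) \<partial>lborel \<partial>lborel)" using trans[OF sec(2)[OF that]] by simp
    finally show ?thesis using swap[OF that] by simp
  qed
  \<comment> \<open>The matrix with rows (a, b) and (- cnj b, cnj a) is a lower shear by p times an
    upper shear by b times a lower shear by q. The diagonal entries 1 + b q = a and 1 + b p = cnj a
    determine q and p, and determinant one settles the remaining entry.\<close>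
  define p q where "p = (cnj a - 1) / b" and "q = (a - 1) / b"
  note [measurable] = F
  have m3: "(\<lambda>(x, y). F (x, y + p * x)) \<in> borel_measurable borel"
    unfolding borel_prod[symmetric] by measurable
  have m2: "(\<lambda>(x, y). F (x + b * y, y + p * (x + b * y))) \<in> borel_measurable borel"
    unfolding borel_prod[symmetric] by measurable
  have "(\<integral>\<^sup>+x. \<integral>\<^sup>+y. F (x, y) \<partial>lborel \<partial>lborel) = (\<integral>\<^sup>+x. \<integral>\<^sup>+y. F (x, y + p * x) \<partial>lborel \<partial>lborel)"
    using shear1[OF F] by simp
  also have "\<dots> = (\<integral>\<^sup>+x. \<integral>\<^sup>+y. F (x + b * y, y + p * (x + b * y)) \<partial>lborel \<partial>lborel)"
    using shear2[OF m3, of b] by simp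
  also have "\<dots> = (\<integral>\<^sup>+x. \<integral>\<^sup>+y. F (x + b * (y + q * x), (y + q * x) + p * (x + b * (y + q * x))) \<partial>lborel \<partial>lborel)"
    using shear1[OF m2, of q] by simp
  also have "\<dots> = (\<integral>\<^sup>+x. \<integral>\<^sup>+y. F (a * x + b * y, - cnj b * x + cnj a * y) \<partial>lborel \<partial>lborel)"
  proof (intro nn_integral_cong arg_cong[where f = F] prod_eqI)
    fix x y
    have bq: "b * q = a - 1" and bp: "b * p = cnj a - 1" using b by (auto simp: p_def q_def)
    have "x + b * (y + q * x) = x + b * y + (b * q) * x" by (simp add: algebra_simps)
    then have 1: "x + b * (y + q * x) = a * x + b * y" by (simp add: bq algebra_simps)
    then show "fst (x + b * (y + q * x), y + q * x + p * (x + b * (y + q * x))) = fst (a * x + b * y, - cnj b * x + cnj a * y)"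
      by simp
    have "b * (q + p * a) = b * q + (b * p) * a" by (simp add: algebra_simps)
    also have "\<dots> = a * cnj a - 1" unfolding bq bp by (simp add: algebra_simps)
    also have "\<dots> = b * (- cnj b)" using ab by (simp add: algebra_simps)
    finally have "q + p * a = - cnj b" using b by (simp only: mult_cancel_left) simp
    moreover have "y + q * x + p * (a * x + b * y) = (q + p * a) * x + y * (1 + b * p)" by (simp add: algebra_simps)
    ultimately have "y + q * x + p * (a * x + b * y) = - cnj b * x + y * (1 + b * p)" by simp
    also have "\<dots> = - cnj b * x + cnj a * y" by (simp add: bp)
    finally show "snd (x + b * (y + q * x), y + q * x + p * (x + b * (y + q * x))) = snd (a * x + b * y, - cnj b * x + cnj a * y)"
      unfolding 1 by simp
  qed
  finally show ?thesis by simp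
qed

lemma cmod_sq_rotate:
  assumes "a * cnj a + b * cnj b = 1"
  shows "(cmod (a * x + b * y))\<^sup>2 + (cmod (- cnj b * x + cnj a * y))\<^sup>2 = (cmod x)\<^sup>2 + (cmod y)\<^sup>2"
proof -
  have "complex_of_real ((cmod (a * x + b * y))\<^sup>2 + (cmod (- cnj b * x + cnj a * y))\<^sup>2) =
    (a * cnj a + b * cnj b) * (x * cnj x + y * cnj y)"
    unfolding of_real_add complex_norm_square by (simp add: algebra_simps)
  also have "\<dots> = complex_of_real ((cmod x)\<^sup>2 + (cmod y)\<^sup>2)"
    unfolding assms of_real_add complex_norm_square by simp
  finally show ?thesis by (simp only: of_real_eq_iff)
qed

text \<open>The joint density of two entries is a function of |x|^2 + |y|^2, which the rotation
  preserves, so invariance of Lebesgue measure carries over.\<close>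

lemma nn_integral_cgauss_rotate:
  fixes f :: "complex \<times> complex \<Rightarrow> ennreal"
  assumes f [measurable]: "f \<in> borel_measurable borel" and ab: "a * cnj a + b * cnj b = 1" and b: "b \<noteq> 0"
  shows "(\<integral>\<^sup>+y. \<integral>\<^sup>+x. f (a * x + b * y, - cnj b * x + cnj a * y) \<partial>cgauss \<partial>cgauss) = (\<integral>\<^sup>+y. \<integral>\<^sup>+x. f (x, y) \<partial>cgauss \<partial>cgauss)"
proof -
  define d where "d z = ennreal (exp (- (cmod z)\<^sup>2) / pi)" for z :: complex
  have [measurable]: "d \<in> borel_measurable borel" unfolding d_def by measurable
  have expand: "(\<integral>\<^sup>+y. \<integral>\<^sup>+x. g (x, y) \<partial>cgauss \<partial>cgauss) = (\<integral>\<^sup>+x. \<integral>\<^sup>+y. d x * d y * g (x, y) \<partial>lborel \<partial>lborel)"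
    if [measurable]: "g \<in> borel_measurable (borel \<Otimes>\<^sub>M borel)" for g
  proof -
    interpret pair_sigma_finite cgauss cgauss ..
    have "g \<in> borel_measurable (cgauss \<Otimes>\<^sub>M cgauss)" by measurable
    from Fubini[OF this] have "(\<integral>\<^sup>+y. \<integral>\<^sup>+x. g (x, y) \<partial>cgauss \<partial>cgauss) = (\<integral>\<^sup>+x. \<integral>\<^sup>+y. g (x, y) \<partial>cgauss \<partial>cgauss)" by simp
    also have "\<dots> = (\<integral>\<^sup>+x. d x * (\<integral>\<^sup>+y. d y * g (x, y) \<partial>lborel) \<partial>lborel)"
      unfolding cgauss_def d_def[symmetric] by (simp add: nn_integral_density)
    also have "\<dots> = (\<integral>\<^sup>+x. \<integral>\<^sup>+y. d x * d y * g (x, y) \<partial>lborel \<partial>lborel)"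
      by (intro nn_integral_cong) (simp add: nn_integral_cmult[symmetric] mult.assoc)
    finally show ?thesis .
  qed
  have dd: "d x * d y = ennreal (exp (- ((cmod x)\<^sup>2 + (cmod y)\<^sup>2)) / pi\<^sup>2)" for x y
    unfolding d_def by (subst ennreal_mult[symmetric]) (auto simp: exp_diff exp_minus power2_eq_square field_simps exp_add)
  have m: "(\<lambda>(x, y). d x * d y * f (x, y)) \<in> borel_measurable borel"
    unfolding borel_prod[symmetric] by measurable
  have "(\<lambda>(x, y). f (a * x + b * y, - cnj b * x + cnj a * y)) \<in> borel_measurable (borel \<Otimes>\<^sub>M borel)"
    by measurable
  from expand[OF this]
  have "(\<integral>\<^sup>+y. \<integral>\<^sup>+x. f (a * x + b * y, - cnj b * x + cnj a * y) \<partial>cgauss \<partial>cgauss) =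
     (\<integral>\<^sup>+x. \<integral>\<^sup>+y. d x * d y * f (a * x + b * y, - cnj b * x + cnj a * y) \<partial>lborel \<partial>lborel)" by simp
  also have "\<dots> = (\<integral>\<^sup>+x. \<integral>\<^sup>+y. d (a * x + b * y) * d (- cnj b * x + cnj a * y) * f (a * x + b * y, - cnj b * x + cnj a * y) \<partial>lborel \<partial>lborel)"
    unfolding dd cmod_sq_rotate[OF ab] ..
  also have "\<dots> = (\<integral>\<^sup>+x. \<integral>\<^sup>+y. d x * d y * f (x, y) \<partial>lborel \<partial>lborel)"
    using nn_integral_lborel_rotate[OF m ab b] by simp
  also have "\<dots> = (\<integral>\<^sup>+y. \<integral>\<^sup>+x. f (x, y) \<partial>cgauss \<partial>cgauss)"
    by (rule expand[symmetric]) (simp add: borel_prod)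
  finally show ?thesis .
qed

lemma measurable_PiM_rotate:
  assumes I: "i \<in> I" "j \<in> I"
  shows "(\<lambda>w. w(j := - cnj b * w i + cnj a * w j, i := a * w i + b * w j))
    \<in> measurable (PiM I (\<lambda>_. cgauss)) (PiM I (\<lambda>_. cgauss))" (is "?T \<in> measurable ?P ?P")
proof (rule measurable_PiM_single')
  show "(\<lambda>w. ?T w k) \<in> measurable ?P cgauss" if k: "k \<in> I" for k
  proof -
    have c: "(\<lambda>w. w l) \<in> borel_measurable ?P" if "l \<in> I" for l
      using measurable_component_singleton[OF that, of "\<lambda>_. cgauss"] by (simp cong: measurable_cong_sets)
    have "(\<lambda>w. ?T w k) \<in> borel_measurable ?P"
      using c[OF I(1)] c[OF I(2)] c[OF k] by (cases "k = i"; cases "k = j") simp_all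
    then show ?thesis by (simp cong: measurable_cong_sets)
  qed
  show "?T \<in> space ?P \<rightarrow> I \<rightarrow>\<^sub>E space cgauss" using I by (auto simp: space_PiM PiE_def extensional_def)
qed

text \<open>Fubini's theorem isolates the coordinates i and j; with all others fixed, the
  two-dimensional invariance applies.\<close>

lemma nn_integral_PiM_rotate:
  assumes I: "finite I" "i \<in> I" "j \<in> I" "i \<noteq> j"
    and f [measurable]: "f \<in> borel_measurable (PiM I (\<lambda>_. cgauss))"
    and ab: "a * cnj a + b * cnj b = 1" and b: "b \<noteq> 0"
  shows "(\<integral>\<^sup>+w. f (w(j := - cnj b * w i + cnj a * w j, i := a * w i + b * w j)) \<partial>PiM I (\<lambda>_. cgauss)) =
    (\<integral>\<^sup>+w. f w \<partial>PiM I (\<lambda>_. cgauss))"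
proof -
  define J where "J = I - {i, j}"
  have IJ: "I = insert i (insert j J)" and J: "finite J" "j \<notin> J" "i \<notin> insert j J" using I by (auto simp: J_def)
  let ?P = "\<lambda>A. PiM A (\<lambda>_. cgauss)"
  have two: "(\<integral>\<^sup>+w. g w \<partial>?P I) = (\<integral>\<^sup>+w. \<integral>\<^sup>+y. \<integral>\<^sup>+x. g (w(j := y, i := x)) \<partial>cgauss \<partial>cgauss \<partial>?P J)"
    if g [measurable]: "g \<in> borel_measurable (?P I)" for g
  proof -
    have [measurable]: "g \<in> borel_measurable (?P (insert i (insert j J)))" using g by (simp add: IJ[symmetric])
    have "(\<integral>\<^sup>+w. g w \<partial>?P I) = (\<integral>\<^sup>+w. \<integral>\<^sup>+x. g (w(i := x)) \<partial>cgauss \<partial>?P (insert j J))"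
      unfolding IJ using J by (intro cgauss_product.product_nn_integral_insert) auto
    also have "\<dots> = (\<integral>\<^sup>+w. \<integral>\<^sup>+y. \<integral>\<^sup>+x. g (w(j := y, i := x)) \<partial>cgauss \<partial>cgauss \<partial>?P J)"
      using J by (intro cgauss_product.product_nn_integral_insert) auto
    finally show ?thesis .
  qed
  let ?T = "\<lambda>w. w(j := - cnj b * w i + cnj a * w j, i := a * w i + b * w j)"
  have T: "?T \<in> measurable (?P I) (?P I)" by (rule measurable_PiM_rotate[OF I(2,3)])
  have "(\<integral>\<^sup>+w. f (?T w) \<partial>?P I) = (\<integral>\<^sup>+w. \<integral>\<^sup>+y. \<integral>\<^sup>+x. f (?T (w(j := y, i := x))) \<partial>cgauss \<partial>cgauss \<partial>?P J)"
    by (rule two) (rule measurable_compose[OF T f])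
  also have "\<dots> = (\<integral>\<^sup>+w. \<integral>\<^sup>+y. \<integral>\<^sup>+x. f (w(j := - cnj b * x + cnj a * y, i := a * x + b * y)) \<partial>cgauss \<partial>cgauss \<partial>?P J)"
    using I by (simp add: fun_upd_twist)
  also have "\<dots> = (\<integral>\<^sup>+w. \<integral>\<^sup>+y. \<integral>\<^sup>+x. f (w(j := y, i := x)) \<partial>cgauss \<partial>cgauss \<partial>?P J)"
  proof (rule nn_integral_cong)
    fix w assume w: "w \<in> space (?P J)"
    have "(\<lambda>z. w(j := snd z, i := fst z)) \<in> measurable (borel \<Otimes>\<^sub>M borel) (?P I)"
    proof (rule measurable_PiM_single')
      show "(\<lambda>z. (w(j := snd z, i := fst z)) k) \<in> measurable (borel \<Otimes>\<^sub>M borel) cgauss" for k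
      proof -
        have "(\<lambda>z. (w(j := snd z, i := fst z)) k) \<in> borel_measurable (borel \<Otimes>\<^sub>M borel)"
          by (cases "k = i"; cases "k = j") simp_all
        then show ?thesis by (simp cong: measurable_cong_sets)
      qed
      show "(\<lambda>z. w(j := snd z, i := fst z)) \<in> space (borel \<Otimes>\<^sub>M borel) \<rightarrow> I \<rightarrow>\<^sub>E space cgauss"
        using w by (auto simp: IJ space_PiM PiE_def extensional_def)
    qed
    from measurable_compose[OF this f]
    have "(\<lambda>z. f (w(j := snd z, i := fst z))) \<in> borel_measurable borel" by (simp add: borel_prod)
    from nn_integral_cgauss_rotate[OF this ab b]
    show "(\<integral>\<^sup>+y. \<integral>\<^sup>+x. f (w(j := - cnj b * x + cnj a * y, i := a * x + b * y)) \<partial>cgauss \<partial>cgauss) =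
      (\<integral>\<^sup>+y. \<integral>\<^sup>+x. f (w(j := y, i := x)) \<partial>cgauss \<partial>cgauss)" by simp
  qed
  also have "\<dots> = (\<integral>\<^sup>+w. f w \<partial>?P I)" by (rule two[symmetric]) (rule f)
  finally show ?thesis .
qed

subsection \<open>The law of the Gram determinant\<close>

definition rotate_cols :: "nat \<Rightarrow> nat \<Rightarrow> complex \<Rightarrow> complex \<Rightarrow> (nat \<Rightarrow> complex) \<Rightarrow> nat \<Rightarrow> complex" where
  "rotate_cols j m a b x = x(m := - cnj b * x j + cnj a * x m, j := a * x j + b * x m)"

lemma sum_rotate_cols:
  assumes "j < M" "m < M" "j \<noteq> m" "a * cnj a + b * cnj b = 1"
  shows "(\<Sum>i<M. rotate_cols j m a b x i * cnj (rotate_cols j m a b y i)) = (\<Sum>i<M. x i * cnj (y i))"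
proof -
  have split: "(\<Sum>i<M. F i) = F j + F m + (\<Sum>i\<in>{..<M} - {j, m}. F i)" for F :: "nat \<Rightarrow> complex"
  proof -
    have "(\<Sum>i<M. F i) = (\<Sum>i\<in>{j, m}. F i) + (\<Sum>i\<in>{..<M} - {j, m}. F i)"
      using assms by (subst sum.subset_diff[of "{j, m}"]) (auto simp: add.commute)
    then show ?thesis using assms by simp
  qed
  have "rotate_cols j m a b x j * cnj (rotate_cols j m a b y j) + rotate_cols j m a b x m * cnj (rotate_cols j m a b y m) =
    (a * cnj a + b * cnj b) * (x j * cnj (y j) + x m * cnj (y m))"
    using assms(3) by (simp add: rotate_cols_def algebra_simps)
  also have "\<dots> = x j * cnj (y j) + x m * cnj (y m)" by (simp add: assms(4))
  finally show ?thesis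
    unfolding split by (simp add: rotate_cols_def)
qed

text \<open>The rows are rotated one at a time, \<open>k\<close> counting those already done.
  Rotating row k touches only the entries (k, j) and (k, m).\<close>

lemma nn_integral_rotate_rows:
  assumes jm: "j < M" "m < M" "j \<noteq> m" and ab: "a * cnj a + b * cnj b = 1" "b \<noteq> 0"
    and k: "k \<le> R" and f: "f \<in> borel_measurable (channel_law R M)"
  shows "(\<integral>\<^sup>+h. f (\<lambda>(r, i). if r < k then rotate_cols j m a b (\<lambda>i. h (r, i)) i else h (r, i)) \<partial>channel_law R M) =
    (\<integral>\<^sup>+h. f h \<partial>channel_law R M)"
  using k f
proof (induction k arbitrary: f)
  case 0
  then show ?case by simp
next
  case (Suc k)
  let ?I = "{..<R} \<times> {..<M}"
  let ?G = "\<lambda>k h (r, i). if r < k then rotate_cols j m a b (\<lambda>i. h (r, i)) i else h (r, i)"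
  let ?T = "\<lambda>h. h((k, m) := - cnj b * h (k, j) + cnj a * h (k, m), (k, j) := a * h (k, j) + b * h (k, m))"
  have T: "(\<lambda>h. f (?T h)) \<in> borel_measurable (channel_law R M)"
  proof (rule measurable_compose[OF _ Suc.prems(2)])
    show "?T \<in> measurable (channel_law R M) (channel_law R M)"
      unfolding channel_law_def
      by (rule measurable_PiM_rotate) (use Suc.prems jm in auto)
  qed
  have eq: "?G (Suc k) h = ?T (?G k h)" for h
    using jm by (auto simp: rotate_cols_def fun_eq_iff less_Suc_eq)
  have "(\<integral>\<^sup>+h. f (?G (Suc k) h) \<partial>channel_law R M) = (\<integral>\<^sup>+h. f (?T (?G k h)) \<partial>channel_law R M)"
    by (simp only: eq)
  also have "\<dots> = (\<integral>\<^sup>+h. f (?T h) \<partial>channel_law R M)"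
    by (rule Suc.IH[OF _ T]) (use Suc.prems in simp)
  also have "\<dots> = (\<integral>\<^sup>+h. f h \<partial>channel_law R M)"
    using Suc.prems jm ab unfolding channel_law_def by (intro nn_integral_PiM_rotate) auto
  finally show ?case .
qed

text \<open>The last row is kept as a separate argument because it is fixed by Fubini's theorem
  while the other rows stay random.\<close>

definition add_row :: "nat \<Rightarrow> (nat \<times> nat \<Rightarrow> complex) \<Rightarrow> (nat \<Rightarrow> complex) \<Rightarrow> nat \<times> nat \<Rightarrow> complex" where
  "add_row R h x = (\<lambda>(r, i). if r < R then h (r, i) else x i)"

lemma gram_cong: "(\<And>x. x \<in> {..<R} \<times> {..<M} \<Longrightarrow> h x = h' x) \<Longrightarrow> gram R M h = gram R M h'"
  by (auto simp: gram_def intro!: cong_mat)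

text \<open>Only entry m of the last row is nonzero, so column m adds a rank-one term
  \<open>u * v\<close> to the Gram matrix of the first m columns, and the whole matrix factors into
  a block upper and a block lower triangular one.\<close>

lemma det_gram_add_row:
  assumes x: "\<And>i. i < m \<Longrightarrow> x i = 0"
  shows "det (gram (Suc R) (Suc m) (add_row R h x)) = x m * cnj (x m) * det (gram R m h)"
proof -
  let ?A = "gram R m h"
  define u where "u = mat R 1 (\<lambda>(r, _). h (r, m))"
  define v where "v = mat 1 R (\<lambda>(_, r). cnj (h (r, m)))"
  define c where "c = mat 1 1 (\<lambda>_. x m)"
  define c' where "c' = mat 1 1 (\<lambda>_. cnj (x m))"
  have c: "u \<in> carrier_mat R 1" "v \<in> carrier_mat 1 R" "c \<in> carrier_mat 1 1" "c' \<in> carrier_mat 1 1"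
    by (auto simp: u_def v_def c_def c'_def)
  let ?X = "four_block_mat (1\<^sub>m R) u (0\<^sub>m 1 R) c"
  let ?Y = "four_block_mat ?A (0\<^sub>m R 1) v c'"
  have X: "?X \<in> carrier_mat (R + 1) (R + 1)" and Y: "?Y \<in> carrier_mat (R + 1) (R + 1)"
    by (rule four_block_carrier_mat[OF one_carrier_mat c(3)], rule four_block_carrier_mat[OF gram_carrier c(4)])
  have "gram (Suc R) (Suc m) (add_row R h x) = ?X * ?Y"
  proof -
    have "?X * ?Y = four_block_mat (1\<^sub>m R * ?A + u * v) (1\<^sub>m R * 0\<^sub>m R 1 + u * c') (0\<^sub>m 1 R * ?A + c * v) (0\<^sub>m 1 R * 0\<^sub>m R 1 + c * c')"
      by (rule mult_four_block_mat[of _ R R _ 1 _ 1 _ _ R _ 1]) (use c gram_carrier[of R m h] in auto)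
    also have "\<dots> = gram (Suc R) (Suc m) (add_row R h x)"
    proof (rule eq_matI)
      fix i j assume "i < dim_row (gram (Suc R) (Suc m) (add_row R h x))" "j < dim_col (gram (Suc R) (Suc m) (add_row R h x))"
      then have ij: "i < Suc R" "j < Suc R" by (auto simp: gram_def)
      have d: "dim_row ?A = R" "dim_col ?A = R" using gram_carrier[of R m h] by (auto simp del: gram_carrier)
      show "four_block_mat (1\<^sub>m R * ?A + u * v) (1\<^sub>m R * 0\<^sub>m R 1 + u * c') (0\<^sub>m 1 R * ?A + c * v) (0\<^sub>m 1 R * 0\<^sub>m R 1 + c * c') $$ (i, j) =
        gram (Suc R) (Suc m) (add_row R h x) $$ (i, j)"
      proof (cases "i < R"; cases "j < R")
        assume "i < R" "j < R"
        then show ?thesis using c d ij by (auto simp: index_gram add_row_def u_def v_def scalar_prod_def)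
      next
        assume "i < R" "\<not> j < R"
        moreover from this ij have "j = R" by simp
        ultimately show ?thesis using c d x by (auto simp: index_gram add_row_def u_def c'_def scalar_prod_def)
      next
        assume "\<not> i < R" "j < R"
        moreover from this ij have "i = R" by simp
        ultimately show ?thesis using c d x by (auto simp: index_gram add_row_def v_def c_def scalar_prod_def)
      next
        assume "\<not> i < R" "\<not> j < R"
        moreover from this ij have "i = R" "j = R" by auto
        ultimately show ?thesis using c d x by (auto simp: index_gram add_row_def c_def c'_def scalar_prod_def)
      qed
    qed (use c gram_carrier[of R m h] in \<open>auto simp: gram_def\<close>)
    finally show ?thesis by simp
  qed
  then have "det (gram (Suc R) (Suc m) (add_row R h x)) = det ?X * det ?Y" using det_mult[OF X Y] by simp
  also have "det ?X = det c" by (subst det_four_block_mat_lower_left_zero[of _ R _ 1]) (use c in auto)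
  also have "det c = x m" by (simp add: c_def det_single)
  also have "det ?Y = det ?A * det c'" by (subst det_four_block_mat_upper_right_zero[of _ R _ 1]) (use c in auto)
  also have "det c' = cnj (x m)" by (simp add: c'_def det_single)
  finally show ?thesis by simp
qed

lemma continuous_on_det_gram: "continuous_on UNIV (\<lambda>h. det (gram R M h))"
  by (rule continuous_on_det[OF gram_carrier], subst index_gram, assumption, assumption)
    (intro continuous_intros continuous_on_product_coordinates)

lemma borel_measurable_cmod_det_gram [measurable]:
  "(\<lambda>h. cmod (det (gram R M h))) \<in> borel_measurable (channel_law R M)"
proof (rule measurable_channel_law)
  show "(\<lambda>h. cmod (det (gram R M h))) \<in> borel_measurable borel"
    by (intro borel_measurable_continuous_onI continuous_on_norm continuous_on_det_gram)
qed (metis gram_cong)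

lemma borel_measurable_cmod_det_add_row:
  "(\<lambda>h. cmod (det (gram (Suc R) M (add_row R h x)))) \<in> borel_measurable (channel_law R M)"
proof (rule measurable_channel_law)
  have "continuous_on UNIV (\<lambda>h. add_row R h x)"
  proof (rule continuous_on_coordinatewise_then_product)
    fix p :: "nat \<times> nat"
    show "continuous_on UNIV (\<lambda>h. add_row R h x p)"
      by (cases p; cases "fst p < R") (auto simp: add_row_def)
  qed
  then have "continuous_on UNIV (\<lambda>h. det (gram (Suc R) M (add_row R h x)))"
    using continuous_on_compose2[OF continuous_on_det_gram] by blast
  then show "(\<lambda>h. cmod (det (gram (Suc R) M (add_row R h x)))) \<in> borel_measurable borel"
    by (intro borel_measurable_continuous_onI continuous_on_norm)
  show "cmod (det (gram (Suc R) M (add_row R h x))) = cmod (det (gram (Suc R) M (add_row R h' x)))"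
    if "\<And>p. p \<in> {..<R} \<times> {..<M} \<Longrightarrow> h p = h' p" for h h'
    by (intro arg_cong[where f = cmod] arg_cong[where f = det] gram_cong) (auto simp: add_row_def that)
qed

text \<open>Rotating column i into the last column m, for i = 0, ..., m - 1, clears the appended row
  up to its last entry.  Each rotation leaves the Gram matrix and the law of the other rows unchanged.\<close>
lemma nn_integral_det_add_row_reduce:
  fixes \<phi> :: "real \<Rightarrow> ennreal"
  assumes \<phi>: "\<phi> \<in> borel_measurable borel" and k: "k \<le> m"
  shows "\<exists>y. (\<forall>i<k. y i = 0) \<and> sqnorm (Suc m) y = sqnorm (Suc m) x \<and>
    (\<integral>\<^sup>+h. \<phi> (cmod (det (gram (Suc R) (Suc m) (add_row R h y)))) \<partial>channel_law R (Suc m)) =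
    (\<integral>\<^sup>+h. \<phi> (cmod (det (gram (Suc R) (Suc m) (add_row R h x)))) \<partial>channel_law R (Suc m))"
  using k
proof (induction k)
  case 0
  then show ?case by (intro exI[of _ x]) simp
next
  case (Suc k)
  let ?\<Phi> = "\<lambda>y. \<integral>\<^sup>+h. \<phi> (cmod (det (gram (Suc R) (Suc m) (add_row R h y)))) \<partial>channel_law R (Suc m)"
  from Suc obtain y where y: "\<forall>i<k. y i = 0" "sqnorm (Suc m) y = sqnorm (Suc m) x" "?\<Phi> y = ?\<Phi> x"
    by auto
  show ?case
  proof (cases "y k = 0")
    case True
    then show ?thesis using y by (intro exI[of _ y]) (auto simp: less_Suc_eq)
  next
    case False
    define \<rho> where "\<rho> = sqrt ((cmod (y k))\<^sup>2 + (cmod (y m))\<^sup>2)"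
    have \<rho>: "0 < \<rho>" using False by (auto simp: \<rho>_def intro!: add_pos_nonneg)
    \<comment> \<open>With this choice the new entry k is a * y k + b * y m = 0. The entry b is
      nonzero because y k is, as the factorization into shears requires.\<close>
    define a b where "a = - y m / complex_of_real \<rho>" and "b = y k / complex_of_real \<rho>"
    have b: "b \<noteq> 0" using False \<rho> by (simp add: b_def)
    have "a * cnj a + b * cnj b = (y m * cnj (y m) + y k * cnj (y k)) / (complex_of_real \<rho> * complex_of_real \<rho>)"
      by (simp add: a_def b_def add_divide_distrib)
    also have "y m * cnj (y m) + y k * cnj (y k) = complex_of_real (\<rho>\<^sup>2)"
      by (simp add: \<rho>_def complex_norm_square del: of_real_power)
    also have "complex_of_real (\<rho>\<^sup>2) / (complex_of_real \<rho> * complex_of_real \<rho>) = 1"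
      using \<rho> by (simp add: power2_eq_square)
    finally have ab: "a * cnj a + b * cnj b = 1" .
    have km: "k < Suc m" "m < Suc m" "k \<noteq> m" using Suc.prems by auto
    let ?y = "rotate_cols k m a b y"
    let ?G = "\<lambda>h (r, i). if r < R then rotate_cols k m a b (\<lambda>i. h (r, i)) i else h (r, i)"
    have zero: "\<forall>i<Suc k. ?y i = 0"
      using y(1) km by (auto simp: rotate_cols_def less_Suc_eq a_def b_def)
    have norm: "sqnorm (Suc m) ?y = sqnorm (Suc m) y"
    proof -
      have "complex_of_real (sqnorm (Suc m) ?y) = complex_of_real (sqnorm (Suc m) y)"
        unfolding cip_self[symmetric] cip_def using sum_rotate_cols[OF km ab, of y y] by (simp only: mult.commute)
      then show ?thesis by (simp only: of_real_eq_iff)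
    qed
    have gram: "gram (Suc R) (Suc m) (add_row R (?G h) ?y) = gram (Suc R) (Suc m) (add_row R h y)" for h
    proof (rule eq_matI)
      fix r s assume "r < dim_row (gram (Suc R) (Suc m) (add_row R h y))" "s < dim_col (gram (Suc R) (Suc m) (add_row R h y))"
      then have rs: "r < Suc R" "s < Suc R" by (auto simp: gram_def)
      have "add_row R (?G h) ?y (r, i) = rotate_cols k m a b (\<lambda>i. add_row R h y (r, i)) i" for r i
        by (auto simp: add_row_def)
      then show "gram (Suc R) (Suc m) (add_row R (?G h) ?y) $$ (r, s) = gram (Suc R) (Suc m) (add_row R h y) $$ (r, s)"
        unfolding index_gram[OF rs] by (simp only: sum_rotate_cols[OF km ab])
    qed (auto simp: gram_def)
    have "?\<Phi> ?y = (\<integral>\<^sup>+h. \<phi> (cmod (det (gram (Suc R) (Suc m) (add_row R (?G h) ?y)))) \<partial>channel_law R (Suc m))"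
      by (rule nn_integral_rotate_rows[OF km ab b le_refl, symmetric])
        (rule measurable_compose[OF borel_measurable_cmod_det_add_row \<phi>])
    also have "\<dots> = ?\<Phi> y" by (simp only: gram)
    finally show ?thesis using zero norm y by (intro exI[of _ ?y]) simp
  qed
qed

text \<open>Selecting distinct entries of an i.i.d. array gives an i.i.d. array. This is used both
  for dropping the last column and for deleting a row.\<close>

lemma distr_channel_law_reindex:
  assumes "inj_on f ({..<R} \<times> {..<M})" "f \<in> {..<R} \<times> {..<M} \<rightarrow> {..<R'} \<times> {..<M'}"
  shows "distr (channel_law R' M') (channel_law R M) (\<lambda>h. \<lambda>p\<in>{..<R} \<times> {..<M}. h (f p)) = channel_law R M"
  unfolding channel_law_def
  using distr_PiM_reindex[of "{..<R'} \<times> {..<M'}" "\<lambda>_. cgauss" f "{..<R} \<times> {..<M}"] assms prob_space_cgauss by simp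

lemma measurable_channel_law_reindex:
  assumes "f \<in> {..<R} \<times> {..<M} \<rightarrow> {..<R'} \<times> {..<M'}"
  shows "(\<lambda>h. \<lambda>p\<in>{..<R} \<times> {..<M}. h (f p)) \<in> measurable (channel_law R' M') (channel_law R M)"
  unfolding channel_law_def using assms by (intro measurable_restrict measurable_component_singleton) auto

text \<open>Once the whole norm of x sits in its last entry, the determinant is that squared norm
  times the Gram determinant of the first m columns. The last column of the random rows no longer
  occurs and is integrated out.\<close>

lemma nn_integral_det_add_row:
  fixes \<phi> :: "real \<Rightarrow> ennreal"
  assumes \<phi>: "\<phi> \<in> borel_measurable borel"
  shows "(\<integral>\<^sup>+h. \<phi> (cmod (det (gram (Suc R) (Suc m) (add_row R h x)))) \<partial>channel_law R (Suc m)) =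
    (\<integral>\<^sup>+h. \<phi> (sqnorm (Suc m) x * cmod (det (gram R m h))) \<partial>channel_law R m)"
proof -
  obtain y where y: "\<forall>i<m. y i = 0" "sqnorm (Suc m) y = sqnorm (Suc m) x"
    and eq: "(\<integral>\<^sup>+h. \<phi> (cmod (det (gram (Suc R) (Suc m) (add_row R h y)))) \<partial>channel_law R (Suc m)) =
    (\<integral>\<^sup>+h. \<phi> (cmod (det (gram (Suc R) (Suc m) (add_row R h x)))) \<partial>channel_law R (Suc m))"
    using nn_integral_det_add_row_reduce[OF \<phi> le_refl] by blast
  have "sqnorm (Suc m) y = (cmod (y m))\<^sup>2" using y(1) by (simp add: sqnorm_def)
  then have "cmod (det (gram (Suc R) (Suc m) (add_row R h y))) = sqnorm (Suc m) x * cmod (det (gram R m h))" for h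
    using det_gram_add_row[of m y R h] y by (simp add: norm_mult power2_eq_square)
  with eq have "(\<integral>\<^sup>+h. \<phi> (cmod (det (gram (Suc R) (Suc m) (add_row R h x)))) \<partial>channel_law R (Suc m)) =
    (\<integral>\<^sup>+h. \<phi> (sqnorm (Suc m) x * cmod (det (gram R m h))) \<partial>channel_law R (Suc m))" by simp
  also have "\<dots> = (\<integral>\<^sup>+h. \<phi> (sqnorm (Suc m) x * cmod (det (gram R m (\<lambda>p\<in>{..<R} \<times> {..<m}. h p)))) \<partial>channel_law R (Suc m))"
  proof (rule nn_integral_cong)
    fix h
    have "gram R m h = gram R m (\<lambda>p\<in>{..<R} \<times> {..<m}. h p)" by (rule gram_cong) auto
    then show "\<phi> (sqnorm (Suc m) x * cmod (det (gram R m h))) = \<phi> (sqnorm (Suc m) x * cmod (det (gram R m (\<lambda>p\<in>{..<R} \<times> {..<m}. h p))))"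
      by simp
  qed
  also have "\<dots> = (\<integral>\<^sup>+h. \<phi> (sqnorm (Suc m) x * cmod (det (gram R m h))) \<partial>distr (channel_law R (Suc m)) (channel_law R m) (\<lambda>h. \<lambda>p\<in>{..<R} \<times> {..<m}. h p))"
  proof -
    have T: "(\<lambda>h. \<lambda>p\<in>{..<R} \<times> {..<m}. h p) \<in> measurable (channel_law R (Suc m)) (channel_law R m)"
      by (rule measurable_channel_law_reindex) auto
    have "(\<lambda>h. \<phi> (sqnorm (Suc m) x * cmod (det (gram R m h)))) \<in> borel_measurable (channel_law R m)"
      by (rule measurable_compose[OF _ \<phi>]) measurable
    then show ?thesis using nn_integral_distr[OF T] by simp
  qed
  also have "distr (channel_law R (Suc m)) (channel_law R m) (\<lambda>h. \<lambda>p\<in>{..<R} \<times> {..<m}. h p) = channel_law R m"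
    by (rule distr_channel_law_reindex) auto
  finally show ?thesis .
qed

text \<open>The Gamma law with shape n and rate 1 for n at least 1, as \<open>erlang_density\<close>
  counts shapes from 0.\<close>

definition gamma_law :: "nat \<Rightarrow> real measure" where
  "gamma_law n = density lborel (erlang_density (n - 1) 1)"

lemma sets_gamma_law [simp, measurable_cong]: "sets (gamma_law n) = sets borel"
  by (simp add: gamma_law_def)

lemma prob_space_gamma_law: "prob_space (gamma_law n)"
  unfolding gamma_law_def by (rule prob_space_erlang_density) simp

text \<open>Conditionally on the last row, the inner integral depends on that row only through its
  squared norm, a sum of m + 1 exponential variables. An identity of laws, checked on indicators,
  transfers nonvanishing, integrability and expectation alike.\<close>

lemma distr_cmod_det_gram:
  "distr (channel_law (Suc R) (Suc m)) borel (\<lambda>h. cmod (det (gram (Suc R) (Suc m) h))) =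
   distr (gamma_law (Suc m) \<Otimes>\<^sub>M channel_law R m) borel (\<lambda>(t, h). t * cmod (det (gram R m h)))"
proof (rule measure_eqI)
  fix A :: "real set" assume "A \<in> sets (distr (channel_law (Suc R) (Suc m)) borel (\<lambda>h. cmod (det (gram (Suc R) (Suc m) h))))"
  then have A [measurable]: "A \<in> sets borel" by simp
  let ?\<phi> = "indicator A :: real \<Rightarrow> ennreal"
  let ?I = "{R} \<times> {..<Suc m}" and ?J = "{..<R} \<times> {..<Suc m}"
  let ?P = "\<lambda>I. PiM I (\<lambda>_. cgauss) :: (nat \<times> nat \<Rightarrow> complex) measure"
  interpret L: prob_space "channel_law R m" by (rule prob_space_channel_law)
  interpret G: prob_space "gamma_law (Suc m)" by (rule prob_space_gamma_law)
  interpret pair_sigma_finite "gamma_law (Suc m)" "channel_law R m" ..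
  have IJ: "{..<Suc R} \<times> {..<Suc m} = ?I \<union> ?J" by auto
  have \<phi>: "?\<phi> \<in> borel_measurable borel" by simp
  have m1 [measurable]: "(\<lambda>z. ?\<phi> (fst z * cmod (det (gram R m (snd z))))) \<in> borel_measurable (gamma_law (Suc m) \<Otimes>\<^sub>M channel_law R m)"
    by measurable
  have m2: "(\<lambda>h. ?\<phi> (cmod (det (gram (Suc R) (Suc m) h)))) \<in> borel_measurable (channel_law (Suc R) (Suc m))"
    by measurable
  have "emeasure (distr (channel_law (Suc R) (Suc m)) borel (\<lambda>h. cmod (det (gram (Suc R) (Suc m) h)))) A =
    (\<integral>\<^sup>+h. ?\<phi> (cmod (det (gram (Suc R) (Suc m) h))) \<partial>channel_law (Suc R) (Suc m))"
    by (subst nn_integral_indicator[symmetric], simp, subst nn_integral_distr) auto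
  also have "\<dots> = (\<integral>\<^sup>+x. \<integral>\<^sup>+h. ?\<phi> (cmod (det (gram (Suc R) (Suc m) (merge ?I ?J (x, h))))) \<partial>?P ?J \<partial>?P ?I)"
    using m2 unfolding channel_law_def IJ
    by (intro cgauss_product.product_nn_integral_fold) auto
  also have "\<dots> = (\<integral>\<^sup>+x. \<integral>\<^sup>+h. ?\<phi> (cmod (det (gram (Suc R) (Suc m) (add_row R h (\<lambda>i. x (R, i)))))) \<partial>channel_law R (Suc m) \<partial>?P ?I)"
  proof -
    have "gram (Suc R) (Suc m) (merge ?I ?J (x, h)) = gram (Suc R) (Suc m) (add_row R h (\<lambda>i. x (R, i)))" for x h
      by (rule gram_cong) (auto simp: add_row_def merge_def)
    then show ?thesis by (simp only: channel_law_def)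
  qed
  also have "\<dots> = (\<integral>\<^sup>+x. \<integral>\<^sup>+h. ?\<phi> (sqnorm (Suc m) (\<lambda>i. x (R, i)) * cmod (det (gram R m h))) \<partial>channel_law R m \<partial>?P ?I)"
    by (simp only: nn_integral_det_add_row[OF \<phi>])
  also have "\<dots> = (\<integral>\<^sup>+x. (\<lambda>t. \<integral>\<^sup>+h. ?\<phi> (t * cmod (det (gram R m h))) \<partial>channel_law R m) (\<Sum>p\<in>?I. (cmod (x p))\<^sup>2) \<partial>?P ?I)"
  proof -
    have "(\<Sum>p\<in>?I. (cmod (x p))\<^sup>2) = sqnorm (Suc m) (\<lambda>i. x (R, i))" for x :: "nat \<times> nat \<Rightarrow> complex"
      unfolding sqnorm_def by (rule sum.reindex_bij_witness[of _ "\<lambda>i. (R, i)" snd]) auto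
    then show ?thesis by simp
  qed
  also have "\<dots> = (\<integral>\<^sup>+t. \<integral>\<^sup>+h. ?\<phi> (t * cmod (det (gram R m h))) \<partial>channel_law R m \<partial>distr (?P ?I) borel (\<lambda>x. \<Sum>p\<in>?I. (cmod (x p))\<^sup>2))"
  proof -
    have T: "(\<lambda>x. \<Sum>p\<in>?I. (cmod (x p))\<^sup>2) \<in> borel_measurable (?P ?I)" by measurable
    have "(\<lambda>t. \<integral>\<^sup>+h. ?\<phi> (t * cmod (det (gram R m h))) \<partial>channel_law R m) \<in> borel_measurable (gamma_law (Suc m))"
      by measurable
    then have "(\<lambda>t. \<integral>\<^sup>+h. ?\<phi> (t * cmod (det (gram R m h))) \<partial>channel_law R m) \<in> borel_measurable borel"
      by (simp cong: measurable_cong_sets)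
    then show ?thesis using nn_integral_distr[OF T] by simp
  qed
  also have "distr (?P ?I) borel (\<lambda>x. \<Sum>p\<in>?I. (cmod (x p))\<^sup>2) = gamma_law (Suc m)"
    by (subst distr_PiM_cgauss_sum_sq) (auto simp: gamma_law_def card_cartesian_product)
  also have "(\<integral>\<^sup>+t. \<integral>\<^sup>+h. ?\<phi> (t * cmod (det (gram R m h))) \<partial>channel_law R m \<partial>gamma_law (Suc m)) =
    (\<integral>\<^sup>+z. ?\<phi> (fst z * cmod (det (gram R m (snd z)))) \<partial>(gamma_law (Suc m) \<Otimes>\<^sub>M channel_law R m))"
    using L.nn_integral_fst[OF m1] by simp
  also have "\<dots> = emeasure (distr (gamma_law (Suc m) \<Otimes>\<^sub>M channel_law R m) borel (\<lambda>(t, h). t * cmod (det (gram R m h)))) A"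
    by (subst nn_integral_indicator[symmetric], simp, subst nn_integral_distr) (auto simp: split_beta')
  finally show "emeasure (distr (channel_law (Suc R) (Suc m)) borel (\<lambda>h. cmod (det (gram (Suc R) (Suc m) h)))) A =
    emeasure (distr (gamma_law (Suc m) \<Otimes>\<^sub>M channel_law R m) borel (\<lambda>(t, h). t * cmod (det (gram R m h)))) A" .
qed simp

subsection \<open>Logarithmic moments of the Gamma distribution\<close>

lemma integrable_powr_div_exp:
  assumes "s > (0::real)"
  shows "integrable lborel (\<lambda>t. indicator {0<..} t * (t powr (s - 1) / exp t))"
proof -
  have "(\<lambda>t. t powr (s - 1) / exp t) absolutely_integrable_on {0..}"
    using Gamma_integral_real[OF assms] by (intro nonnegative_absolutely_integrable_1) (auto simp: integrable_on_def)
  then have "(\<lambda>t. t powr (s - 1) / exp t) absolutely_integrable_on {0<..}"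
    by (rule set_integrable_subset) auto
  then have "integrable lebesgue (\<lambda>t. indicator {0<..} t * (t powr (s - 1) / exp t))"
    by (simp add: set_integrable_def)
  then show ?thesis by (subst (asm) integrable_completion) auto
qed

text \<open>Near 0 the bound is - ln x = 2 ln (x^(-1/2)). An exponent above -1 keeps the majorant
  integrable there.\<close>

lemma abs_ln_le:
  assumes "0 < (x::real)" shows "\<bar>ln x\<bar> \<le> x + 2 * x powr (- (1 / 2))"
proof (cases "1 \<le> x")
  case True
  then have "ln x \<le> x" using ln_le_minus_one[of x] by simp
  then show ?thesis using True by (simp add: add_increasing2)
next
  case False
  have "- ln x = 2 * ln (x powr (- (1 / 2)))" using assms by (simp add: ln_powr)
  also have "ln (x powr (- (1 / 2))) \<le> x powr (- (1 / 2))" using assms ln_le_minus_one[of "x powr (- (1 / 2))"] by simp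
  finally show ?thesis using False assms by simp
qed

text \<open>Multiplying x^k exp (- x) by the majorant of |ln x| gives the integrands of the Gamma
  function at k + 2 and k + 1/2.\<close>

lemma integrable_erlang_ln: "integrable lborel (\<lambda>x. erlang_density k 1 x * ln x)"
proof (rule Bochner_Integration.integrable_bound)
  let ?g = "\<lambda>s x. indicator {0<..} x * (x powr (s - 1) / exp x) :: real"
  show "integrable lborel (\<lambda>x. ?g (real k + 2) x + 2 * ?g (real k + 1 / 2) x)"
    by (intro Bochner_Integration.integrable_add Bochner_Integration.integrable_mult_right integrable_powr_div_exp) auto
  show "AE x in lborel. norm (erlang_density k 1 x * ln x) \<le> norm (?g (real k + 2) x + 2 * ?g (real k + 1 / 2) x)"
    using AE_lborel_singleton[of "0::real"]
  proof eventually_elim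
    case (elim x)
    show ?case
    proof (cases "0 < x")
      case True
      have e: "0 \<le> erlang_density k 1 x" "erlang_density k 1 x \<le> x ^ k / exp x"
        using True by (auto simp: erlang_density_def exp_minus field_simps mult_le_cancel_left1)
      have "norm (erlang_density k 1 x * ln x) = erlang_density k 1 x * \<bar>ln x\<bar>"
        using e by (simp add: abs_mult)
      also have "\<dots> \<le> x ^ k / exp x * (x + 2 * x powr (- (1 / 2)))"
        using e abs_ln_le[OF True] True by (intro mult_mono) auto
      also have "\<dots> = ?g (real k + 2) x + 2 * ?g (real k + 1 / 2) x"
      proof -
        have "x powr (real k + 2 - 1) = x powr (real (Suc k))" by (simp add: algebra_simps)
        also have "\<dots> = x ^ k * x" using True by (simp only: powr_realpow) simp
        finally have 1: "x powr (real k + 2 - 1) = x ^ k * x" .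
        have "x powr (real k + 1 / 2 - 1) = x powr (real k + (- (1 / 2)))" by simp
        also have "\<dots> = x ^ k * x powr (- (1 / 2))" using True by (simp only: powr_add powr_realpow)
        finally have 2: "x powr (real k + 1 / 2 - 1) = x ^ k * x powr (- (1 / 2))" .
        show ?thesis unfolding 1 2 using True by (simp add: distrib_left add_divide_distrib)
      qed
      finally show ?thesis by simp
    qed (use elim in \<open>simp add: erlang_density_def\<close>)
  qed
qed simp

lemma has_bochner_integral_erlang_density: "has_bochner_integral lborel (erlang_density k 1) 1"
proof (rule has_bochner_integral_nn_integral)
  interpret prob_space "density lborel (erlang_density k 1)" by (rule prob_space_erlang_density) simp
  show "(\<integral>\<^sup>+x. ennreal (erlang_density k 1 x) \<partial>lborel) = ennreal 1"
    using emeasure_space_1 by (simp add: emeasure_density)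
qed auto

lemmas integrable_erlang_density = has_bochner_integral_erlang_density[THEN integrable.intros]
lemmas integral_erlang_density = has_bochner_integral_erlang_density[THEN has_bochner_integral_integral_eq]

lemma integrable_gamma_law_ln: "integrable (gamma_law n) ln"
  unfolding gamma_law_def
  by (subst integrable_density) (auto simp: integrable_erlang_ln)

text \<open>For n at least 1 this is the digamma value \<psi>(n), kept as an integral because its
  recurrence is all that is used.\<close>

definition gamma_log_mean :: "nat \<Rightarrow> real" where
  "gamma_log_mean n = (\<integral>x. ln x \<partial>gamma_law n)"

text \<open>Integration by parts: the derivative of \<open>F\<close> is the difference of the
  integrands for n + 1 and n, minus the density of shape n divided by n, and \<open>F\<close>
  vanishes at both ends.\<close>

lemma gamma_log_mean_Suc:
  assumes n: "0 < n"
  shows "gamma_log_mean (Suc n) = gamma_log_mean n + 1 / n"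
proof -
  obtain k where k: "n = Suc k" using n by (cases n) auto
  let ?e = "\<lambda>k x. erlang_density k 1 x :: real"
  \<comment> \<open>Minus the density of shape n + 1 times ln x. Below, \<open>?e n\<close> has
    shape n + 1 and \<open>?e k\<close>, with k = n - 1, has shape n.\<close>
  define F where "F x = - (x ^ n / fact n * exp (- x) * ln x)" for x :: real
  define f where "f x = x ^ n / fact n * exp (- x) * ln x - x ^ k / fact k * exp (- x) * ln x - x ^ k / fact k * exp (- x) / n" for x :: real
  have fe: "f x = ?e n x * ln x - ?e k x * ln x - ?e k x / n" if "0 < x" for x
    using that by (simp add: f_def erlang_density_def)
  have der: "(F has_real_derivative f x) (at x)" if "0 < x" for x
  proof -
    have "(F has_real_derivative - ((of_nat n * x ^ (n - 1) / fact n * exp (- x) + x ^ n / fact n * (exp (- x) * - 1)) * ln x + x ^ n / fact n * exp (- x) * (1 / x))) (at x)"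
      unfolding F_def using that
      by (auto intro!: derivative_eq_intros simp: field_simps)
    also have "- ((of_nat n * x ^ (n - 1) / fact n * exp (- x) + x ^ n / fact n * (exp (- x) * - 1)) * ln x + x ^ n / fact n * exp (- x) * (1 / x)) = f x"
    proof -
      have "real n * x ^ (n - 1) / fact n = x ^ k / fact k" by (simp add: k field_simps del: of_nat_Suc)
      moreover have "x ^ n / fact n * exp (- x) * (1 / x) = x ^ k / fact k * exp (- x) / n"
        using that by (simp add: k field_simps)
      ultimately show ?thesis by (simp only: f_def) (simp add: algebra_simps)
    qed
    finally show ?thesis .
  qed
  have int: "integrable lborel (\<lambda>x. ?e n x * ln x - ?e k x * ln x - ?e k x / n)"
    by (intro Bochner_Integration.integrable_diff integrable_erlang_ln integrable_divide)
      (use integrable_erlang_density in auto)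
  have cont: "isCont f x" if "0 < x" for x
    unfolding f_def using that n by (intro continuous_intros) auto
  have AEeq: "AE x in lborel. indicator {0<..} x *\<^sub>R f x = ?e n x * ln x - ?e k x * ln x - ?e k x / n"
    using AE_lborel_singleton[of "0::real"]
    by eventually_elim (auto simp: fe indicator_def erlang_density_def)
  have fm: "(\<lambda>x. indicator {0<..} x *\<^sub>R f x) \<in> borel_measurable lborel" unfolding f_def by measurable
  have setint: "set_integrable lborel {0<..} f"
    unfolding set_integrable_def
    using int AEeq fm by (subst integrable_cong_AE) auto
  have "(LBINT x=0..\<infinity>. f x) = 0 - 0"
  proof (rule interval_integral_FTC_integrable)
    show "(F has_vector_derivative f x) (at x)" if "0 < ereal x" "ereal x < \<infinity>" for x
      using der that by (simp add: has_real_derivative_iff_has_vector_derivative)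
    show "isCont f x" if "0 < ereal x" "ereal x < \<infinity>" for x using cont that by simp
    show "set_integrable lborel (einterval 0 \<infinity>) f"
      using setint by (simp add: zero_ereal_def)
    \<comment> \<open>At 0 one power of x is paired with the logarithm, since x ln x tends to 0
      while x^k may be constant.\<close>
    have "((\<lambda>x. - (x ^ k) / fact n * (x * ln x * exp (- x))) \<longlongrightarrow> - (0 ^ k) / fact n * 0) (at_right (0::real))"
      by (intro tendsto_intros, simp, real_asymp)
    moreover have "(\<lambda>x. - (x ^ k) / fact n * (x * ln x * exp (- x))) = F"
      by (simp add: fun_eq_iff F_def k)
    ultimately have "(F \<longlongrightarrow> 0) (at_right 0)" by simp
    then show "((F \<circ> real_of_ereal) \<longlongrightarrow> 0) (at_right 0)"
      by (simp add: zero_ereal_def ereal_tendsto_simps)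
    \<comment> \<open>At infinity an extra power of x is borrowed so that the two factors x^(k + 2)
      / exp x and ln x / x both tend to 0.\<close>
    have "((\<lambda>x. - (x ^ (k + 2) / exp x / fact n) * (ln x / x)) \<longlongrightarrow> - (0 / fact n) * 0) (at_top :: real filter)"
      by (intro tendsto_intros tendsto_power_div_exp_0 ln_x_over_x_tendsto_0) auto
    moreover have "\<forall>\<^sub>F x in at_top. - (x ^ (k + 2) / exp x / fact n) * (ln x / x) = F x"
      using eventually_gt_at_top[of 0]
      by eventually_elim (simp add: F_def k exp_minus field_simps power2_eq_square)
    ultimately have "(F \<longlongrightarrow> - (0 / fact n) * 0) at_top" by (rule Lim_transform_eventually)
    then have "(F \<longlongrightarrow> 0) at_top" by simp
    then show "((F \<circ> real_of_ereal) \<longlongrightarrow> 0) (at_left \<infinity>)"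
      by (simp add: ereal_tendsto_simps)
  qed simp
  then have "0 = (\<integral>x. indicator {0<..} x *\<^sub>R f x \<partial>lborel)"
    using interval_integral_to_infinity_eq[of lborel 0 f] by (simp add: zero_ereal_def set_lebesgue_integral_def)
  also have "\<dots> = (\<integral>x. ?e n x * ln x - ?e k x * ln x - ?e k x / n \<partial>lborel)"
    by (rule integral_cong_AE[OF fm _ AEeq]) measurable
  also have "\<dots> = (\<integral>x. ?e n x * ln x \<partial>lborel) - (\<integral>x. ?e k x * ln x \<partial>lborel) - (\<integral>x. ?e k x \<partial>lborel) / n"
    by (subst Bochner_Integration.integral_diff Bochner_Integration.integral_diff; (intro Bochner_Integration.integrable_diff integrable_erlang_ln integrable_divide integrable_erlang_density)?)+ simp
  also have "(\<integral>x. ?e k x \<partial>lborel) = 1" by (rule integral_erlang_density)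
  finally show ?thesis
    unfolding gamma_log_mean_def gamma_law_def
    by (simp add: integral_density k)
qed

lemma gamma_log_mean_eq_harm: "0 < n \<Longrightarrow> gamma_log_mean n = gamma_log_mean 1 + harm (n - 1)"
proof (induction n rule: nat_induct_non_zero)
  case (Suc n)
  then show ?case
    using harm_Suc[of "n - 1", where 'a = real] by (simp add: gamma_log_mean_Suc inverse_eq_divide)
qed (simp add: harm_def)

subsection \<open>The expected loss\<close>

lemma (in prob_space) distr_pair_snd:
  assumes "sigma_finite_measure N"
  shows "distr (M \<Otimes>\<^sub>M N) N snd = N"
proof (rule measure_eqI)
  interpret N: sigma_finite_measure N by fact
  fix A assume "A \<in> sets (distr (M \<Otimes>\<^sub>M N) N snd)"
  then have A: "A \<in> sets N" by simp
  then have "emeasure (distr (M \<Otimes>\<^sub>M N) N snd) A = emeasure (M \<Otimes>\<^sub>M N) (space M \<times> A)"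
    by (auto simp: emeasure_distr space_pair_measure dest: sets.sets_into_space intro!: arg_cong2[where f = emeasure])
  then show "emeasure (distr (M \<Otimes>\<^sub>M N) N snd) A = emeasure N A"
    using A by (simp add: N.emeasure_pair_measure_Times emeasure_space_1)
qed simp

lemma AE_gamma_law_pos: "AE t in gamma_law n. 0 < t"
proof -
  have "AE t in lborel. 0 < ennreal (erlang_density (n - 1) 1 t) \<longrightarrow> 0 < t"
    using AE_lborel_singleton[of "0::real"]
    by eventually_elim (auto simp: erlang_density_def split: if_splits)
  then show ?thesis unfolding gamma_law_def by (subst AE_density) auto
qed

text \<open>The three claims are proved in one induction because the logarithm of the product splits
  only where both factors are nonzero. M is generalized, as each step removes a column together with
  a row.\<close>

lemma log_det_gram_expectation:
  assumes "R \<le> M"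
  shows "AE h in channel_law R M. det (gram R M h) \<noteq> 0"
    and "integrable (channel_law R M) (\<lambda>h. ln (cmod (det (gram R M h))))"
    and "(\<integral>h. ln (cmod (det (gram R M h))) \<partial>channel_law R M) = (\<Sum>i<R. gamma_log_mean (M - i))"
  using assms
proof (induction R arbitrary: M)
  case 0
  { case 1 then show ?case by (simp add: gram_def det_dim_zero) }
  { case 2 then show ?case by (simp add: gram_def det_dim_zero) }
  { case 3 then show ?case by (simp add: gram_def det_dim_zero) }
next
  case (Suc R)
  have all: "(AE h in channel_law (Suc R) M. det (gram (Suc R) M h) \<noteq> 0) \<and>
    integrable (channel_law (Suc R) M) (\<lambda>h. ln (cmod (det (gram (Suc R) M h)))) \<and>
    (\<integral>h. ln (cmod (det (gram (Suc R) M h))) \<partial>channel_law (Suc R) M) = (\<Sum>i<Suc R. gamma_log_mean (M - i))"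
    if RM: "Suc R \<le> M" for M
  proof -
    obtain m where M: "M = Suc m" "R \<le> m" using RM by (cases M) auto
    note IH = Suc.IH[OF M(2)]
    let ?L = "channel_law R m" and ?A = "gamma_law (Suc m)" and ?L' = "channel_law (Suc R) (Suc m)"
    let ?g = "\<lambda>h. cmod (det (gram R m h))" and ?g' = "\<lambda>h. cmod (det (gram (Suc R) (Suc m) h))"
    interpret L: prob_space ?L by (rule prob_space_channel_law)
    interpret A: prob_space ?A by (rule prob_space_gamma_law)
    interpret pair_sigma_finite ?A ?L ..
    note D = distr_cmod_det_gram[of R m]
    have pos: "AE z in ?A \<Otimes>\<^sub>M ?L. 0 < fst z \<and> 0 < ?g (snd z)"
    proof (rule AE_pair_measure)
      show "{z \<in> space (?A \<Otimes>\<^sub>M ?L). 0 < fst z \<and> 0 < ?g (snd z)} \<in> sets (?A \<Otimes>\<^sub>M ?L)" by measurable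
      show "AE t in ?A. AE h in ?L. 0 < fst (t, h) \<and> 0 < ?g (snd (t, h))"
        using AE_gamma_law_pos IH(1) by (auto elim!: eventually_mono)
    qed
    have m1 [measurable]: "(\<lambda>(t, h). t * ?g h) \<in> borel_measurable (?A \<Otimes>\<^sub>M ?L)" by measurable
    have "AE z in ?A \<Otimes>\<^sub>M ?L. (case z of (t, h) \<Rightarrow> t * ?g h) \<noteq> 0"
      using pos by eventually_elim (simp add: split_beta)
    then have "AE x in distr (?A \<Otimes>\<^sub>M ?L) borel (\<lambda>(t, h). t * ?g h). x \<noteq> 0"
      by (subst AE_distr_iff) auto
    then have "AE x in distr ?L' borel ?g'. x \<noteq> 0" unfolding D .
    then have 1: "AE h in ?L'. det (gram (Suc R) (Suc m) h) \<noteq> 0"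
      by (subst (asm) AE_distr_iff) auto
    have iA: "integrable (?A \<Otimes>\<^sub>M ?L) (\<lambda>z. ln (fst z))" "(\<integral>z. ln (fst z) \<partial>(?A \<Otimes>\<^sub>M ?L)) = gamma_log_mean (Suc m)"
    proof -
      have m: "fst \<in> measurable (?A \<Otimes>\<^sub>M ?L) ?A" "ln \<in> borel_measurable ?A" by measurable
      show "integrable (?A \<Otimes>\<^sub>M ?L) (\<lambda>z. ln (fst z))"
        using integrable_gamma_law_ln[of "Suc m"] integrable_distr_eq[OF m] by (simp add: L.distr_pair_fst)
      show "(\<integral>z. ln (fst z) \<partial>(?A \<Otimes>\<^sub>M ?L)) = gamma_log_mean (Suc m)"
        using integral_distr[OF m] by (simp add: L.distr_pair_fst gamma_log_mean_def)
    qed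
    have iL: "integrable (?A \<Otimes>\<^sub>M ?L) (\<lambda>z. ln (?g (snd z)))" "(\<integral>z. ln (?g (snd z)) \<partial>(?A \<Otimes>\<^sub>M ?L)) = (\<Sum>i<R. gamma_log_mean (m - i))"
    proof -
      have m: "snd \<in> measurable (?A \<Otimes>\<^sub>M ?L) ?L" "(\<lambda>h. ln (?g h)) \<in> borel_measurable ?L" by measurable
      have snd: "distr (?A \<Otimes>\<^sub>M ?L) ?L snd = ?L" by (rule A.distr_pair_snd) standard
      show "integrable (?A \<Otimes>\<^sub>M ?L) (\<lambda>z. ln (?g (snd z)))"
        using IH(2) integrable_distr_eq[OF m] by (simp add: snd)
      show "(\<integral>z. ln (?g (snd z)) \<partial>(?A \<Otimes>\<^sub>M ?L)) = (\<Sum>i<R. gamma_log_mean (m - i))"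
        using IH(3) integral_distr[OF m] by (simp add: snd)
    qed
    have AEeq: "AE z in ?A \<Otimes>\<^sub>M ?L. ln (case z of (t, h) \<Rightarrow> t * ?g h) = ln (fst z) + ln (?g (snd z))"
      using pos by eventually_elim (auto simp: ln_mult split_beta)
    have ml: "(\<lambda>z. ln (case z of (t, h) \<Rightarrow> t * ?g h)) \<in> borel_measurable (?A \<Otimes>\<^sub>M ?L)" by measurable
    have mr: "(\<lambda>z. ln (fst z) + ln (?g (snd z))) \<in> borel_measurable (?A \<Otimes>\<^sub>M ?L)" by measurable
    have "integrable (distr (?A \<Otimes>\<^sub>M ?L) borel (\<lambda>(t, h). t * ?g h)) ln"
      using iA iL AEeq by (subst integrable_distr_eq[OF m1], simp, subst integrable_cong_AE[OF ml mr]) auto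
    then have "integrable (distr ?L' borel ?g') ln" unfolding D .
    then have 2: "integrable ?L' (\<lambda>h. ln (?g' h))"
      by (subst (asm) integrable_distr_eq) auto
    have "(\<integral>h. ln (?g' h) \<partial>?L') = (\<integral>x. ln x \<partial>distr ?L' borel ?g')"
      by (subst integral_distr) auto
    also have "\<dots> = (\<integral>z. ln (case z of (t, h) \<Rightarrow> t * ?g h) \<partial>(?A \<Otimes>\<^sub>M ?L))"
      unfolding D by (subst integral_distr[OF m1]) auto
    also have "\<dots> = (\<integral>z. ln (fst z) + ln (?g (snd z)) \<partial>(?A \<Otimes>\<^sub>M ?L))"
      by (rule integral_cong_AE[OF ml mr AEeq])
    also have "\<dots> = gamma_log_mean (Suc m) + (\<Sum>i<R. gamma_log_mean (m - i))"
      using iA iL by simp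
    also have "\<dots> = (\<Sum>i<Suc R. gamma_log_mean (Suc m - i))"
      by (subst sum.lessThan_Suc_shift) simp
    finally have 3: "(\<integral>h. ln (?g' h) \<partial>?L') = (\<Sum>i<Suc R. gamma_log_mean (Suc m - i))" .
    show ?thesis unfolding M(1) by (intro conjI 1 2 3)
  qed
  { case 1 then show ?case using all by blast }
  { case 2 then show ?case using all by blast }
  { case 3 then show ?case using all by blast }
qed

section \<open>Channels with one row deleted\<close>

lemma mat_delete_gram:
  assumes "r < Suc R"
  shows "mat_delete (gram (Suc R) M h) r r = gram R M (\<lambda>(i, j). h (insert_index r i, j))"
  using assms by (intro eq_matI) (auto simp: mat_delete_def gram_def insert_index_def)

text \<open>The remaining R rows still have all M columns and form a Gaussian channel again,
  whichever row was deleted.\<close>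

lemma log_det_delete_row_expectation:
  assumes r: "r < Suc R" and M: "Suc R \<le> M"
  shows "AE h in channel_law (Suc R) M. det (mat_delete (gram (Suc R) M h) r r) \<noteq> 0"
    and "integrable (channel_law (Suc R) M) (\<lambda>h. ln (cmod (det (mat_delete (gram (Suc R) M h) r r))))"
    and "(\<integral>h. ln (cmod (det (mat_delete (gram (Suc R) M h) r r))) \<partial>channel_law (Suc R) M) = (\<Sum>i<R. gamma_log_mean (M - i))"
proof -
  let ?I = "{..<R} \<times> {..<M}"
  define f :: "nat \<times> nat \<Rightarrow> nat \<times> nat" where "f = (\<lambda>(i, j). (insert_index r i, j))"
  define T where "T h = (\<lambda>p\<in>?I. h (f p))" for h :: "nat \<times> nat \<Rightarrow> complex"
  have f: "inj_on f ?I" "f \<in> ?I \<rightarrow> {..<Suc R} \<times> {..<M}"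
    using r by (auto simp: f_def inj_on_def insert_index_def split: if_splits)
  have D: "distr (channel_law (Suc R) M) (channel_law R M) T = channel_law R M"
    unfolding T_def[abs_def] by (rule distr_channel_law_reindex[OF f])
  have T: "T \<in> measurable (channel_law (Suc R) M) (channel_law R M)"
    unfolding T_def[abs_def] by (rule measurable_channel_law_reindex[OF f(2)])
  have eq: "mat_delete (gram (Suc R) M h) r r = gram R M (T h)" for h
    unfolding mat_delete_gram[OF r] by (rule gram_cong) (auto simp: T_def f_def)
  have RM: "R \<le> M" using M by simp
  note E = log_det_gram_expectation[OF RM]
  have m: "(\<lambda>h. ln (cmod (det (gram R M h)))) \<in> borel_measurable (channel_law R M)" by measurable
  have "AE h in distr (channel_law (Suc R) M) (channel_law R M) T. det (gram R M h) \<noteq> 0"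
    using E(1) unfolding D .
  from AE_distrD[OF T this] show "AE h in channel_law (Suc R) M. det (mat_delete (gram (Suc R) M h) r r) \<noteq> 0"
    unfolding eq .
  show "integrable (channel_law (Suc R) M) (\<lambda>h. ln (cmod (det (mat_delete (gram (Suc R) M h) r r))))"
    using E(2) integrable_distr_eq[OF T m] by (simp add: eq D)
  show "(\<integral>h. ln (cmod (det (mat_delete (gram (Suc R) M h) r r))) \<partial>channel_law (Suc R) M) = (\<Sum>i<R. gamma_log_mean (M - i))"
    using E(3) integral_distr[OF T m] by (simp add: eq D)
qed

text \<open>The sum for det G exceeds that for a deleted row by its last term alone, so each log
  gain has mean \<psi>(M - KN + 1), the same for every row.\<close>

lemma beta_DPC_ZF_eq:
  assumes KN: "0 < K * N" and M: "K * N \<le> M"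
  shows "beta_DPC_ZF K N M =
    ((\<Sum>i<K * N. gamma_log_mean (M - i)) - real (K * N) * gamma_log_mean (Suc (M - K * N))) / ln 2"
proof -
  obtain R where R: "K * N = Suc R" using KN by (cases "K * N") auto
  let ?L = "channel_law (Suc R) M"
  let ?d = "\<lambda>h. ln (cmod (det (gram (Suc R) M h)))"
  let ?D = "\<lambda>r h. ln (cmod (det (mat_delete (gram (Suc R) M h) r r)))"
  have RM: "Suc R \<le> M" using M R by simp
  note E = log_det_gram_expectation[OF RM]
  note E' = log_det_delete_row_expectation[OF _ RM]
  have "AE h in ?L. \<forall>r\<in>{..<Suc R}. det (mat_delete (gram (Suc R) M h) r r) \<noteq> 0"
    using E'(1) by (subst AE_finite_all) auto
  then have AE: "AE h in ?L. Lim at_top (\<lambda>P. C_DPC K N M (chan_mat (K * N) M h) P - C_ZF (K * N) M (chan_mat (K * N) M h) P) =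
     (?d h - (\<Sum>r<Suc R. ?d h - ?D r h)) / ln 2"
    using E(1)
  proof eventually_elim
    case (elim h)
    have "Lim at_top (\<lambda>P. C_DPC K N M (chan_mat (K * N) M h) P - C_ZF (K * N) M (chan_mat (K * N) M h) P) =
      log 2 (cmod (det (gram (K * N) M h))) -
     (\<Sum>r<K * N. log 2 (cmod (det (gram (K * N) M h))) - log 2 (cmod (det (mat_delete (gram (K * N) M h) r r))))"
      by (rule tendsto_Lim[OF _ rate_loss_tendsto[OF KN]]) (use elim in \<open>auto simp: R\<close>)
    then show ?case
      by (simp only: R log_def diff_divide_distrib sum_divide_distrib)
  qed
  have int: "integrable ?L (\<lambda>h. \<Sum>r<Suc R. ?d h - ?D r h)"
    by (intro Bochner_Integration.integrable_sum Bochner_Integration.integrable_diff E(2) E'(2)) auto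
  have "beta_DPC_ZF K N M = (\<integral>h. (?d h - (\<Sum>r<Suc R. ?d h - ?D r h)) / ln 2 \<partial>?L)"
    unfolding beta_DPC_ZF_def R[symmetric]
  \<comment> \<open>Replacing the limit by its almost sure value inside the Bochner integral needs
    the limit to be measurable for all channels.\<close>
  proof (rule integral_cong_AE[OF borel_measurable_rate_loss])
    show "(\<lambda>h. (ln (cmod (det (gram (K * N) M h))) - (\<Sum>r<K * N. ln (cmod (det (gram (K * N) M h))) -
        ln (cmod (det (mat_delete (gram (K * N) M h) r r))))) / ln 2) \<in> borel_measurable (channel_law (K * N) M)"
      unfolding R by (intro borel_measurable_integrable integrable_divide Bochner_Integration.integrable_diff E(2) int)
  qed (insert AE, unfold R, assumption)
  also have "\<dots> = ((\<integral>h. ?d h \<partial>?L) - (\<Sum>r<Suc R. (\<integral>h. ?d h \<partial>?L) - (\<integral>h. ?D r h \<partial>?L))) / ln 2"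
    using E(2) E'(2) int by (simp add: Bochner_Integration.integral_diff Bochner_Integration.integral_sum del: sum.lessThan_Suc)
  also have "\<dots> = ((\<Sum>i<Suc R. gamma_log_mean (M - i)) - (\<Sum>r<Suc R. (\<Sum>i<Suc R. gamma_log_mean (M - i)) - (\<Sum>i<R. gamma_log_mean (M - i)))) / ln 2"
    using E(3) E'(3) by (intro arg_cong2[where f = "(/)"] arg_cong2[where f = "(-)"] sum.cong refl) auto
  also have "\<dots> = ((\<Sum>i<Suc R. gamma_log_mean (M - i)) - real (Suc R) * gamma_log_mean (M - R)) / ln 2"
    by (simp add: algebra_simps)
  also have "M - R = Suc (M - Suc R)" using RM by simp
  finally show ?thesis by (simp only: R)
qed

section \<open>Harmonic numbers and the limit\<close>

lemma sum_harm_diff: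
  assumes "Suc R \<le> M"
  shows "(\<Sum>i<Suc R. harm (M - 1 - i)) = real M * harm (M - 1) - real (M - Suc R) * harm (M - Suc R) - real R"
  using assms
proof (induction R)
  case 0
  then show ?case by (simp add: of_nat_diff algebra_simps)
next
  case (Suc R)
  define n where "n = M - Suc (Suc R)"
  have n: "M - Suc R = Suc n" "M - 1 - Suc R = n" using Suc.prems by (auto simp: n_def)
  have "(\<Sum>i<Suc (Suc R). harm (M - 1 - i)) = real M * harm (M - 1) - real (Suc n) * harm (Suc n) - real R + harm n"
    using Suc n by simp
  also have "real (Suc n) * harm (Suc n) = real (Suc n) * harm n + 1"
    by (simp add: harm_Suc distrib_left)
  finally show ?case by (simp add: n_def[symmetric] algebra_simps)
qed

text \<open>Both sides of the difference contain \<psi>(1) exactly KN times, so it cancels. The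
  multiples M - KN and KN of H(M - KN) add up to M, and M H(M - 1) = M H(M) - 1 turns the subtracted
  KN - 1 into KN.\<close>

lemma Delta_DPC_ZF_eq:
  assumes KN: "0 < K * N" and M: "K * N \<le> M"
  shows "Delta_DPC_ZF K N M =
    3 / ln 2 * (real M / real (K * N) * (harm M - harm (M - K * N)) - 1)"
proof -
  obtain R where R: "K * N = Suc R" using KN by (cases "K * N") auto
  have RM: "Suc R \<le> M" using M R by simp
  have "(\<Sum>i<Suc R. gamma_log_mean (M - i)) = (\<Sum>i<Suc R. gamma_log_mean 1 + harm (M - 1 - i))"
    using RM by (intro sum.cong refl trans[OF gamma_log_mean_eq_harm]) (auto simp: diff_commute)
  also have "\<dots> = real (Suc R) * gamma_log_mean 1 + (real M * harm (M - 1) - real (M - Suc R) * harm (M - Suc R) - real R)"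
    unfolding sum.distrib sum_harm_diff[OF RM] by simp
  finally have 1: "(\<Sum>i<Suc R. gamma_log_mean (M - i)) = real (Suc R) * gamma_log_mean 1 +
    (real M * harm (M - 1) - real (M - Suc R) * harm (M - Suc R) - real R)" .
  have 2: "gamma_log_mean (Suc (M - Suc R)) = gamma_log_mean 1 + harm (M - Suc R)"
    using gamma_log_mean_eq_harm[of "Suc (M - Suc R)"] by simp
  obtain m where m: "M = Suc m" using RM by (cases M) auto
  have 3: "real M * harm (M - 1) = real M * harm M - 1"
    by (simp add: m harm_Suc distrib_left del: of_nat_Suc)
  have "beta_DPC_ZF K N M = (real M * (harm M - harm (M - Suc R)) - real (Suc R)) / ln 2"
    unfolding beta_DPC_ZF_eq[OF KN M] R 1 2 3 using RM
    by (simp add: of_nat_diff algebra_simps)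
  then have "Delta_DPC_ZF K N M = 3 / ln 2 * ((real M * (harm M - harm (M - Suc R)) - real (Suc R)) / real (Suc R))"
    unfolding Delta_DPC_ZF_def R by simp
  then show ?thesis unfolding R diff_divide_distrib by simp
qed

theorem theorem3:
  fixes \<alpha> :: real
  assumes "\<alpha> > 1"
  shows "\<forall>\<epsilon>>0. \<exists>L. \<forall>K N M :: nat. 1 \<le> K \<longrightarrow> 1 \<le> N \<longrightarrow> L \<le> K * N \<longrightarrow>
           real M = \<alpha> * real (K * N) \<longrightarrow>
           \<bar>Delta_DPC_ZF K N M - (- 3 * (log 2 (exp 1) + \<alpha> * log 2 (1 - 1 / \<alpha>)))\<bar> < \<epsilon>"
proof (intro allI impI)
  fix \<epsilon> :: real assume \<epsilon>: "0 < \<epsilon>"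
  \<comment> \<open>Two harmonic numbers are each approximated up to \<delta>, and the result is
    multiplied by 3 \<alpha> / ln 2.\<close>
  define \<delta> where "\<delta> = \<epsilon> * ln 2 / (6 * \<alpha>)"
  have \<delta>: "0 < \<delta>" using \<epsilon> assms by (simp add: \<delta>_def)
  have "\<forall>\<^sub>F n in sequentially. dist (harm n - ln (real n)) euler_mascheroni < \<delta>"
    by (rule tendstoD[OF euler_mascheroni_LIMSEQ \<delta>])
  then obtain n0 where n0: "\<And>n. n0 \<le> n \<Longrightarrow> \<bar>harm n - ln (real n) - euler_mascheroni\<bar> < \<delta>"
    unfolding eventually_sequentially dist_real_def by auto
  \<comment> \<open>The smaller harmonic index is M - KN = (\<alpha> - 1) KN, so this L pushes both
    indices beyond \<open>n0\<close>.\<close>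
  obtain L :: nat where L: "real n0 / (\<alpha> - 1) \<le> real L" using real_arch_simple by blast
  show "\<exists>L. \<forall>K N M :: nat. 1 \<le> K \<longrightarrow> 1 \<le> N \<longrightarrow> L \<le> K * N \<longrightarrow>
           real M = \<alpha> * real (K * N) \<longrightarrow>
           \<bar>Delta_DPC_ZF K N M - (- 3 * (log 2 (exp 1) + \<alpha> * log 2 (1 - 1 / \<alpha>)))\<bar> < \<epsilon>"
  proof (intro exI[of _ L] allI impI)
    fix K N M :: nat
    assume K: "1 \<le> K" and N: "1 \<le> N" and LKN: "L \<le> K * N" and M: "real M = \<alpha> * real (K * N)"
    let ?R = "K * N"
    have R: "0 < ?R" using K N by simp
    have "real ?R < real M" using M R assms by simp
    then have RM: "?R < M" by (simp only: of_nat_less_iff)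
    have MR: "real (M - ?R) = (\<alpha> - 1) * real ?R" using RM M by (simp add: of_nat_diff algebra_simps)
    have "real n0 \<le> (\<alpha> - 1) * real L" using L assms by (simp add: field_simps)
    also have "\<dots> \<le> real (M - ?R)" unfolding MR using LKN assms by (intro mult_left_mono, simp only: of_nat_le_iff, simp)
    finally have "n0 \<le> M - ?R" by simp
    then have n: "\<bar>harm (M - ?R) - ln (real (M - ?R)) - euler_mascheroni\<bar> < \<delta>"
      "\<bar>harm M - ln (real M) - euler_mascheroni\<bar> < \<delta>" by (auto intro!: n0)
    have "1 - 1 / \<alpha> = real (M - ?R) / real M" unfolding MR M using R assms by (simp add: field_simps)
    then have ln: "ln (1 - 1 / \<alpha>) = ln (real (M - ?R)) - ln (real M)"
      using RM by (simp add: ln_div del: of_nat_mult of_nat_diff)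
    \<comment> \<open>The Euler-Mascheroni constants cancel in this difference, and the logarithms
      combine to ln ((M - KN) / M) = ln (1 - 1 / \<alpha>) exactly, leaving only the two
      approximation errors.\<close>
    define e where "e = harm M - harm (M - ?R) + ln (1 - 1 / \<alpha>)"
    have e: "\<bar>e\<bar> < 2 * \<delta>" using n unfolding e_def ln by linarith
    have "Delta_DPC_ZF K N M = 3 / ln 2 * (\<alpha> * (harm M - harm (M - ?R)) - 1)"
      unfolding Delta_DPC_ZF_eq[OF R less_imp_le[OF RM]] M using R by simp
    moreover have "- 3 * (log 2 (exp 1) + \<alpha> * log 2 (1 - 1 / \<alpha>)) = 3 / ln 2 * (- \<alpha> * ln (1 - 1 / \<alpha>) - 1)"
      by (simp add: log_def field_simps)
    ultimately have "Delta_DPC_ZF K N M - (- 3 * (log 2 (exp 1) + \<alpha> * log 2 (1 - 1 / \<alpha>))) = 3 / ln 2 * \<alpha> * e"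
      by (simp only: e_def) (simp add: field_simps)
    then have "\<bar>Delta_DPC_ZF K N M - (- 3 * (log 2 (exp 1) + \<alpha> * log 2 (1 - 1 / \<alpha>)))\<bar> = 3 / ln 2 * \<alpha> * \<bar>e\<bar>"
      using assms by (simp add: abs_mult)
    also have "\<dots> < 3 / ln 2 * \<alpha> * (2 * \<delta>)" using e assms by (intro mult_strict_left_mono) auto
    also have "\<dots> = \<epsilon>" using assms by (simp add: \<delta>_def field_simps)
    finally show "\<bar>Delta_DPC_ZF K N M - (- 3 * (log 2 (exp 1) + \<alpha> * log 2 (1 - 1 / \<alpha>)))\<bar> < \<epsilon>" .
  qed
qed


end
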